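(* Let $(X,\mathbb{Z}^k,T)$ be a dynamical system (compact metric space with continuous $\mathbb{Z}^k$-action) having the marker property. Then there exists a metric $d$ on $X$ compatible with the topology such that $\mathrm{mdim}_M(X,d)=\mathrm{mdim}(X)$.
   Context: Notation: $T^nx=T(n,x)$, $|\cdot|$ Euclidean norm, $[N]=\{0,\dots,N-1\}^k$, $d_\Omega(x,y)=\sup_{n\in\Omega}d(T^nx,T^ny)$ for $\Omega\subset\mathbb{Z}^k$. Marker property: for every finite $F\subset\mathbb{Z}^k$ there is an open $U\subset X$ with $X=\bigcup_{n}T^nU$ and $U\cap T^nU=\emptyset$ for all nonzero $n\in F$. Mean dimension: a continuous map $f:(X,d)\to Y$ is an $\varepsilon$-embedding if $\mathrm{diam}\,f^{-1}(y)<\varepsilon$ for all $y$; $\mathrm{widim}_\varepsilon(X,d)$ is the minimal dimension of a finite simplicial complex admitting an $\varepsilon$-embedding of $(X,d)$; $\mathrm{mdim}(X)=\lim_{\varepsilon\to0}\lim_{N\to\infty}N^{-k}\mathrm{widim}_\varepsilon(X,d_{[N]})$. Metric mean dimension: $A(X,\varepsilon,d)$ is the minimal cardinality of an open cover of $X$ all of whose members have $d$-diameter $<\varepsilon$; $S(X,\varepsilon,d)=\lim_{N\to\infty}N^{-k}\log A(X,\varepsilon,d_{[N]})$; $\mathrm{mdim}_M(X,d)=\liminf_{\varepsilon\to0}S(X,\varepsilon,d)/|\log\varepsilon|$. *)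

theory Defs
  imports "HOL-Analysis.Analysis"
begin

definition Zk_system :: "'a::metric_space set \<Rightarrow> (int^'k::finite \<Rightarrow> 'a \<Rightarrow> 'a) \<Rightarrow> bool" where
  "Zk_system X T \<longleftrightarrow> compact X \<and>
     (\<forall>n. continuous_on X (T n) \<and> T n ` X \<subseteq> X) \<and>
     (\<forall>x\<in>X. T 0 x = x) \<and>
     (\<forall>m n. \<forall>x\<in>X. T (m + n) x = T m (T n x))"

definition marker_property :: "'a::metric_space set \<Rightarrow> (int^'k::finite \<Rightarrow> 'a \<Rightarrow> 'a) \<Rightarrow> bool" where
  "marker_property X T \<longleftrightarrow> (\<forall>F. finite F \<longrightarrow>
     (\<exists>U. openin (top_of_set X) U \<and> X = (\<Union>n. T n ` U) \<and>
          (\<forall>n\<in>F. n \<noteq> 0 \<longrightarrow> U \<inter> T n ` U = {})))"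

definition cube :: "nat \<Rightarrow> (int^'k::finite) set" where
  "cube N = {n. \<forall>i. 0 \<le> n $ i \<and> n $ i < int N}"

definition dyn_metric :: "(int^'k::finite \<Rightarrow> 'a \<Rightarrow> 'a) \<Rightarrow> (int^'k) set \<Rightarrow> ('a \<Rightarrow> 'a \<Rightarrow> real) \<Rightarrow> 'a \<Rightarrow> 'a \<Rightarrow> real" where
  "dyn_metric T \<Omega> D x y = Sup ((\<lambda>n. D (T n x) (T n y)) ` \<Omega>)"

definition diam_wrt :: "('a \<Rightarrow> 'a \<Rightarrow> real) \<Rightarrow> 'a set \<Rightarrow> real" where
  "diam_wrt D S = (if S = {} then 0 else Sup {D x y | x y. x \<in> S \<and> y \<in> S})"

text \<open>Finite (abstract) simplicial complexes on vertex set nat, with their geometric realization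
  in the space of functions nat => real (product topology).\<close>
definition simplicial_cx :: "nat set set \<Rightarrow> bool" where
  "simplicial_cx K \<longleftrightarrow> finite K \<and> (\<forall>\<sigma>\<in>K. \<sigma> \<noteq> {} \<and> finite \<sigma>) \<and>
     (\<forall>\<sigma>\<in>K. \<forall>\<tau>. \<tau> \<noteq> {} \<and> \<tau> \<subseteq> \<sigma> \<longrightarrow> \<tau> \<in> K)"

definition realization :: "nat set set \<Rightarrow> (nat \<Rightarrow> real) set" where
  "realization K = {t. (\<forall>i. 0 \<le> t i) \<and> (\<exists>\<sigma>\<in>K. {i. t i \<noteq> 0} \<subseteq> \<sigma> \<and> sum t \<sigma> = 1)}"

definition cx_dim :: "nat set set \<Rightarrow> nat" where
  "cx_dim K = Max ((\<lambda>\<sigma>. card \<sigma> - 1) ` K)"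

definition eps_embedding :: "'a::topological_space set \<Rightarrow> ('a \<Rightarrow> 'a \<Rightarrow> real) \<Rightarrow> real \<Rightarrow> ('a \<Rightarrow> 'b::topological_space) \<Rightarrow> 'b set \<Rightarrow> bool" where
  "eps_embedding X D \<epsilon> f Y \<longleftrightarrow> continuous_on X f \<and> f ` X \<subseteq> Y \<and>
     (\<forall>y. diam_wrt D {x\<in>X. f x = y} < \<epsilon>)"

definition widim :: "'a::topological_space set \<Rightarrow> ('a \<Rightarrow> 'a \<Rightarrow> real) \<Rightarrow> real \<Rightarrow> nat" where
  "widim X D \<epsilon> = (LEAST n. \<exists>K f. simplicial_cx K \<and> cx_dim K = n \<and>
        eps_embedding X D \<epsilon> f (realization K))"

definition mdim :: "'a::metric_space set \<Rightarrow> (int^'k::finite \<Rightarrow> 'a \<Rightarrow> 'a) \<Rightarrow> ereal" where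
  "mdim X T = Lim (at_right 0) (\<lambda>\<epsilon>.
     lim (\<lambda>N. ereal (real (widim X (dyn_metric T (cube N) dist) \<epsilon>) / real N ^ CARD('k))))"

definition cover_num :: "'a::topological_space set \<Rightarrow> ('a \<Rightarrow> 'a \<Rightarrow> real) \<Rightarrow> real \<Rightarrow> nat" where
  "cover_num X D \<epsilon> = Inf {card \<U> | \<U>. finite \<U> \<and> \<Union>\<U> = X \<and>
       (\<forall>U\<in>\<U>. openin (top_of_set X) U \<and> diam_wrt D U < \<epsilon>)}"

definition mdim_M :: "'a::metric_space set \<Rightarrow> (int^'k::finite \<Rightarrow> 'a \<Rightarrow> 'a) \<Rightarrow> ('a \<Rightarrow> 'a \<Rightarrow> real) \<Rightarrow> ereal" where
  "mdim_M X T d = Liminf (at_right 0) (\<lambda>\<epsilon>.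
     lim (\<lambda>N. ereal (ln (real (cover_num X (dyn_metric T (cube N) d) \<epsilon>)) / real N ^ CARD('k)))
       / ereal \<bar>ln \<epsilon>\<bar>)"

end

theory Submission
  imports Defs
begin

text \<open>
  Both averages over cubes converge to their infimum, so a bound on a single cube bounds the rate.

  Lower bound, for every compatible \<open>d\<close>: Lipschitz bump functions along the orbit map \<open>X\<close> into a
  cube \<open>[0,1]\<^sup>I\<close>. If few sets of small \<open>d\<close>-diameter cover \<open>X\<close>, counting yields a grid point that every
  image point approaches in few coordinates; pushing the other coordinates to 0 or 1 gives an
  \<open>\<epsilon>\<close>-embedding into a skeleton of small dimension.

  Upper bound: it suffices to approximate any pseudometric uniformly by one with small covering
  numbers at some small scale, and then to pass to a limit as in Baire's theorem. Let \<open>\<pi>\<close> be an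
  \<open>\<epsilon>\<close>-embedding for the metric of an \<open>N\<close>-cube into a complex whose dimension is close to the
  optimal \<open>mdim N\<^sup>k\<close>. The marker function gives a power diagram on the lattice that
  depends continuously on the point. Most sites are well inside a cell; there the cell is cut into
  \<open>N\<close>-cubes, and the distance functions on such a cube are replaced by Lipschitz functions of \<open>\<pi>\<close> at
  its corner. Elsewhere one interpolates with the original functions. An orbit is then coded by one
  point of the complex per cube, plus finitely many real numbers at each of the few other sites.
\<close>

section \<open>Continuous pseudometrics\<close>

text \<open>Why markers: a metric is one function on \<open>X\<close>, so at \<open>T p x\<close> it
  must know where \<open>p\<close> sits inside its coding box. A fixed tiling of the lattice cannot
  tell; a tiling read off the point continuously and equivariantly can. Periodic points obstruct
  such a choice, and the marker property excludes them. Why the constant is sharp: a point of an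
  \<open>n\<close>-dimensional complex rounded to mesh \<open>1 / q\<close> costs about
  \<open>n * ln q\<close>. One such point per box gives nearly the mean dimension times
  \<open>ln q\<close> per site. The numbers of vertices and of possible centres and the Lipschitz
  constants do not depend on \<open>q\<close>, so \<open>q\<close> is chosen last and they vanish
  against \<open>ln q\<close>. Only the badly placed sites also cost a multiple of
  \<open>ln q\<close>; hence their density must be small, which the shrinking factor
  \<open>t\<close> close to 1 ensures. Why approximation suffices: metric mean dimension is a lower
  limit, so one good scale per step is enough. As one cube already bounds the covering rate, being
  good at that scale survives a small uniform change of the metric.\<close>

definition cont_pseudometric :: "'a::metric_space set \<Rightarrow> ('a \<Rightarrow> 'a \<Rightarrow> real) \<Rightarrow> bool" where
  "cont_pseudometric X D \<longleftrightarrow> continuous_on (X \<times> X) (\<lambda>z. D (fst z) (snd z)) \<and>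
     (\<forall>x\<in>X. D x x = 0) \<and> (\<forall>x\<in>X. \<forall>y\<in>X. D x y = D y x) \<and>
     (\<forall>x\<in>X. \<forall>y\<in>X. \<forall>z\<in>X. D x z \<le> D x y + D y z)"

lemma cont_pseudometricD:
  assumes "cont_pseudometric X D"
  shows "continuous_on (X \<times> X) (\<lambda>z. D (fst z) (snd z))"
    and "\<And>x. x \<in> X \<Longrightarrow> D x x = 0"
    and "\<And>x y. x \<in> X \<Longrightarrow> y \<in> X \<Longrightarrow> D x y = D y x"
    and "\<And>x y z. x \<in> X \<Longrightarrow> y \<in> X \<Longrightarrow> z \<in> X \<Longrightarrow> D x z \<le> D x y + D y z"
  using assms unfolding cont_pseudometric_def by blast+

lemma cont_pseudometric_nonneg:
  assumes "cont_pseudometric X D" "x \<in> X" "y \<in> X"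
  shows "0 \<le> D x y"
  using cont_pseudometricD(2)[OF assms(1,2)] cont_pseudometricD(3)[OF assms]
    cont_pseudometricD(4)[OF assms(1,2,3,2)] by linarith

lemma cont_pseudometric_dist: "cont_pseudometric X dist"
  unfolding cont_pseudometric_def
  by (auto simp: dist_commute dist_triangle intro!: continuous_intros)

lemma cont_pseudometric_compose:
  assumes "cont_pseudometric X D" "continuous_on S f" "continuous_on S g" "f ` S \<subseteq> X" "g ` S \<subseteq> X"
  shows "continuous_on S (\<lambda>s. D (f s) (g s))"
proof -
  have "continuous_on S (\<lambda>s. (f s, g s))" by (intro continuous_intros assms)
  moreover have "(\<lambda>s. (f s, g s)) ` S \<subseteq> X \<times> X" using assms by auto
  ultimately show ?thesis
    using continuous_on_compose2[OF cont_pseudometricD(1)[OF assms(1)]] by fastforce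
qed

lemma cont_pseudometric_bounded:
  assumes "compact X" "cont_pseudometric X D"
  obtains B where "B > 0" "\<And>x y. x \<in> X \<Longrightarrow> y \<in> X \<Longrightarrow> D x y \<le> B"
proof -
  have "compact ((\<lambda>z. D (fst z) (snd z)) ` (X \<times> X))"
    by (intro compact_continuous_image cont_pseudometricD assms compact_Times)
  then obtain B where B: "\<And>x. x \<in> (\<lambda>z. D (fst z) (snd z)) ` (X \<times> X) \<Longrightarrow> norm x \<le> B"
    using compact_imp_bounded bounded_iff by metis
  have "D x y \<le> max B 1" if "x \<in> X" "y \<in> X" for x y
    using B[of "D x y"] that by force
  then show ?thesis using that[of "max B 1"] by simp
qed

lemma cont_pseudometric_diff_le:
  assumes "cont_pseudometric X D" "x \<in> X" "y \<in> X" "x' \<in> X" "y' \<in> X"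
  shows "D x y \<le> D x x' + D x' y' + D y y'"
  using cont_pseudometricD(4)[OF assms(1), of x x' y] cont_pseudometricD(4)[OF assms(1), of x' y' y]
    cont_pseudometricD(3)[OF assms(1), of y y'] assms by linarith

lemma cont_pseudometric_small:
  assumes "compact X" "cont_pseudometric X D" "e > 0"
  obtains r where "r > 0" "\<And>x y. x \<in> X \<Longrightarrow> y \<in> X \<Longrightarrow> dist x y < r \<Longrightarrow> D x y < e"
proof -
  have "uniformly_continuous_on (X \<times> X) (\<lambda>z. D (fst z) (snd z))"
    by (intro compact_uniformly_continuous cont_pseudometricD assms compact_Times)
  then obtain r where r: "r > 0"
    "\<And>z z'. z \<in> X \<times> X \<Longrightarrow> z' \<in> X \<times> X \<Longrightarrow> dist z' z < r \<Longrightarrow>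
        dist (D (fst z') (snd z')) (D (fst z) (snd z)) < e"
    unfolding uniformly_continuous_on_def using assms(3) by metis
  have "D x y < e" if "x \<in> X" "y \<in> X" "dist x y < r" for x y
  proof -
    have "dist (x, y) (y, y) < r" using that by (simp add: dist_Pair_Pair)
    with r(2)[of "(y,y)" "(x,y)"] that cont_pseudometricD(2)[OF assms(2), of y] show ?thesis
      by (simp add: dist_real_def)
  qed
  with r(1) that show ?thesis by blast
qed

lemma openin_pseudoball:
  assumes "cont_pseudometric X D" "a \<in> X"
  shows "openin (top_of_set X) {x \<in> X. D x a < r}"
proof -
  have "continuous_on X (\<lambda>x. D x a)"
    by (rule cont_pseudometric_compose[OF assms(1)]) (use assms in \<open>auto intro!: continuous_intros\<close>)
  from continuous_openin_preimage_gen[OF this, of "{..<r}"]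
  have "openin (top_of_set X) (X \<inter> (\<lambda>x. D x a) -` {..<r})" by simp
  moreover have "X \<inter> (\<lambda>x. D x a) -` {..<r} = {x \<in> X. D x a < r}" by blast
  ultimately show ?thesis by simp
qed

lemma cont_pseudometric_net:
  assumes "compact X" "cont_pseudometric X D" "e > 0"
  obtains Z where "finite Z" "Z \<subseteq> X" "\<And>x. x \<in> X \<Longrightarrow> \<exists>z\<in>Z. D x z < e"
proof -
  obtain r where r: "r > 0" "\<And>x y. x \<in> X \<Longrightarrow> y \<in> X \<Longrightarrow> dist x y < r \<Longrightarrow> D x y < e"
    using cont_pseudometric_small[OF assms] by metis
  obtain Z where Z: "finite Z" "Z \<subseteq> X" "X \<subseteq> (\<Union>x\<in>Z. ball x r)"
    using compactE_image[OF assms(1), of X "\<lambda>x. ball x r"] r(1)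
    by (metis UN_I centre_in_ball open_ball subsetI)
  show ?thesis
  proof (rule that[OF Z(1,2)])
    fix x assume "x \<in> X"
    then obtain z where "z \<in> Z" "dist z x < r" using Z(3) by auto
    then show "\<exists>z\<in>Z. D x z < e" using r(2)[of x z] Z(2) \<open>x \<in> X\<close> by (auto simp: dist_commute)
  qed
qed

text \<open>The empty set has diameter 0 by convention, hence the hypothesis
  \<open>0 \<le> c\<close>.\<close>

lemma diam_wrt_le:
  assumes "\<And>x y. x \<in> S \<Longrightarrow> y \<in> S \<Longrightarrow> D x y \<le> c" "0 \<le> c"
  shows "diam_wrt D S \<le> c"
proof (cases "S = {}")
  case False
  then have "{D x y |x y. x \<in> S \<and> y \<in> S} \<noteq> {}" by blast
  then have "Sup {D x y |x y. x \<in> S \<and> y \<in> S} \<le> c"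
    by (rule cSup_least) (use assms(1) in blast)
  then show ?thesis using False unfolding diam_wrt_def by simp
qed (use assms in \<open>simp add: diam_wrt_def\<close>)

lemma le_diam_wrt:
  assumes "compact X" "cont_pseudometric X D" "S \<subseteq> X" "x \<in> S" "y \<in> S"
  shows "D x y \<le> diam_wrt D S"
proof -
  obtain B where B: "\<And>x y. x \<in> X \<Longrightarrow> y \<in> X \<Longrightarrow> D x y \<le> B"
    using cont_pseudometric_bounded[OF assms(1,2)] by metis
  have "bdd_above {D x y |x y. x \<in> S \<and> y \<in> S}"
    using B assms(3) by (auto simp: bdd_above_def intro!: exI[of _ B])
  then show ?thesis unfolding diam_wrt_def using assms(4,5) by (auto intro!: cSup_upper)
qed

text \<open>By compactness the supremum is attained, so a strict pointwise bound stays strict.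
  Needed for the fibres of continuous maps.\<close>

lemma diam_wrt_less:
  assumes "compact X" "cont_pseudometric X D" "S \<subseteq> X" "closed S" "e > 0"
    and "\<And>x y. x \<in> S \<Longrightarrow> y \<in> S \<Longrightarrow> D x y < e"
  shows "diam_wrt D S < e"
proof (cases "S = {}")
  case False
  have "compact S" using assms compact_Int_closed[of X S] by (simp add: inf_absorb2)
  then have "\<exists>z\<in>S \<times> S. \<forall>w\<in>S \<times> S. D (fst w) (snd w) \<le> D (fst z) (snd z)"
    by (intro continuous_attains_sup compact_Times
        continuous_on_subset[OF cont_pseudometricD(1)[OF assms(2)]]) (use False assms(3) in auto)
  then obtain a b where ab: "a \<in> S" "b \<in> S" "\<And>x y. x \<in> S \<Longrightarrow> y \<in> S \<Longrightarrow> D x y \<le> D a b" by fastforce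
  moreover have "0 \<le> D a b" using ab assms(2,3) cont_pseudometric_nonneg by blast
  ultimately show ?thesis using diam_wrt_le[of S D "D a b"] assms(6)[of a b] by fastforce
qed (use assms in \<open>simp add: diam_wrt_def\<close>)

section \<open>Dynamical metrics\<close>

lemma dyn_metric_le_iff:
  assumes "finite \<Omega>" "\<Omega> \<noteq> {}"
  shows "dyn_metric T \<Omega> D x y \<le> c \<longleftrightarrow> (\<forall>n\<in>\<Omega>. D (T n x) (T n y) \<le> c)"
  unfolding dyn_metric_def using assms by (subst cSup_eq_Max) auto

lemma dyn_metric_less_iff:
  assumes "finite \<Omega>" "\<Omega> \<noteq> {}"
  shows "dyn_metric T \<Omega> D x y < c \<longleftrightarrow> (\<forall>n\<in>\<Omega>. D (T n x) (T n y) < c)"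
  unfolding dyn_metric_def using assms by (subst cSup_eq_Max) auto

lemma dyn_metric_ge:
  assumes "finite \<Omega>" "n \<in> \<Omega>"
  shows "D (T n x) (T n y) \<le> dyn_metric T \<Omega> D x y"
  using dyn_metric_le_iff[of \<Omega> T D x y "dyn_metric T \<Omega> D x y"] assms by auto

lemma dyn_metric_singleton: "dyn_metric T {n} D = (\<lambda>x y. D (T n x) (T n y))"
  unfolding dyn_metric_def by simp

lemma dyn_metric_Un:
  assumes "finite A" "A \<noteq> {}" "finite B" "B \<noteq> {}"
  shows "dyn_metric T (A \<union> B) D = (\<lambda>x y. max (dyn_metric T A D x y) (dyn_metric T B D x y))"
  unfolding dyn_metric_def using assms by (intro ext) (simp add: cSup_eq_Max image_Un Max_Un)

lemma dyn_metric_mono: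
  assumes "finite B" "A \<noteq> {}" "A \<subseteq> B"
  shows "dyn_metric T A D x y \<le> dyn_metric T B D x y"
proof -
  have "finite A" using assms(1,3) finite_subset by blast
  then show ?thesis using assms(2) by (subst dyn_metric_le_iff) (auto intro!: dyn_metric_ge[OF assms(1)] subsetD[OF assms(3)])
qed

lemma cont_pseudometric_max:
  assumes "cont_pseudometric X D" "cont_pseudometric X E"
  shows "cont_pseudometric X (\<lambda>x y. max (D x y) (E x y))"
  unfolding cont_pseudometric_def
proof (intro conjI ballI)
  show "continuous_on (X \<times> X) (\<lambda>z. max (D (fst z) (snd z)) (E (fst z) (snd z)))"
    by (rule continuous_on_max[OF cont_pseudometricD(1)[OF assms(1)] cont_pseudometricD(1)[OF assms(2)]])
  fix x y z assume xyz: "x \<in> X" "y \<in> X" "z \<in> X"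
  show "max (D x z) (E x z) \<le> max (D x y) (E x y) + max (D y z) (E y z)"
    using cont_pseudometricD(4)[OF assms(1) xyz] cont_pseudometricD(4)[OF assms(2) xyz] by linarith
next
  fix x y assume xy: "x \<in> X" "y \<in> X"
  show "max (D x x) (E x x) = 0"
    using cont_pseudometricD(2)[OF assms(1) xy(1)] cont_pseudometricD(2)[OF assms(2) xy(1)] by simp
  show "max (D x y) (E x y) = max (D y x) (E y x)"
    using cont_pseudometricD(3)[OF assms(1) xy] cont_pseudometricD(3)[OF assms(2) xy] by simp
qed

locale Zk_action =
  fixes X :: "'a::metric_space set" and T :: "int^'k::finite \<Rightarrow> 'a \<Rightarrow> 'a"
  assumes system: "Zk_system X T" and nonempty: "X \<noteq> {}"
begin

abbreviation dyn :: "nat \<Rightarrow> ('a \<Rightarrow> 'a \<Rightarrow> real) \<Rightarrow> 'a \<Rightarrow> 'a \<Rightarrow> real" where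
  "dyn N \<equiv> dyn_metric T (cube N)"

lemma compact_X: "compact X" and T_cont: "continuous_on X (T n)"
  and T_in: "x \<in> X \<Longrightarrow> T n x \<in> X" and T_zero: "x \<in> X \<Longrightarrow> T 0 x = x"
  and T_add: "x \<in> X \<Longrightarrow> T m (T n x) = T (m + n) x"
  using system unfolding Zk_system_def by auto

lemma T_image: "T n ` X = X"
proof
  show "T n ` X \<subseteq> X" using T_in by auto
  show "X \<subseteq> T n ` X"
  proof
    fix x assume "x \<in> X"
    then have "x = T n (T (- n) x)" by (simp add: T_add T_zero)
    then show "x \<in> T n ` X" using T_in[OF \<open>x \<in> X\<close>] by blast
  qed
qed

lemma cont_pseudometric_shift:
  assumes "cont_pseudometric X D"
  shows "cont_pseudometric X (\<lambda>x y. D (T n x) (T n y))"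
  unfolding cont_pseudometric_def
proof (intro conjI ballI)
  show "continuous_on (X \<times> X) (\<lambda>z. D (T n (fst z)) (T n (snd z)))"
    by (rule cont_pseudometric_compose[OF assms])
      (auto intro!: continuous_on_compose2[OF T_cont] continuous_intros T_in)
qed (auto intro!: cont_pseudometricD(2-)[OF assms] T_in)

lemma cont_pseudometric_dyn:
  assumes "cont_pseudometric X D" "finite \<Omega>" "\<Omega> \<noteq> {}"
  shows "cont_pseudometric X (dyn_metric T \<Omega> D)"
  using assms(2,3)
proof (induction rule: finite_ne_induct)
  case (singleton n)
  then show ?case using cont_pseudometric_shift[OF assms(1)] by (simp add: dyn_metric_singleton)
next
  case (insert n \<Omega>)
  have "dyn_metric T (insert n \<Omega>) D = dyn_metric T ({n} \<union> \<Omega>) D" by simp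
  also have "\<dots> = (\<lambda>x y. max (dyn_metric T {n} D x y) (dyn_metric T \<Omega> D x y))"
    using insert by (intro dyn_metric_Un) auto
  finally show ?case
    using cont_pseudometric_max[OF _ insert.IH] cont_pseudometric_shift[OF assms(1), of n]
    by (simp add: dyn_metric_singleton)
qed

lemma dyn_metric_translate:
  assumes "x \<in> X" "y \<in> X"
  shows "dyn_metric T ((+) p ` \<Omega>) D x y = dyn_metric T \<Omega> D (T p x) (T p y)"
  unfolding dyn_metric_def using assms by (simp add: image_image T_add add.commute)

end

section \<open>Widim through barycentric coordinates\<close>

text \<open>The functions \<open>t i\<close> are the barycentric coordinates of an \<open>e\<close>-embedding into a complex of
  dimension at most \<open>n\<close>.\<close>
definition small_param :: "'a::topological_space set \<Rightarrow> ('a \<Rightarrow> 'a \<Rightarrow> real) \<Rightarrow> real \<Rightarrow> nat \<Rightarrow> nat \<Rightarrow> (nat \<Rightarrow> 'a \<Rightarrow> real) \<Rightarrow> bool" where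
  "small_param X D e n p t \<longleftrightarrow> (\<forall>i<p. continuous_on X (t i)) \<and>
     (\<forall>x\<in>X. (\<forall>i<p. 0 \<le> t i x) \<and> (\<Sum>i<p. t i x) = 1 \<and> card {i. i < p \<and> t i x \<noteq> 0} \<le> Suc n) \<and>
     (\<forall>x\<in>X. \<forall>y\<in>X. (\<forall>i<p. t i x = t i y) \<longrightarrow> D x y < e)"

text \<open>For nonempty compact \<open>X\<close> and positive \<open>e\<close>,
  \<open>widim\<close> is the least such \<open>n\<close>: \<open>widim_le\<close> and
  \<open>small_map_widim\<close> are the two halves.\<close>

definition small_map :: "'a::topological_space set \<Rightarrow> ('a \<Rightarrow> 'a \<Rightarrow> real) \<Rightarrow> real \<Rightarrow> nat \<Rightarrow> bool" where
  "small_map X D e n \<longleftrightarrow> (\<exists>p t. small_param X D e n p t)"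

lemma small_paramD:
  assumes "small_param X D e n p t"
  shows "\<And>i. i < p \<Longrightarrow> continuous_on X (t i)"
    "\<And>x i. x \<in> X \<Longrightarrow> i < p \<Longrightarrow> 0 \<le> t i x" "\<And>x. x \<in> X \<Longrightarrow> (\<Sum>i<p. t i x) = 1"
    "\<And>x. x \<in> X \<Longrightarrow> card {i. i < p \<and> t i x \<noteq> 0} \<le> Suc n"
    "\<And>x y. x \<in> X \<Longrightarrow> y \<in> X \<Longrightarrow> (\<And>i. i < p \<Longrightarrow> t i x = t i y) \<Longrightarrow> D x y < e"
  using assms unfolding small_param_def by simp_all

lemma small_mapI_param:
  fixes p :: nat and t :: "nat \<Rightarrow> 'a::topological_space \<Rightarrow> real"
  assumes "\<And>i. i < p \<Longrightarrow> continuous_on X (t i)"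
    "\<And>x i. x \<in> X \<Longrightarrow> i < p \<Longrightarrow> 0 \<le> t i x" "\<And>x. x \<in> X \<Longrightarrow> (\<Sum>i<p. t i x) = 1"
    "\<And>x. x \<in> X \<Longrightarrow> card {i. i < p \<and> t i x \<noteq> 0} \<le> Suc n"
    "\<And>x y. x \<in> X \<Longrightarrow> y \<in> X \<Longrightarrow> \<forall>i<p. t i x = t i y \<Longrightarrow> D x y < e"
  shows "small_map X D e n"
proof -
  have "small_param X D e n p t"
    unfolding small_param_def by (intro conjI ballI allI impI) (simp_all add: assms)
  then show ?thesis unfolding small_map_def by blast
qed

lemma small_mapI:
  fixes t :: "'i \<Rightarrow> 'a::topological_space \<Rightarrow> real"
  assumes "finite I" "\<And>i. i \<in> I \<Longrightarrow> continuous_on X (t i)"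
    "\<And>x i. x \<in> X \<Longrightarrow> i \<in> I \<Longrightarrow> 0 \<le> t i x" "\<And>x. x \<in> X \<Longrightarrow> (\<Sum>i\<in>I. t i x) = 1"
    "\<And>x. x \<in> X \<Longrightarrow> card {i \<in> I. t i x \<noteq> 0} \<le> Suc n"
    "\<And>x y. x \<in> X \<Longrightarrow> y \<in> X \<Longrightarrow> (\<And>i. i \<in> I \<Longrightarrow> t i x = t i y) \<Longrightarrow> D x y < e"
  shows "small_map X D e n"
proof -
  obtain h where h: "bij_betw h {..<card I} I"
    using ex_bij_betw_nat_finite[OF assms(1)] unfolding atLeast0LessThan by blast
  then have hI: "h i \<in> I" if "i < card I" for i using that by (auto simp: bij_betw_def)
  have "(\<Sum>i<card I. t (h i) x) = 1" if "x \<in> X" for x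
    using sum.reindex_bij_betw[OF h, of "\<lambda>i. t i x"] assms(4)[OF that] by simp
  moreover have "card {i. i < card I \<and> t (h i) x \<noteq> 0} \<le> Suc n" if "x \<in> X" for x
  proof -
    have "bij_betw h {i. i < card I \<and> t (h i) x \<noteq> 0} {i \<in> I. t i x \<noteq> 0}"
      using h unfolding bij_betw_def by (auto simp: inj_on_def)
    then show ?thesis using assms(5)[OF that] bij_betw_same_card[of h] by simp
  qed
  moreover have "D x y < e" if "x \<in> X" "y \<in> X" "\<forall>i<card I. t (h i) x = t (h i) y" for x y
  proof (rule assms(6)[OF that(1,2)])
    fix i assume "i \<in> I"
    then obtain j where "j < card I" "i = h j" using h by (auto simp: bij_betw_def)
    then show "t i x = t i y" using that(3) by simp
  qed
  ultimately show ?thesis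
    by (intro small_mapI_param[of "card I" X "\<lambda>i. t (h i)"]) (simp_all add: hI assms(2,3))
qed

lemma small_map_mono:
  assumes "small_map X D e n" "n \<le> n'" "e \<le> e'" "\<And>x y. x \<in> X \<Longrightarrow> y \<in> X \<Longrightarrow> E x y \<le> D x y"
  shows "small_map X E e' n'"
proof -
  obtain p t where "small_param X D e n p t" using assms(1) unfolding small_map_def by blast
  note pt = small_paramD[OF this]
  have "D x y < e \<Longrightarrow> x \<in> X \<Longrightarrow> y \<in> X \<Longrightarrow> E x y < e'" for x y
    using assms(3) assms(4)[of x y] by linarith
  moreover have "card {i. i < p \<and> t i x \<noteq> 0} \<le> Suc n'" if "x \<in> X" for x
    using pt(4)[OF that] assms(2) by linarith
  ultimately show ?thesis
    by (intro small_mapI_param[of p X t]) (simp_all add: pt)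
qed

lemma small_map_pullback:
  assumes "small_map X D e n" "continuous_on Y f" "f ` Y \<subseteq> X"
  shows "small_map Y (\<lambda>x y. D (f x) (f y)) e n"
proof -
  obtain p t where "small_param X D e n p t" using assms(1) unfolding small_map_def by blast
  note pt = small_paramD[OF this]
  have fX: "f y \<in> X" if "y \<in> Y" for y using assms(3) that by auto
  have "continuous_on Y (\<lambda>x. t i (f x))" if "i < p" for i
    using continuous_on_compose2[OF pt(1)[OF that] assms(2,3)] .
  then show ?thesis
    by (intro small_mapI_param[of p Y "\<lambda>i y. t i (f y)"]) (simp_all add: pt fX)
qed

text \<open>A partition of unity: a bump that is positive at \<open>x\<close> is positive at every
  \<open>y\<close> with the same coordinates, so both points are close to its centre.\<close>

lemma small_map_exists:
  assumes "compact X" "cont_pseudometric X D" "e > 0"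
  shows "\<exists>n. small_map X D e n"
proof -
  obtain Z where Z: "finite Z" "Z \<subseteq> X" "\<And>x. x \<in> X \<Longrightarrow> \<exists>z\<in>Z. D x z < e/2"
    using cont_pseudometric_net[OF assms(1,2), of "e/2"] assms(3) by auto
  define b where "b z x = max 0 (e/2 - D x z)" for z x
  define s where "s x = (\<Sum>z\<in>Z. b z x)" for x
  have bc: "continuous_on X (b z)" if "z \<in> Z" for z
    unfolding b_def using that Z(2)
    by (intro continuous_intros cont_pseudometric_compose[OF assms(2)]) auto
  have s0: "s x > 0" if x: "x \<in> X" for x
  proof -
    obtain z where "z \<in> Z" "D x z < e/2" using Z(3)[OF x] by blast
    then have "0 < b z x" "z \<in> Z" by (auto simp: b_def)
    then show ?thesis unfolding s_def using Z(1) by (intro sum_pos2[of _ z]) (auto simp: b_def)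
  qed
  have "small_map X D e (card Z)"
  proof (rule small_mapI[of Z _ "\<lambda>z x. b z x / s x"])
    show "finite Z" by fact
    show "continuous_on X (\<lambda>x. b z x / s x)" if "z \<in> Z" for z
    proof (intro continuous_on_divide bc that ballI)
      show "continuous_on X s" unfolding s_def by (intro continuous_on_sum bc)
      show "s x \<noteq> 0" if "x \<in> X" for x using s0[OF that] by simp
    qed
    show "0 \<le> b z x / s x" if "x \<in> X" "z \<in> Z" for x z
      using s0[OF that(1)] by (simp add: b_def)
    show "(\<Sum>z\<in>Z. b z x / s x) = 1" if "x \<in> X" for x
      using s0[OF that] by (simp flip: sum_divide_distrib s_def)
    show "card {z \<in> Z. b z x / s x \<noteq> 0} \<le> Suc (card Z)" for x
      using card_mono[OF Z(1), of "{z \<in> Z. b z x / s x \<noteq> 0}"] by auto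
    show "D x y < e" if xy: "x \<in> X" "y \<in> X" and eq: "\<And>z. z \<in> Z \<Longrightarrow> b z x / s x = b z y / s y" for x y
    proof -
      obtain z where z: "z \<in> Z" "D x z < e/2" using Z(3)[OF xy(1)] by blast
      then have "b z x / s x > 0" using s0[OF xy(1)] by (simp add: b_def)
      then have "b z y > 0" using eq[OF z(1)] s0[OF xy(2)] by (simp add: zero_less_divide_iff)
      then have "D y z < e/2" by (auto simp: b_def max_def split: if_splits)
      moreover have "D x y \<le> D x z + D z y" "D z y = D y z"
        using cont_pseudometricD(3,4)[OF assms(2)] xy z(1) Z(2) by blast+
      ultimately show ?thesis using z(2) by linarith
    qed
  qed
  then show ?thesis ..
qed

lemma small_map_imp_eps_embedding:
  assumes "compact X" "cont_pseudometric X D" "e > 0" "X \<noteq> {}" "small_map X D e n"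
  shows "\<exists>K f. simplicial_cx K \<and> cx_dim K \<le> n \<and> eps_embedding X D e f (realization K)"
proof -
  obtain p t where "small_param X D e n p t" using assms(5) unfolding small_map_def by blast
  note pt = small_paramD[OF this]
  \<comment> \<open>The \<open>n\<close>-skeleton of the full simplex on \<open>p\<close>
    vertices.\<close>
  define K where "K = {\<sigma>. \<sigma> \<subseteq> {..<p} \<and> \<sigma> \<noteq> {} \<and> card \<sigma> \<le> Suc n}"
  define f where "f x i = (if i < p then t i x else 0)" for x i
  have fin: "finite K" unfolding K_def by (rule finite_subset[of _ "Pow {..<p}"]) auto
  have scx: "simplicial_cx K" unfolding simplicial_cx_def
  proof (intro conjI ballI allI impI)
    fix \<sigma> \<tau> assume a: "\<sigma> \<in> K" "\<tau> \<noteq> {} \<and> \<tau> \<subseteq> \<sigma>"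
    then have "finite \<sigma>" by (auto simp: K_def intro: finite_subset)
    then have "card \<tau> \<le> card \<sigma>" using a by (intro card_mono) auto
    with a show "\<tau> \<in> K" by (auto simp: K_def)
  qed (use fin in \<open>auto simp: K_def intro: finite_subset\<close>)
  have real: "f x \<in> realization K" if x: "x \<in> X" for x
  proof -
    define \<sigma> where "\<sigma> = {i. i < p \<and> t i x \<noteq> 0}"
    have \<sigma>: "\<sigma> \<subseteq> {..<p}" by (auto simp: \<sigma>_def)
    have "sum (f x) \<sigma> = (\<Sum>i<p. t i x)"
      by (rule sum.mono_neutral_cong_left) (auto simp: \<sigma>_def f_def)
    then have one: "sum (f x) \<sigma> = 1" using pt(3)[OF x] by simp
    then have "\<sigma> \<noteq> {}" by auto
    then have "\<sigma> \<in> K" using pt(4)[OF x] \<sigma> by (auto simp: K_def \<sigma>_def)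
    moreover have "{i. f x i \<noteq> 0} \<subseteq> \<sigma>" by (auto simp: f_def \<sigma>_def)
    moreover have "\<forall>i. 0 \<le> f x i" using pt(2)[OF x] by (simp add: f_def)
    ultimately show ?thesis using one unfolding realization_def by blast
  qed
  have "K \<noteq> {}" using real assms(4) by (auto simp: realization_def)
  then have dim: "cx_dim K \<le> n" unfolding cx_dim_def using fin by (auto simp: K_def)
  have cont: "continuous_on X f"
  proof (rule continuous_on_coordinatewise_then_product)
    show "continuous_on X (\<lambda>x. f x i)" for i
      by (cases "i < p") (simp_all add: f_def pt(1))
  qed
  have "diam_wrt D {x \<in> X. f x = y} < e" for y
  proof (rule diam_wrt_less[OF assms(1,2) _ _ assms(3)])
    have "closedin (top_of_set X) (X \<inter> f -` {y})"
      by (rule continuous_closedin_preimage[OF cont]) auto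
    moreover have "X \<inter> f -` {y} = {x \<in> X. f x = y}" by auto
    ultimately show "closed {x \<in> X. f x = y}"
      using closedin_closed_trans[OF _ compact_imp_closed[OF assms(1)]] by metis
    fix a b assume "a \<in> {x \<in> X. f x = y}" "b \<in> {x \<in> X. f x = y}"
    then have ab: "a \<in> X" "b \<in> X" "f a = f b" by auto
    have "t i a = t i b" if "i < p" for i using fun_cong[OF ab(3), of i] that by (simp add: f_def)
    then show "D a b < e" using pt(5) ab by blast
  qed auto
  then have "eps_embedding X D e f (realization K)"
    unfolding eps_embedding_def using cont real by blast
  with dim scx show ?thesis by blast
qed

lemma widim_le:
  assumes "compact X" "cont_pseudometric X D" "e > 0" "X \<noteq> {}" "small_map X D e n"
  shows "widim X D e \<le> n"
proof -
  obtain K f where K: "simplicial_cx K" "cx_dim K \<le> n" "eps_embedding X D e f (realization K)"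
    using small_map_imp_eps_embedding[OF assms] by blast
  then have "widim X D e \<le> cx_dim K" unfolding widim_def by (intro Least_le) blast
  with K(2) show ?thesis by linarith
qed

lemma small_map_widim:
  assumes "compact X" "cont_pseudometric X D" "e > 0" "X \<noteq> {}"
  shows "small_map X D e (widim X D e)"
proof -
  define P where "P n \<longleftrightarrow> (\<exists>K f. simplicial_cx K \<and> cx_dim K = n \<and>
        eps_embedding X D e f (realization K))" for n
  obtain n where "small_map X D e n" using small_map_exists[OF assms(1-3)] by blast
  then have "\<exists>n. P n" unfolding P_def using small_map_imp_eps_embedding[OF assms] by blast
  \<comment> \<open>\<open>LEAST\<close> denotes an attained value only because some embedding
    exists.\<close>
  then have "P (widim X D e)" unfolding widim_def P_def[symmetric] by (rule LeastI_ex)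
  then obtain K f where K: "simplicial_cx K" "cx_dim K = widim X D e"
    "eps_embedding X D e f (realization K)" unfolding P_def by blast
  then have fin: "finite (\<Union>K)" "finite K" by (auto simp: simplicial_cx_def)
  have f: "continuous_on X f" "\<And>x. x \<in> X \<Longrightarrow> f x \<in> realization K"
    "\<And>y. diam_wrt D {x \<in> X. f x = y} < e"
    using K(3) unfolding eps_embedding_def by auto
  have zero: "f x i = 0" if "x \<in> X" "i \<notin> \<Union>K" for x i
    using f(2)[OF that(1)] that(2) unfolding realization_def by blast
  show ?thesis
  proof (rule small_mapI[of "\<Union>K" _ "\<lambda>i x. f x i"])
    show "finite (\<Union>K)" by fact
    show "continuous_on X (\<lambda>x. f x i)" for i
      using f(1) by (rule continuous_on_product_then_coordinatewise)
    show "0 \<le> f x i" if "x \<in> X" for x i using f(2)[OF that] by (simp add: realization_def)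
    fix x assume x: "x \<in> X"
    then obtain \<sigma> where \<sigma>: "\<sigma> \<in> K" "{i. f x i \<noteq> 0} \<subseteq> \<sigma>" "sum (f x) \<sigma> = 1"
      using f(2)[OF x] unfolding realization_def by blast
    have "(\<Sum>i\<in>\<Union>K. f x i) = sum (f x) \<sigma>"
      by (rule sum.mono_neutral_right) (use fin \<sigma> in auto)
    then show "(\<Sum>i\<in>\<Union>K. f x i) = 1" using \<sigma>(3) by simp
    have "finite \<sigma>" using \<sigma>(1) fin(1) by (meson Union_upper finite_subset)
    then have "card {i \<in> \<Union>K. f x i \<noteq> 0} \<le> card \<sigma>"
      using \<sigma>(2) by (intro card_mono) auto
    moreover have "card \<sigma> - 1 \<le> cx_dim K" unfolding cx_dim_def using \<sigma>(1) fin(2) by (intro Max_ge) auto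
    ultimately show "card {i \<in> \<Union>K. f x i \<noteq> 0} \<le> Suc (widim X D e)" using K(2) by linarith
  next
    fix x y assume xy: "x \<in> X" "y \<in> X" "\<And>i. i \<in> \<Union>K \<Longrightarrow> f x i = f y i"
    then have "f x = f y" using zero by (intro ext) metis
    then have "D x y \<le> diam_wrt D {z \<in> X. f z = f x}"
      using xy by (intro le_diam_wrt[OF assms(1,2)]) auto
    then show "D x y < e" using f(3)[of "f x"] by linarith
  qed
qed

section \<open>Products of simplices and subadditivity of widim\<close>

lemma card_chain_le:
  fixes C :: "(nat \<times> nat) set"
  assumes "finite A" "finite B" "C \<subseteq> A \<times> B" "A \<noteq> {}" "B \<noteq> {}"
    and chain: "\<And>i j i' j'. (i, j) \<in> C \<Longrightarrow> (i', j') \<in> C \<Longrightarrow> i < i' \<Longrightarrow> j \<le> j'"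
  shows "Suc (card C) \<le> card A + card B"
proof -
  define ra where "ra i = card {a \<in> A. a < i}" for i
  define rb where "rb j = card {b \<in> B. b < j}" for j
  have mono: "ra i \<le> ra i'" "rb i \<le> rb i'" if "i \<le> i'" for i i'
    unfolding ra_def rb_def using that assms(1,2) by (auto intro!: card_mono)
  have sa: "ra i < ra i'" if "i < i'" "i \<in> A" for i i'
    unfolding ra_def using that assms(1) by (intro psubset_card_mono) auto
  have sb: "rb i < rb i'" if "i < i'" "i \<in> B" for i i'
    unfolding rb_def using that assms(2) by (intro psubset_card_mono) auto
  have la: "ra i < card A" if "i \<in> A" for i
    unfolding ra_def using that assms(1) by (intro psubset_card_mono) auto
  have lb: "rb i < card B" if "i \<in> B" for i
    unfolding rb_def using that assms(2) by (intro psubset_card_mono) auto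
  \<comment> \<open>Row rank plus column rank increases strictly along a staircase and takes at most
    \<open>card A + card B - 1\<close> values.\<close>
  define r where "r z = ra (fst z) + rb (snd z)" for z
  have lt: "r (i, j) < r (i', j')" if "(i, j) \<in> C" "(i', j') \<in> C" "i < i' \<or> i = i' \<and> j < j'" for i j i' j'
  proof (cases "i < i'")
    case True
    then have "j \<le> j'" using chain that by blast
    moreover have "i \<in> A" using that assms(3) by blast
    ultimately show ?thesis using sa[OF True] mono(2) unfolding r_def by (simp add: add_less_le_mono)
  next
    case False
    then have "i = i'" "j < j'" "j \<in> B" using that assms(3) by auto
    then show ?thesis using sb unfolding r_def by simp
  qed
  have "inj_on r C"
  proof (rule inj_onI)
    fix z w assume a: "z \<in> C" "w \<in> C" "r z = r w"
    obtain i j i' j' where "z = (i, j)" "w = (i', j')" by (metis prod.exhaust)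
    then show "z = w" using lt[of i j i' j'] lt[of i' j' i j] a by fastforce
  qed
  moreover have "r ` C \<subseteq> {..<card A + card B - 1}"
  proof
    fix m assume "m \<in> r ` C"
    then obtain i j where "m = ra i + rb j" "i \<in> A" "j \<in> B" using assms(3) by (auto simp: r_def)
    then show "m \<in> {..<card A + card B - 1}" using la[of i] lb[of j] by auto
  qed
  ultimately have "card C \<le> card A + card B - 1"
    using card_inj_on_le[of r C "{..<card A + card B - 1}"] by simp
  moreover have "0 < card A" using assms by (simp add: card_gt_0_iff)
  ultimately show ?thesis by linarith
qed

text \<open>A mixed second difference of \<open>min (S i) (T j)\<close>: in this form row and column
  sums telescope and continuity is immediate.\<close>

definition overlap :: "(nat \<Rightarrow> real) \<Rightarrow> (nat \<Rightarrow> real) \<Rightarrow> nat \<Rightarrow> nat \<Rightarrow> real" where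
  "overlap S T i j = (min (S (Suc i)) (T (Suc j)) - min (S i) (T (Suc j)))
     - (min (S (Suc i)) (T j) - min (S i) (T j))"

text \<open>The length of the intersection of \<open>[S i, S (i+1)]\<close> and \<open>[T j, T (j+1)]\<close>.
  This staircase formula parametrises the product of two simplices by a simplicial complex without
  raising the dimension.\<close>
lemma overlap_eq:
  assumes "S i \<le> S (Suc i)" "T j \<le> T (Suc j)"
  shows "overlap S T i j = max 0 (min (S (Suc i)) (T (Suc j)) - max (S i) (T j))"
  using assms unfolding overlap_def by (auto simp: min_def max_def)

lemma overlap_sum:
  assumes "\<And>i. i \<le> p \<Longrightarrow> 0 \<le> S i \<and> S i \<le> T q" "T 0 = 0" "i < p"
  shows "(\<Sum>j<q. overlap S T i j) = S (Suc i) - S i"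
proof -
  define f where "f j = min (S (Suc i)) (T j) - min (S i) (T j)" for j
  have "(\<Sum>j<q. overlap S T i j) = (\<Sum>j<q. f (Suc j) - f j)"
    by (simp add: overlap_def f_def)
  also have "\<dots> = f q - f 0" by (rule sum_lessThan_telescope)
  also have "\<dots> = S (Suc i) - S i"
    using assms(1)[of i] assms(1)[of "Suc i"] assms(2,3) by (simp add: f_def)
  finally show ?thesis .
qed

lemma overlap_commute: "overlap S T i j = overlap T S j i"
  unfolding overlap_def by (simp add: min.commute)

text \<open>The coordinates \<open>s\<close> and \<open>t\<close> cut \<open>[0,1]\<close> into two
  families of intervals; the new coordinates are the lengths of the pieces of the common refinement.
  Their row and column sums give back \<open>s\<close> and \<open>t\<close>. The nonempty pieces
  form a staircase, so there are at most \<open>(a + 1) + (b + 1) - 1\<close> of them.\<close>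

lemma small_map_max:
  assumes "small_map X D e a" "small_map X E e b"
  shows "small_map X (\<lambda>x y. max (D x y) (E x y)) e (a + b)"
proof -
  obtain p s where "small_param X D e a p s" using assms(1) unfolding small_map_def by blast
  note ps = small_paramD[OF this]
  obtain q t where "small_param X E e b q t" using assms(2) unfolding small_map_def by blast
  note qt = small_paramD[OF this]
  define S where "S x i = (\<Sum>i'<i. s i' x)" for x i
  define T where "T x j = (\<Sum>j'<j. t j' x)" for x j
  define u where "u z x = overlap (S x) (T x) (fst z) (snd z)" for z x
  have S0: "S x 0 = 0" "T x 0 = 0" for x by (simp_all add: S_def T_def)
  have S1: "S x p = 1" "T x q = 1" if "x \<in> X" for x using that ps(3) qt(3) by (simp_all add: S_def T_def)
  have Smono: "S x i \<le> S x i'" if "x \<in> X" "i \<le> i'" "i' \<le> p" for x i i'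
    unfolding S_def using that ps(2) by (intro sum_mono2) auto
  have Tmono: "T x i \<le> T x i'" if "x \<in> X" "i \<le> i'" "i' \<le> q" for x i i'
    unfolding T_def using that qt(2) by (intro sum_mono2) auto
  have rng: "0 \<le> S x i \<and> S x i \<le> 1" if "x \<in> X" "i \<le> p" for x i
    using Smono[OF that(1), of 0 i] Smono[OF that(1), of i p] S0 S1 that by simp
  have rngT: "0 \<le> T x i \<and> T x i \<le> 1" if "x \<in> X" "i \<le> q" for x i
    using Tmono[OF that(1), of 0 i] Tmono[OF that(1), of i q] S0 S1 that by simp
  have row: "(\<Sum>j<q. u (i, j) x) = s i x" if "x \<in> X" "i < p" for x i
    using overlap_sum[of p "S x" "T x" q i] rng[OF that(1)] S0 S1 that by (simp add: u_def) (simp add: S_def)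
  have col: "(\<Sum>i<p. u (i, j) x) = t j x" if "x \<in> X" "j < q" for x j
    using overlap_sum[of q "T x" "S x" p j] rngT[OF that(1)] S0 S1 that
    by (simp add: u_def overlap_commute[of "S x"]) (simp add: T_def)
  have eq: "u z x = max 0 (min (S x (Suc (fst z))) (T x (Suc (snd z))) - max (S x (fst z)) (T x (snd z)))"
    if "x \<in> X" "fst z < p" "snd z < q" for z x
    unfolding u_def using that by (intro overlap_eq Smono Tmono) auto
  show ?thesis
  proof (rule small_mapI[of "{..<p} \<times> {..<q}" _ u])
    show "finite ({..<p} \<times> {..<q})" by simp
    show "continuous_on X (u z)" if "z \<in> {..<p} \<times> {..<q}" for z
      unfolding u_def overlap_def S_def T_def using that
      by (intro continuous_on_diff continuous_on_min continuous_on_sum ps qt) auto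
    fix x assume x: "x \<in> X"
    show "0 \<le> u z x" if "z \<in> {..<p} \<times> {..<q}" for z
      using eq[OF x, of z] that by auto
    have "(\<Sum>z\<in>{..<p} \<times> {..<q}. u z x) = (\<Sum>i<p. \<Sum>j<q. u (i, j) x)"
      by (simp add: sum.cartesian_product)
    also have "\<dots> = (\<Sum>i<p. s i x)" using row[OF x] by (intro sum.cong) auto
    finally show "(\<Sum>z\<in>{..<p} \<times> {..<q}. u z x) = 1" using ps(3)[OF x] by simp
    define A where "A = {i. i < p \<and> s i x \<noteq> 0}"
    define B where "B = {j. j < q \<and> t j x \<noteq> 0}"
    define C where "C = {z \<in> {..<p} \<times> {..<q}. u z x \<noteq> 0}"
    have lt: "S x i < S x (Suc i)" "T x j < T x (Suc j)" "S x i < T x (Suc j)" "T x j < S x (Suc i)"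
      "i < p" "j < q" if "(i, j) \<in> C" for i j
      using that eq[OF x, of "(i, j)"] by (auto simp: C_def max_def split: if_splits)
    have "C \<subseteq> A \<times> B"
    proof
      fix z assume "z \<in> C"
      then show "z \<in> A \<times> B" using lt[of "fst z" "snd z"] by (cases z) (auto simp: A_def B_def S_def T_def)
    qed
    \<comment> \<open>Interval \<open>i'\<close> lies to the right of interval \<open>i\<close>.
      With \<open>j' < j\<close> the \<open>j'\<close>-th interval would end before the
      \<open>j\<close>-th begins, hence before interval \<open>i'\<close> begins.\<close>
    moreover have "j \<le> j'" if "(i, j) \<in> C" "(i', j') \<in> C" "i < i'" for i j i' j'
    proof (rule ccontr)
      assume "\<not> j \<le> j'"
      then have "T x (Suc j') \<le> T x j" using lt[OF that(1)] by (intro Tmono[OF x]) auto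
      moreover have "S x (Suc i) \<le> S x i'" using lt[OF that(2)] that(3) by (intro Smono[OF x]) auto
      ultimately show False using lt[OF that(1)] lt[OF that(2)] by linarith
    qed
    moreover have "A \<noteq> {}" "B \<noteq> {}"
    proof -
      have "\<exists>i<p. s i x \<noteq> 0" using ps(3)[OF x] by (metis lessThan_iff sum.neutral zero_neq_one)
      then show "A \<noteq> {}" by (auto simp: A_def)
      have "\<exists>i<q. t i x \<noteq> 0" using qt(3)[OF x] by (metis lessThan_iff sum.neutral zero_neq_one)
      then show "B \<noteq> {}" by (auto simp: B_def)
    qed
    ultimately have "Suc (card C) \<le> card A + card B"
      by (intro card_chain_le) (auto simp: A_def B_def)
    then show "card {z \<in> {..<p} \<times> {..<q}. u z x \<noteq> 0} \<le> Suc (a + b)"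
      using ps(4)[OF x] qt(4)[OF x] by (simp add: A_def B_def C_def)
  next
    fix x y assume xy: "x \<in> X" "y \<in> X" and same: "\<And>z. z \<in> {..<p} \<times> {..<q} \<Longrightarrow> u z x = u z y"
    have "s i x = s i y" if "i < p" for i
    proof -
      have "(\<Sum>j<q. u (i, j) x) = (\<Sum>j<q. u (i, j) y)"
        using that by (intro sum.cong same) auto
      then show ?thesis using row[OF xy(1) that] row[OF xy(2) that] by simp
    qed
    then have "D x y < e" by (intro ps(5) xy)
    have "t i x = t i y" if "i < q" for i
    proof -
      have "(\<Sum>j<p. u (j, i) x) = (\<Sum>j<p. u (j, i) y)"
        using that by (intro sum.cong same) auto
      then show ?thesis using col[OF xy(1) that] col[OF xy(2) that] by simp
    qed
    then have "E x y < e" by (intro qt(5) xy)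
    with \<open>D x y < e\<close> show "max (D x y) (E x y) < e" by simp
  qed
qed

section \<open>Covering numbers\<close>

definition small_cover :: "'a::topological_space set \<Rightarrow> ('a \<Rightarrow> 'a \<Rightarrow> real) \<Rightarrow> real \<Rightarrow> 'a set set \<Rightarrow> bool" where
  "small_cover X D e \<U> \<longleftrightarrow> finite \<U> \<and> \<Union>\<U> = X \<and>
     (\<forall>U\<in>\<U>. openin (top_of_set X) U \<and> diam_wrt D U < e)"

lemma cover_num_le: "small_cover X D e \<U> \<Longrightarrow> cover_num X D e \<le> card \<U>"
  unfolding cover_num_def small_cover_def by (intro cInf_lower) auto

lemma cover_num_attained:
  assumes "small_cover X D e \<U>"
  obtains \<V> where "small_cover X D e \<V>" "card \<V> = cover_num X D e"
proof -
  have "Inf {card \<U> |\<U>. small_cover X D e \<U>} \<in> {card \<U> |\<U>. small_cover X D e \<U>}"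
    using assms by (intro Inf_nat_def1) auto
  moreover have "cover_num X D e = Inf {card \<U> |\<U>. small_cover X D e \<U>}"
    unfolding cover_num_def small_cover_def by simp
  ultimately show ?thesis using that by auto
qed

text \<open>The classes of \<open>code\<close> need not be open, so each is replaced by its open
  \<open>r\<close>-neighbourhood; two steps of length below \<open>r\<close> fit into the gap
  between \<open>e1\<close> and \<open>e\<close>.\<close>

lemma small_cover_code:
  assumes "compact X" "cont_pseudometric X D" "e1 < e" "0 \<le> e1" "finite (code ` X)"
    and code: "\<And>x y. x \<in> X \<Longrightarrow> y \<in> X \<Longrightarrow> code x = code y \<Longrightarrow> D x y \<le> e1"
  obtains \<U> where "small_cover X D e \<U>" "card \<U> \<le> card (code ` X)"
proof -
  define r where "r = (e - e1) / 3"
  have r: "r > 0" using assms(3) by (simp add: r_def)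
  define N where "N c = (\<Union>a\<in>{a\<in>X. code a = c}. {x \<in> X. D x a < r})" for c
  define \<U> where "\<U> = N ` code ` X"
  have "small_cover X D e \<U>" unfolding small_cover_def
  proof (intro conjI ballI)
    show "finite \<U>" using assms(5) by (simp add: \<U>_def)
    show "\<Union>\<U> = X"
    proof
      show "\<Union>\<U> \<subseteq> X" by (auto simp: \<U>_def N_def)
      show "X \<subseteq> \<Union>\<U>"
      proof
        fix x assume x: "x \<in> X"
        then have "D x x < r" using cont_pseudometricD(2)[OF assms(2) x] r by simp
        then have "x \<in> N (code x)" using x by (auto simp: N_def)
        then show "x \<in> \<Union>\<U>" using x by (auto simp: \<U>_def)
      qed
    qed
    fix U assume "U \<in> \<U>"
    then obtain c where U: "U = N c" by (auto simp: \<U>_def)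
    show "openin (top_of_set X) U"
      unfolding U N_def by (intro openin_Union) (auto intro!: openin_pseudoball[OF assms(2)])
    have "diam_wrt D U \<le> e1 + 2 * r"
    proof (rule diam_wrt_le)
      fix x y assume "x \<in> U" "y \<in> U"
      then obtain a b where ab: "a \<in> X" "b \<in> X" "code a = code b" "x \<in> X" "y \<in> X" "D x a < r" "D y b < r"
        by (auto simp: U N_def)
      have "D x y \<le> D x a + D a b + D y b"
        using cont_pseudometric_diff_le[OF assms(2)] ab by blast
      then show "D x y \<le> e1 + 2 * r" using code[OF ab(1,2,3)] ab by linarith
    qed (use assms(4) r in simp)
    then show "diam_wrt D U < e" using assms(3) by (simp add: r_def field_simps)
  qed
  moreover have "card \<U> \<le> card (code ` X)"
    unfolding \<U>_def using assms(5) by (rule card_image_le)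
  ultimately show ?thesis using that by blast
qed

lemma cover_num_le_code:
  assumes "compact X" "cont_pseudometric X D" "e1 < e" "0 \<le> e1" "finite (code ` X)"
    and "\<And>x y. x \<in> X \<Longrightarrow> y \<in> X \<Longrightarrow> code x = code y \<Longrightarrow> D x y \<le> e1"
  shows "cover_num X D e \<le> card (code ` X)"
  using small_cover_code[OF assms] cover_num_le order_trans by metis

lemma small_cover_exists:
  assumes "compact X" "cont_pseudometric X D" "e > 0"
  shows "\<exists>\<U>. small_cover X D e \<U>"
proof -
  obtain Z where Z: "finite Z" "Z \<subseteq> X" "\<And>x. x \<in> X \<Longrightarrow> \<exists>z\<in>Z. D x z < e/4"
    using cont_pseudometric_net[OF assms(1,2), of "e/4"] assms(3) by auto
  then obtain code where code: "\<And>x. x \<in> X \<Longrightarrow> code x \<in> Z \<and> D x (code x) < e/4" by metis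
  have "finite (code ` X)" using code Z(1) by (meson finite_subset image_subsetI)
  moreover have "D x y \<le> e/2" if xy: "x \<in> X" "y \<in> X" "code x = code y" for x y
  proof -
    have "D x y \<le> D x (code x) + D (code x) y" "D (code x) y = D y (code x)"
      using cont_pseudometricD(3,4)[OF assms(2)] xy code Z(2) by blast+
    moreover have "D y (code x) < e/4" using code[OF xy(2)] xy(3) by simp
    ultimately show ?thesis using code[OF xy(1)] by linarith
  qed
  moreover have "e/2 < e" "0 \<le> e/2" using assms(3) by auto
  ultimately obtain \<U> where "small_cover X D e \<U>"
    using small_cover_code[OF assms(1,2), of "e/2" e code] by metis
  then show ?thesis ..
qed

lemma cover_numE:
  assumes "compact X" "cont_pseudometric X D" "e > 0"
  obtains \<U> where "small_cover X D e \<U>" "card \<U> = cover_num X D e"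
  using small_cover_exists[OF assms] cover_num_attained by metis

lemma cover_num_pos:
  assumes "compact X" "cont_pseudometric X D" "e > 0" "X \<noteq> {}"
  shows "1 \<le> cover_num X D e"
proof -
  obtain \<U> where \<U>: "small_cover X D e \<U>" "card \<U> = cover_num X D e"
    using cover_numE[OF assms(1-3)] by blast
  then have "\<U> \<noteq> {}" "finite \<U>" using assms(4) by (auto simp: small_cover_def)
  then show ?thesis using \<U>(2) card_gt_0_iff[of \<U>] by linarith
qed

lemma cover_num_mono:
  assumes "compact X" "cont_pseudometric X D" "cont_pseudometric X E" "e > 0"
    and close: "\<And>x y. x \<in> X \<Longrightarrow> y \<in> X \<Longrightarrow> E x y \<le> D x y + c" and e': "e + c \<le> e'" "0 \<le> c"
  shows "cover_num X E e' \<le> cover_num X D e"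
proof -
  obtain \<U> where \<U>: "small_cover X D e \<U>" "card \<U> = cover_num X D e"
    using cover_numE[OF assms(1,2,4)] by blast
  have "small_cover X E e' \<U>" unfolding small_cover_def
  proof (intro conjI ballI)
    fix U assume U: "U \<in> \<U>"
    have d: "diam_wrt D U < e" and UX: "U \<subseteq> X" using \<U>(1) U by (auto simp: small_cover_def)
    show "diam_wrt E U < e'"
    proof (cases "U = {}")
      case False
      then obtain u where u: "u \<in> U" by blast
      have 0: "0 \<le> diam_wrt D U"
        using le_diam_wrt[OF assms(1,2) UX u u] cont_pseudometricD(2)[OF assms(2)] u UX by fastforce
      have "diam_wrt E U \<le> diam_wrt D U + c"
      proof (rule diam_wrt_le)
        fix x y assume "x \<in> U" "y \<in> U"
        then show "E x y \<le> diam_wrt D U + c"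
          using close[of x y] le_diam_wrt[OF assms(1,2) UX, of x y] UX by fastforce
      qed (use 0 e' in simp)
      then show ?thesis using d e' by simp
    qed (use assms(4) e' in \<open>simp add: diam_wrt_def\<close>)
  qed (use \<U>(1) in \<open>auto simp: small_cover_def\<close>)
  then show ?thesis using cover_num_le \<U>(2) by metis
qed

lemma cover_num_max:
  assumes "compact X" "cont_pseudometric X D" "cont_pseudometric X E" "e > 0"
  shows "cover_num X (\<lambda>x y. max (D x y) (E x y)) e \<le> cover_num X D e * cover_num X E e"
proof -
  obtain \<U> where \<U>: "small_cover X D e \<U>" "card \<U> = cover_num X D e"
    using cover_numE[OF assms(1,2,4)] by blast
  obtain \<V> where \<V>: "small_cover X E e \<V>" "card \<V> = cover_num X E e"
    using cover_numE[OF assms(1,3,4)] by blast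
  define \<W> where "\<W> = (\<lambda>z. fst z \<inter> snd z) ` (\<U> \<times> \<V>)"
  have fin: "finite (\<U> \<times> \<V>)" using \<U>(1) \<V>(1) by (simp add: small_cover_def)
  have "small_cover X (\<lambda>x y. max (D x y) (E x y)) e \<W>" unfolding small_cover_def
  proof (intro conjI ballI)
    show "finite \<W>" using fin by (simp add: \<W>_def)
    have "\<Union>\<W> = \<Union>\<U> \<inter> \<Union>\<V>" by (auto simp: \<W>_def)
    then show "\<Union>\<W> = X" using \<U>(1) \<V>(1) by (simp add: small_cover_def)
    fix W assume "W \<in> \<W>"
    then obtain U V where W: "U \<in> \<U>" "V \<in> \<V>" "W = U \<inter> V" by (auto simp: \<W>_def)
    have UV: "openin (top_of_set X) U" "diam_wrt D U < e" "U \<subseteq> X" "openin (top_of_set X) V" "diam_wrt E V < e" "V \<subseteq> X"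
      using \<U>(1) \<V>(1) W by (auto simp: small_cover_def)
    show "openin (top_of_set X) W" using UV W(3) by (simp add: openin_Int)
    show "diam_wrt (\<lambda>x y. max (D x y) (E x y)) W < e"
    proof (cases "W = {}")
      case False
      then obtain u where u: "u \<in> W" by blast
      have 0: "0 \<le> diam_wrt D U"
        using le_diam_wrt[OF assms(1,2) UV(3), of u u] cont_pseudometricD(2)[OF assms(2), of u] u UV W(3) by auto
      have "diam_wrt (\<lambda>x y. max (D x y) (E x y)) W \<le> max (diam_wrt D U) (diam_wrt E V)"
      proof (rule diam_wrt_le)
        fix x y assume "x \<in> W" "y \<in> W"
        then have "D x y \<le> diam_wrt D U" "E x y \<le> diam_wrt E V"
          using le_diam_wrt[OF assms(1,2) UV(3), of x y] le_diam_wrt[OF assms(1,3) UV(6), of x y] W(3) by auto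
        then show "max (D x y) (E x y) \<le> max (diam_wrt D U) (diam_wrt E V)" by linarith
      qed (use 0 in simp)
      then show ?thesis using UV by simp
    qed (use assms(4) in \<open>simp add: diam_wrt_def\<close>)
  qed
  then have "cover_num X (\<lambda>x y. max (D x y) (E x y)) e \<le> card \<W>" by (rule cover_num_le)
  also have "\<dots> \<le> card (\<U> \<times> \<V>)" unfolding \<W>_def using fin by (rule card_image_le)
  finally show ?thesis using \<U>(2) \<V>(2) by (simp add: card_cartesian_product)
qed

text \<open>Since \<open>f\<close> is onto, the preimage of a set maps onto that set and has the
  same diameter. Applied to the translations \<open>T p\<close>.\<close>

lemma cover_num_pullback:
  assumes "compact X" "cont_pseudometric X D" "e > 0" "compact Y" "continuous_on Y f" "f ` Y = X"
  shows "cover_num Y (\<lambda>x y. D (f x) (f y)) e \<le> cover_num X D e"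
proof -
  obtain \<U> where \<U>: "small_cover X D e \<U>" "card \<U> = cover_num X D e"
    using cover_numE[OF assms(1,2,3)] by blast
  define \<V> where "\<V> = (\<lambda>U. Y \<inter> f -` U) ` \<U>"
  have fin: "finite \<U>" using \<U>(1) by (simp add: small_cover_def)
  have "small_cover Y (\<lambda>x y. D (f x) (f y)) e \<V>" unfolding small_cover_def
  proof (intro conjI ballI)
    show "finite \<V>" using fin by (simp add: \<V>_def)
    have "\<Union>\<V> = Y \<inter> f -` (\<Union>\<U>)" by (auto simp: \<V>_def)
    then show "\<Union>\<V> = Y" using \<U>(1) assms(6) by (auto simp: small_cover_def)
    fix V assume "V \<in> \<V>"
    then obtain U where U: "U \<in> \<U>" "V = Y \<inter> f -` U" by (auto simp: \<V>_def)
    have oU: "openin (top_of_set X) U" "diam_wrt D U < e" using \<U>(1) U(1) by (auto simp: small_cover_def)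
    show "openin (top_of_set Y) V" unfolding U(2)
      using continuous_openin_preimage[OF assms(5) _ oU(1)] assms(6) by auto
    have "U \<subseteq> f ` Y" using openin_imp_subset[OF oU(1)] assms(6) by simp
    then have im: "f ` V = U" using U(2) by blast
    have "{D (f x) (f y) |x y. x \<in> V \<and> y \<in> V} = {D x y |x y. x \<in> f ` V \<and> y \<in> f ` V}" by blast
    then have "diam_wrt (\<lambda>x y. D (f x) (f y)) V = diam_wrt D (f ` V)"
      unfolding diam_wrt_def by simp
    then show "diam_wrt (\<lambda>x y. D (f x) (f y)) V < e" using im oU(2) by simp
  qed
  then have "cover_num Y (\<lambda>x y. D (f x) (f y)) e \<le> card \<V>" by (rule cover_num_le)
  also have "\<dots> \<le> card \<U>" unfolding \<V>_def using fin by (rule card_image_le)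
  finally show ?thesis using \<U>(2) by simp
qed

section \<open>Averages over cubes\<close>

lemma cube_eq_image: "cube N = vec_lambda ` (UNIV \<rightarrow>\<^sub>E {0..<int N})"
proof
  show "cube N \<subseteq> vec_lambda ` (UNIV \<rightarrow>\<^sub>E {0..<int N})"
  proof
    fix n :: "int^'k" assume "n \<in> cube N"
    then have "($) n \<in> UNIV \<rightarrow>\<^sub>E {0..<int N}" by (auto simp: cube_def)
    then show "n \<in> vec_lambda ` (UNIV \<rightarrow>\<^sub>E {0..<int N})"
      by (metis image_eqI vec_nth_inverse)
  qed
qed (auto simp: cube_def PiE_def Pi_def)

lemma finite_cube: "finite (cube N)"
  unfolding cube_eq_image by (intro finite_imageI finite_PiE) auto

lemma card_cube: "card (cube N :: (int^'k::finite) set) = N ^ CARD('k)"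
proof -
  have "inj_on vec_lambda (UNIV \<rightarrow>\<^sub>E {0..<int N} :: ('k \<Rightarrow> int) set)"
    by (auto simp: inj_on_def vec_lambda_inject)
  then show ?thesis unfolding cube_eq_image by (simp add: card_image card_PiE)
qed

lemma cube_nonempty: "N \<ge> 1 \<Longrightarrow> cube N \<noteq> {}"
proof -
  assume "N \<ge> 1"
  then have "0 \<in> cube N" by (simp add: cube_def)
  then show ?thesis by blast
qed

lemma cube_subset_translates:
  assumes "N \<ge> 1"
  shows "(cube L :: (int^'k::finite) set) \<subseteq> (\<Union>j\<in>cube (L div N + 1). (+) (\<chi> i. int N * j $ i) ` cube N)"
proof
  fix n :: "int^'k" assume n: "n \<in> cube L"
  define j :: "int^'k" where "j = (\<chi> i. n $ i div int N)"
  define r :: "int^'k" where "r = (\<chi> i. n $ i mod int N)"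
  have "n = (\<chi> i. int N * j $ i) + r" by (simp add: vec_eq_iff j_def r_def)
  moreover have "r \<in> cube N" using assms by (simp add: cube_def r_def)
  moreover have "j \<in> cube (L div N + 1)"
  proof -
    have "n $ i div int N < int (L div N + 1)" for i
    proof -
      have "n $ i div int N \<le> int L div int N"
        using n assms by (intro zdiv_mono1) (auto simp: cube_def less_imp_le)
      then show ?thesis by (simp add: zdiv_int)
    qed
    moreover have "0 \<le> n $ i div int N" for i
      using n assms by (simp add: cube_def pos_imp_zdiv_nonneg_iff)
    ultimately show ?thesis by (simp add: cube_def j_def)
  qed
  ultimately show "n \<in> (\<Union>j\<in>cube (L div N + 1). (+) (\<chi> i. int N * j $ i) ` cube N)" by blast
qed

text \<open>Serves both \<open>widim\<close> and the logarithm of the covering number, hence the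
  real-valued \<open>\<phi>\<close>. Empty index sets are excluded throughout because
  \<open>dyn_metric\<close> would be a supremum over nothing.\<close>

lemma cube_subadditive_bound:
  fixes \<phi> :: "(int^'k::finite) set \<Rightarrow> real"
  assumes subadd: "\<And>A B. finite A \<Longrightarrow> finite B \<Longrightarrow> A \<noteq> {} \<Longrightarrow> B \<noteq> {} \<Longrightarrow> \<phi> (A \<union> B) \<le> \<phi> A + \<phi> B"
    and mono: "\<And>A B. finite B \<Longrightarrow> A \<noteq> {} \<Longrightarrow> A \<subseteq> B \<Longrightarrow> \<phi> A \<le> \<phi> B"
    and trans: "\<And>A p. finite A \<Longrightarrow> A \<noteq> {} \<Longrightarrow> \<phi> ((+) p ` A) \<le> \<phi> A"
    and "N \<ge> 1" "L \<ge> 1"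
  shows "\<phi> (cube L) \<le> real (L div N + 1) ^ CARD('k) * \<phi> (cube N)"
proof -
  have fin_sum: "\<phi> (\<Union>j\<in>J. F j) \<le> (\<Sum>j\<in>J. \<phi> (F j))"
    if "finite J" "J \<noteq> {}" "\<And>j. j \<in> J \<Longrightarrow> finite (F j) \<and> F j \<noteq> {}" for J and F :: "int^'k \<Rightarrow> (int^'k) set"
    using that
  proof (induction rule: finite_ne_induct)
    case (insert j J)
    have "\<phi> (\<Union>i\<in>insert j J. F i) \<le> \<phi> (F j) + \<phi> (\<Union>i\<in>J. F i)"
      using insert.prems insert.hyps by (auto intro!: subadd)
    also have "\<phi> (\<Union>i\<in>J. F i) \<le> (\<Sum>j\<in>J. \<phi> (F j))" using insert by auto
    finally show ?case using insert.hyps by simp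
  qed simp
  define J :: "(int^'k) set" where "J = cube (L div N + 1)"
  define F where "F j = (+) (\<chi> i. int N * j $ i) ` (cube N :: (int^'k) set)" for j :: "int^'k"
  have J: "finite J" "J \<noteq> {}" by (auto simp: J_def finite_cube cube_nonempty)
  have F: "finite (F j)" "F j \<noteq> {}" for j
    using cube_nonempty[OF assms(4)] by (auto simp: F_def finite_cube)
  have "\<phi> (cube L) \<le> \<phi> (\<Union>j\<in>J. F j)"
    using J F cube_subset_translates[OF assms(4), of L] cube_nonempty[OF assms(5)]
    unfolding J_def F_def by (intro mono) auto
  also have "\<dots> \<le> (\<Sum>j\<in>J. \<phi> (F j))" using J F by (intro fin_sum) auto
  also have "\<dots> \<le> (\<Sum>j\<in>J. \<phi> (cube N))"
    unfolding F_def using cube_nonempty[OF assms(4)] finite_cube by (intro sum_mono trans) auto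
  also have "\<dots> = real (card J) * \<phi> (cube N)" by simp
  finally show ?thesis by (simp add: J_def card_cube)
qed

text \<open>Fekete's lemma for cubes: covering a large cube by translates of the
  \<open>N\<close>-cube costs only the factor \<open>((L + N) / L) ^ k\<close>, which tends to 1, so
  each single average bounds the upper limit.\<close>

lemma cube_average_tendsto:
  fixes a :: "nat \<Rightarrow> real"
  assumes bound: "\<And>N L. N \<ge> 1 \<Longrightarrow> L \<ge> 1 \<Longrightarrow> a L \<le> real (L div N + 1) ^ k * a N"
    and nonneg: "\<And>N. N \<ge> 1 \<Longrightarrow> 0 \<le> a N"
  shows "(\<lambda>N. a N / real N ^ k) \<longlonglongrightarrow> (INF N\<in>{1..}. a N / real N ^ k)"
proof -
  define l where "l = (INF N\<in>{1..}. a N / real N ^ k)"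
  have bdd: "bdd_below ((\<lambda>N. a N / real N ^ k) ` {1..})"
    using nonneg by (auto simp: bdd_below_def intro!: exI[of _ 0])
  have low: "l \<le> a N / real N ^ k" if "N \<ge> 1" for N
    unfolding l_def using that bdd by (intro cINF_lower) auto
  show ?thesis unfolding l_def[symmetric]
  proof (rule order_tendstoI)
    fix y assume "y < l"
    then show "\<forall>\<^sub>F N in sequentially. y < a N / real N ^ k"
      using low by (intro eventually_sequentiallyI[of 1]) (metis less_le_trans)
  next
    fix y assume "l < y"
    then obtain N where N: "N \<ge> 1" "a N / real N ^ k < y"
      unfolding l_def using cInf_lessD[of "(\<lambda>N. a N / real N ^ k) ` {1..}" y] by auto
    define g where "g L = ((real L + real N) / real L) ^ k * (a N / real N ^ k)" for L
    have "(\<lambda>L. (real L + real N) / real L) \<longlonglongrightarrow> 1" by real_asymp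
    then have "g \<longlonglongrightarrow> 1 ^ k * (a N / real N ^ k)"
      unfolding g_def by (intro tendsto_mult tendsto_power tendsto_const)
    then have "\<forall>\<^sub>F L in sequentially. g L < y" using N(2) by (intro order_tendstoD(2)) auto
    moreover have "\<forall>\<^sub>F L in sequentially. a L / real L ^ k \<le> g L"
    proof (rule eventually_sequentiallyI[of 1])
      fix L :: nat assume L: "1 \<le> L"
      have "(L div N) * N \<le> L" by simp
      then have "real (L div N) * real N \<le> real L" by (metis of_nat_le_iff of_nat_mult)
      then have "real (L div N + 1) \<le> (real L + real N) / real N"
        using N(1) by (simp add: field_simps)
      then have "real (L div N + 1) ^ k \<le> ((real L + real N) / real N) ^ k"
        by (intro power_mono) auto
      then have "a L \<le> ((real L + real N) / real N) ^ k * a N"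
        using bound[OF N(1) L] nonneg[OF N(1)] by (meson mult_right_mono order_trans)
      then have "a L / real L ^ k \<le> ((real L + real N) / real N) ^ k * a N / real L ^ k"
        by (intro divide_right_mono) auto
      also have "\<dots> = g L" unfolding g_def by (simp add: power_divide)
      finally show "a L / real L ^ k \<le> g L" .
    qed
    ultimately show "\<forall>\<^sub>F N in sequentially. a N / real N ^ k < y"
      by eventually_elim simp
  qed
qed

context Zk_action
begin

abbreviation widim_avg :: "real \<Rightarrow> nat \<Rightarrow> real" where
  "widim_avg e N \<equiv> real (widim X (dyn N dist) e) / real N ^ CARD('k)"

abbreviation cover_avg :: "('a \<Rightarrow> 'a \<Rightarrow> real) \<Rightarrow> real \<Rightarrow> nat \<Rightarrow> real" where
  "cover_avg d e N \<equiv> ln (real (cover_num X (dyn N d) e)) / real N ^ CARD('k)"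

definition widim_rate :: "real \<Rightarrow> real" where
  "widim_rate e = (INF N\<in>{1..}. widim_avg e N)"

definition cover_rate :: "('a \<Rightarrow> 'a \<Rightarrow> real) \<Rightarrow> real \<Rightarrow> real" where
  "cover_rate d e = (INF N\<in>{1..}. cover_avg d e N)"

lemma small_map_dyn:
  assumes "cont_pseudometric X D" "finite A" "A \<noteq> {}" "e > 0"
  shows "small_map X (dyn_metric T A D) e (widim X (dyn_metric T A D) e)"
  using assms small_map_widim[OF compact_X _ _ nonempty] cont_pseudometric_dyn by blast

lemma widim_tendsto:
  assumes "e > 0"
  shows "(\<lambda>N. widim_avg e N) \<longlonglongrightarrow> widim_rate e"
  unfolding widim_rate_def
proof (rule cube_average_tendsto)
  fix N L :: nat assume NL: "N \<ge> 1" "L \<ge> 1"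
  note pm = cont_pseudometric_dyn[OF cont_pseudometric_dist]
  note le = widim_le[OF compact_X pm assms nonempty]
  note sm = small_map_dyn[OF cont_pseudometric_dist _ _ assms]
  show "real (widim X (dyn L dist) e)
    \<le> real (L div N + 1) ^ CARD('k) * real (widim X (dyn N dist) e)"
  proof (rule cube_subadditive_bound[of "\<lambda>A. real (widim X (dyn_metric T A dist) e)", OF _ _ _ NL])
    fix A B :: "(int^'k) set" assume AB: "finite A" "finite B" "A \<noteq> {}" "B \<noteq> {}"
    have "widim X (dyn_metric T (A \<union> B) dist) e
      \<le> widim X (dyn_metric T A dist) e + widim X (dyn_metric T B dist) e"
      using small_map_max[OF sm[OF AB(1,3)] sm[OF AB(2,4)]] AB
      by (intro le) (auto simp: dyn_metric_Un)
    then show "real (widim X (dyn_metric T (A \<union> B) dist) e)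
      \<le> real (widim X (dyn_metric T A dist) e) + real (widim X (dyn_metric T B dist) e)" by simp
  next
    fix A B :: "(int^'k) set" assume AB: "finite B" "A \<noteq> {}" "A \<subseteq> B"
    then have A: "finite A" "B \<noteq> {}" by (auto intro: finite_subset)
    have "small_map X (dyn_metric T A dist) e (widim X (dyn_metric T B dist) e)"
      by (rule small_map_mono[OF sm[OF AB(1) A(2)] order_refl order_refl])
        (rule dyn_metric_mono[OF AB])
    then show "real (widim X (dyn_metric T A dist) e) \<le> real (widim X (dyn_metric T B dist) e)"
      using le[OF A(1) AB(2)] by simp
  next
    fix A :: "(int^'k) set" and p assume A: "finite A" "A \<noteq> {}"
    have "small_map X (\<lambda>x y. dyn_metric T A dist (T p x) (T p y)) e (widim X (dyn_metric T A dist) e)"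
      by (rule small_map_pullback[OF sm[OF A] T_cont]) (simp add: T_image)
    then have "small_map X (dyn_metric T ((+) p ` A) dist) e (widim X (dyn_metric T A dist) e)"
      by (rule small_map_mono) (simp_all add: dyn_metric_translate)
    then show "real (widim X (dyn_metric T ((+) p ` A) dist) e) \<le> real (widim X (dyn_metric T A dist) e)"
      using le[of "(+) p ` A"] A by simp
  qed
qed simp

lemma cover_tendsto:
  assumes "cont_pseudometric X d" "e > 0"
  shows "(\<lambda>N. cover_avg d e N) \<longlonglongrightarrow> cover_rate d e"
  unfolding cover_rate_def
proof (rule cube_average_tendsto)
  fix N L :: nat assume NL: "N \<ge> 1" "L \<ge> 1"
  note pm = cont_pseudometric_dyn[OF assms(1)]
  note pos = cover_num_pos[OF compact_X pm assms(2) nonempty]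
  show "ln (real (cover_num X (dyn L d) e))
    \<le> real (L div N + 1) ^ CARD('k) * ln (real (cover_num X (dyn N d) e))"
  proof (rule cube_subadditive_bound[of "\<lambda>A. ln (real (cover_num X (dyn_metric T A d) e))", OF _ _ _ NL])
    fix A B :: "(int^'k) set" assume AB: "finite A" "finite B" "A \<noteq> {}" "B \<noteq> {}"
    let ?a = "cover_num X (dyn_metric T A d) e" and ?b = "cover_num X (dyn_metric T B d) e"
    have "cover_num X (dyn_metric T (A \<union> B) d) e \<le> ?a * ?b"
      using cover_num_max[OF compact_X pm[OF AB(1,3)] pm[OF AB(2,4)] assms(2)] AB
      by (simp add: dyn_metric_Un)
    moreover have "1 \<le> cover_num X (dyn_metric T (A \<union> B) d) e" using AB by (intro pos) auto
    ultimately have "ln (real (cover_num X (dyn_metric T (A \<union> B) d) e)) \<le> ln (real (?a * ?b))"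
      by (intro ln_mono) (auto simp del: of_nat_mult)
    also have "\<dots> = ln (real ?a) + ln (real ?b)"
    proof -
      have "0 < real ?a" "0 < real ?b" using pos[OF AB(1,3)] pos[OF AB(2,4)] by linarith+
      then show ?thesis by (simp add: ln_mult)
    qed
    finally show "ln (real (cover_num X (dyn_metric T (A \<union> B) d) e)) \<le> ln (real ?a) + ln (real ?b)" .
  next
    fix A B :: "(int^'k) set" assume AB: "finite B" "A \<noteq> {}" "A \<subseteq> B"
    then have A: "finite A" "B \<noteq> {}" by (auto intro: finite_subset)
    have "cover_num X (dyn_metric T A d) e \<le> cover_num X (dyn_metric T B d) e"
      by (rule cover_num_mono[OF compact_X pm[OF AB(1) A(2)] pm[OF A(1) AB(2)] assms(2), where c = 0])
        (simp_all add: dyn_metric_mono[OF AB])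
    then show "ln (real (cover_num X (dyn_metric T A d) e)) \<le> ln (real (cover_num X (dyn_metric T B d) e))"
      using pos[OF A(1) AB(2)] by simp
  next
    fix A :: "(int^'k) set" and p assume A: "finite A" "A \<noteq> {}"
    then have A': "finite ((+) p ` A)" "(+) p ` A \<noteq> {}" by auto
    have "cover_num X (dyn_metric T ((+) p ` A) d) e \<le> cover_num X (\<lambda>x y. dyn_metric T A d (T p x) (T p y)) e"
      by (rule cover_num_mono[OF compact_X cont_pseudometric_shift[OF pm[OF A]] pm[OF A'] assms(2), where c = 0])
        (simp_all add: dyn_metric_translate)
    also have "\<dots> \<le> cover_num X (dyn_metric T A d) e"
      by (rule cover_num_pullback[OF compact_X pm[OF A] assms(2) compact_X T_cont T_image])
    finally show "ln (real (cover_num X (dyn_metric T ((+) p ` A) d) e)) \<le> ln (real (cover_num X (dyn_metric T A d) e))"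
      using pos[OF A'] by simp
  qed
next
  fix N :: nat assume "N \<ge> 1"
  then have "1 \<le> cover_num X (dyn N d) e"
    using cover_num_pos[OF compact_X cont_pseudometric_dyn[OF assms(1)] assms(2) nonempty]
      finite_cube cube_nonempty by blast
  then show "0 \<le> ln (real (cover_num X (dyn N d) e))" by simp
qed

lemma widim_rate_less:
  assumes "widim_rate e < c"
  obtains N where "N \<ge> 1" "widim_avg e N < c"
  using assms cInf_lessD[of "(\<lambda>N. widim_avg e N) ` {1..}" c]
  unfolding widim_rate_def by auto

lemma cover_rate_le:
  assumes "cont_pseudometric X d" "e > 0" "N \<ge> 1"
  shows "cover_rate d e \<le> cover_avg d e N"
  unfolding cover_rate_def
proof (rule cINF_lower)
  have "0 \<le> cover_avg d e N" if "N \<ge> 1" for N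
  proof -
    have "1 \<le> cover_num X (dyn N d) e"
      using cover_num_pos[OF compact_X cont_pseudometric_dyn[OF assms(1)] assms(2) nonempty]
        finite_cube cube_nonempty[OF that] by blast
    then show ?thesis by simp
  qed
  then show "bdd_below ((\<lambda>N. cover_avg d e N) ` {1..})"
    by (auto simp: bdd_below_def intro!: exI[of _ 0])
qed (use assms in simp)

lemma widim_rate_antimono:
  assumes "0 < e" "e \<le> e'"
  shows "widim_rate e' \<le> widim_rate e"
proof (rule LIMSEQ_le[OF widim_tendsto widim_tendsto])
  show "\<exists>N0. \<forall>N\<ge>N0. widim_avg e' N
      \<le> widim_avg e N"
  proof (intro exI[of _ 1] allI impI divide_right_mono)
    fix N :: nat assume N: "1 \<le> N"
    note pm = cont_pseudometric_dyn[OF cont_pseudometric_dist finite_cube cube_nonempty[OF N]]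
    have "small_map X (dyn N dist) e' (widim X (dyn N dist) e)"
      by (rule small_map_mono[OF small_map_widim[OF compact_X pm assms(1) nonempty] order_refl assms(2)]) simp
    then show "real (widim X (dyn N dist) e') \<le> real (widim X (dyn N dist) e)"
      using widim_le[OF compact_X pm _ nonempty, of e'] assms by simp
  qed simp
qed (use assms in auto)

text \<open>\<open>widim_rate\<close> grows as the scale decreases, so the limit at 0 exists in
  \<open>ereal\<close> and is a supremum; this gives \<open>Lim\<close> its intended value.\<close>

lemma mdim_eq: "mdim X T = (SUP e\<in>{0<..}. ereal (widim_rate e))"
proof -
  define g where "g e = lim (\<lambda>N. ereal (widim_avg e N))" for e
  define s where "s = (SUP e\<in>{0<..}. ereal (widim_rate e))"
  have g: "g e = ereal (widim_rate e)" if "e > 0" for e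
    unfolding g_def using widim_tendsto[OF that] by (intro limI) simp
  have "(g \<longlongrightarrow> s) (at_right 0)"
  proof (rule order_tendstoI)
    fix y assume "y < s"
    then obtain e where e: "e > 0" "y < ereal (widim_rate e)" unfolding s_def less_SUP_iff by auto
    have "y < g e'" if "e' > 0" "e' < e" for e'
      using g[OF that(1)] widim_rate_antimono[of e' e] that e(2)
      by (metis ereal_less_eq(3) less_eq_real_def less_le_trans)
    then show "\<forall>\<^sub>F e in at_right 0. y < g e" using e(1) by (auto simp: eventually_at_right_field)
  next
    fix y assume "s < y"
    have "g e < y" if "e > 0" for e
    proof -
      have "ereal (widim_rate e) \<le> s" unfolding s_def using that by (intro SUP_upper) auto
      then show ?thesis using g[OF that] \<open>s < y\<close> by simp
    qed
    then show "\<forall>\<^sub>F e in at_right 0. g e < y"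
      by (auto simp: eventually_at_right_field intro!: exI[of _ 1])
  qed
  then show ?thesis unfolding mdim_def g_def[symmetric] s_def[symmetric] by (intro tendsto_Lim) auto
qed

lemma mdim_M_eq:
  assumes "cont_pseudometric X d"
  shows "mdim_M X T d = Liminf (at_right 0) (\<lambda>e. ereal (cover_rate d e / \<bar>ln e\<bar>))"
  unfolding mdim_M_def
proof (rule Liminf_eq)
  have "lim (\<lambda>N. ereal (cover_avg d e N))
      = ereal (cover_rate d e)" if "e > 0" for e
    using cover_tendsto[OF assms that] by (intro limI) simp
  then show "\<forall>\<^sub>F e in at_right 0. lim (\<lambda>N. ereal (cover_avg d e N))
      / ereal \<bar>ln e\<bar> = ereal (cover_rate d e / \<bar>ln e\<bar>)"
    \<comment> \<open>Below scale 1 the divisor \<open>\<bar>ln e\<bar>\<close> is nonzero, so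
      division in \<open>ereal\<close> agrees with division of reals.\<close>
    unfolding eventually_at_right_field by (intro exI[of _ 1]) auto
qed

end

section \<open>Mean dimension is at most metric mean dimension\<close>

lemma continuous_on_Min_insert:
  fixes g :: "'i \<Rightarrow> 'a::topological_space \<Rightarrow> real"
  assumes "finite A" "\<And>i. i \<in> A \<Longrightarrow> continuous_on X (g i)"
  shows "continuous_on X (\<lambda>x. Min (insert c ((\<lambda>i. g i x) ` A)))"
  using assms
proof (induction rule: finite_induct)
  case (insert a A)
  have "Min (insert c ((\<lambda>i. g i x) ` insert a A)) = min (g a x) (Min (insert c ((\<lambda>i. g i x) ` A)))" for x
    using insert.hyps by (simp add: insert_commute[of c])
  then show ?case using insert by (auto intro!: continuous_on_min)
qed simp

lemma continuous_on_Max_insert: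
  fixes g :: "'i \<Rightarrow> 'a::topological_space \<Rightarrow> real"
  assumes "finite A" "\<And>i. i \<in> A \<Longrightarrow> continuous_on X (g i)"
  shows "continuous_on X (\<lambda>x. Max (insert c ((\<lambda>i. g i x) ` A)))"
  using assms
proof (induction rule: finite_induct)
  case (insert a A)
  have "Max (insert c ((\<lambda>i. g i x) ` insert a A)) = max (g a x) (Max (insert c ((\<lambda>i. g i x) ` A)))" for x
    using insert.hyps by (simp add: insert_commute[of c])
  then show ?case using insert by (auto intro!: continuous_on_max)
qed simp

text \<open>A point of the cube is sent to the barycentric coordinates indexed by its upper level sets
  (the staircase triangulation), so the dimension is the number of coordinates strictly between
  0 and 1.\<close>
lemma small_map_from_cube:
  fixes g :: "'i \<Rightarrow> 'a::topological_space \<Rightarrow> real"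
  assumes I: "finite I" and g: "\<And>i. i \<in> I \<Longrightarrow> continuous_on X (g i)"
    and few: "\<And>x. x \<in> X \<Longrightarrow> card {i \<in> I. 0 < g i x \<and> g i x < 1} \<le> n"
    and fib: "\<And>x y A. x \<in> X \<Longrightarrow> y \<in> X \<Longrightarrow> A \<subseteq> I \<Longrightarrow>
       (\<And>i. i \<in> A \<Longrightarrow> 0 < g i x \<and> 0 < g i y) \<Longrightarrow> (\<And>i. i \<in> I - A \<Longrightarrow> g i x < 1 \<and> g i y < 1) \<Longrightarrow> D x y < e"
  shows "small_map X D e n"
proof -
  \<comment> \<open>The levels \<open>s\<close> in \<open>[0,1)\<close> with upper level set
    \<open>A\<close> form the interval from \<open>hi A x\<close> to \<open>lo A x\<close>, and
    \<open>t A x\<close> is its length. The inserted constants 1 and 0 are the ends of the range and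
    keep \<open>Min\<close> and \<open>Max\<close> defined on empty sets.\<close>
  define lo where "lo A x = Min (insert 1 ((\<lambda>i. g i x) ` A))" for A x
  define hi where "hi A x = Max (insert 0 ((\<lambda>i. g i x) ` (I - A)))" for A x
  define t where "t A x = max 0 (lo A x - hi A x)" for A x
  have finA: "finite A" if "A \<subseteq> I" for A using that I finite_subset by blast
  have lo_gt: "s < lo A x \<longleftrightarrow> s < 1 \<and> (\<forall>i\<in>A. s < g i x)" if "A \<subseteq> I" for A x s
    unfolding lo_def using finA[OF that] by (subst Min_gr_iff) auto
  have hi_le: "hi A x \<le> s \<longleftrightarrow> 0 \<le> s \<and> (\<forall>i\<in>I - A. g i x \<le> s)" for A x s
    unfolding hi_def using I by (subst Max_le_iff) auto
  have pos: "0 < t A x \<Longrightarrow> hi A x < lo A x" for A x unfolding t_def by linarith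
  have level: "A = {i \<in> I. hi A x < g i x}" "0 \<le> hi A x" "hi A x < 1" if "A \<subseteq> I" "0 < t A x" for A x
  proof -
    have l: "hi A x < 1" "\<forall>i\<in>A. hi A x < g i x" using lo_gt[OF that(1), of "hi A x" x] pos[OF that(2)] by auto
    have h: "0 \<le> hi A x" "\<forall>i\<in>I - A. g i x \<le> hi A x" using hi_le[of A x "hi A x"] by auto
    have "i \<in> A \<longleftrightarrow> hi A x < g i x" if "i \<in> I" for i
      using l(2) h(2) that by (meson DiffI not_less)
    then show "A = {i \<in> I. hi A x < g i x}" using that(1) by blast
    show "0 \<le> hi A x" "hi A x < 1" by fact+
  qed
  \<comment> \<open>Every level in \<open>[0,1)\<close> has exactly one upper level set, so the
    lengths add up to the length of \<open>[0,1)\<close>.\<close>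
  have sum1: "(\<Sum>A\<in>Pow I. t A x) = 1" for x
  proof -
    define S where "S A = {s. 0 \<le> s \<and> s < 1 \<and> {i \<in> I. s < g i x} = A}" for A :: "'i set"
    have S: "S A = {hi A x..<lo A x}" if "A \<subseteq> I" for A
    proof -
      have "s \<in> S A \<longleftrightarrow> hi A x \<le> s \<and> s < lo A x" for s
      proof -
        have eq: "{i \<in> I. s < g i x} = A \<longleftrightarrow> (\<forall>i\<in>A. s < g i x) \<and> (\<forall>i\<in>I - A. g i x \<le> s)"
        proof
          assume r: "(\<forall>i\<in>A. s < g i x) \<and> (\<forall>i\<in>I - A. g i x \<le> s)"
          have "s < g i x \<longleftrightarrow> i \<in> A" if "i \<in> I" for i using r that by (meson DiffI not_less)
          then show "{i \<in> I. s < g i x} = A" using that by blast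
        qed (auto simp: not_less)
        show ?thesis unfolding S_def mem_Collect_eq eq lo_gt[OF that] hi_le by (simp only: conj_ac)
      qed
      then show ?thesis unfolding set_eq_iff atLeastLessThan_iff by blast
    qed
    have m: "measure lborel (S A) = t A x" if "A \<subseteq> I" for A
      unfolding S[OF that] t_def by (cases "hi A x \<le> lo A x") auto
    have "measure lborel (\<Union>A\<in>Pow I. S A) = (\<Sum>A\<in>Pow I. measure lborel (S A))"
    proof (rule measure_finite_Union)
      show "S ` Pow I \<subseteq> sets lborel" using S by auto
      show "disjoint_family_on S (Pow I)" by (auto simp: disjoint_family_on_def S_def)
      show "emeasure lborel (S A) \<noteq> \<infinity>" if "A \<in> Pow I" for A
        using S[of A] that by (cases "hi A x \<le> lo A x") auto
    qed (use I in simp)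
    also have "\<dots> = (\<Sum>A\<in>Pow I. t A x)" using m by (intro sum.cong) auto
    also have "(\<Union>A\<in>Pow I. S A) = {0..<1}"
    proof (rule set_eqI)
      fix s
      have "{i \<in> I. s < g i x} \<in> Pow I" by auto
      then show "s \<in> (\<Union>A\<in>Pow I. S A) \<longleftrightarrow> s \<in> {0..<1}"
        unfolding S_def UN_iff mem_Collect_eq atLeastLessThan_iff by blast
    qed
    finally show ?thesis by simp
  qed
  show ?thesis
  proof (rule small_mapI[of "Pow I" _ t])
    show "finite (Pow I)" using I by simp
    show "continuous_on X (t A)" if "A \<in> Pow I" for A
      unfolding t_def lo_def hi_def using that finA[of A] I g
      by (intro continuous_on_max continuous_on_diff continuous_on_const
          continuous_on_Min_insert continuous_on_Max_insert) auto
    show "0 \<le> t A x" for A x by (simp add: t_def)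
    show "(\<Sum>A\<in>Pow I. t A x) = 1" for x by (rule sum1)
    show "card {A \<in> Pow I. t A x \<noteq> 0} \<le> Suc n" if x: "x \<in> X" for x
    proof -
      define P where "P = {A \<in> Pow I. t A x \<noteq> 0}"
      define V where "V = insert 0 ((\<lambda>i. g i x) ` {i \<in> I. 0 < g i x \<and> g i x < 1})"
      have P: "A \<subseteq> I" "0 < t A x" if "A \<in> P" for A
        using that by (auto simp: P_def t_def)
      \<comment> \<open>A level set is determined by its lowest level \<open>hi A x\<close>, which
        is 0 or a value strictly between 0 and 1. The value 0 accounts for the
        \<open>Suc\<close>.\<close>
      have "inj_on (\<lambda>A. hi A x) P"
        using level(1)[OF P] by (intro inj_onI) metis
      moreover have "(\<lambda>A. hi A x) ` P \<subseteq> V"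
      proof
        fix v assume "v \<in> (\<lambda>A. hi A x) ` P"
        then obtain A where A: "A \<in> P" "v = hi A x" by auto
        then have v: "0 \<le> v" "v < 1" using level[OF P[OF A(1)]] by auto
        have "v \<in> insert 0 ((\<lambda>i. g i x) ` (I - A))" unfolding A(2) hi_def using I by (intro Max_in) auto
        with v show "v \<in> V" by (auto simp: V_def)
      qed
      moreover have "finite V" using I by (simp add: V_def)
      ultimately have "card P \<le> card V" by (rule card_inj_on_le)
      also have "\<dots> \<le> Suc (card ((\<lambda>i. g i x) ` {i \<in> I. 0 < g i x \<and> g i x < 1}))"
        unfolding V_def using I by (intro card_insert_le_m1) auto
      also have "\<dots> \<le> Suc (card {i \<in> I. 0 < g i x \<and> g i x < 1})"
        using I by (simp add: card_image_le)
      finally show ?thesis using few[OF x] by (simp add: P_def)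
    qed
    fix x y assume xy: "x \<in> X" "y \<in> X" and same: "\<And>A. A \<in> Pow I \<Longrightarrow> t A x = t A y"
    \<comment> \<open>Some coordinate is positive at \<open>x\<close>, hence also at
      \<open>y\<close>. Its index \<open>A\<close> is then a common level set of both points, as
      \<open>fib\<close> requires.\<close>
    have "\<exists>A\<in>Pow I. t A x \<noteq> 0" using sum1[of x] by (metis sum.neutral zero_neq_one)
    then obtain A where A: "A \<subseteq> I" "0 < t A x" by (auto simp: t_def)
    then have Ay: "0 < t A y" using same by simp
    have *: "(\<forall>i\<in>A. 0 < g i z) \<and> (\<forall>i\<in>I - A. g i z < 1)" if "0 < t A z" for z
    proof -
      have "hi A z < 1" "\<forall>i\<in>A. hi A z < g i z" "0 \<le> hi A z" "\<forall>i\<in>I - A. g i z \<le> hi A z"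
        using pos[OF that] lo_gt[OF A(1), of "hi A z" z] hi_le[of A z "hi A z"] by blast+
      then show ?thesis by (meson le_less_trans)
    qed
    show "D x y < e" using *[OF A(2)] *[OF Ay] by (intro fib[OF xy A(1)]) auto
  qed
qed

text \<open>A bad grid point \<open>\<xi>\<close> is determined on a set \<open>S\<close> of \<open>n + 1\<close> coordinates by \<open>S\<close> and a cover
  element, so by \<open>count\<close> not every grid point is bad.\<close>
lemma grid_point_exists:
  fixes F :: "'i \<Rightarrow> 'a \<Rightarrow> real"
  assumes I: "finite I" and \<U>: "finite \<U>" "X \<subseteq> \<Union>\<U>"
    and osc: "\<And>U x y i. U \<in> \<U> \<Longrightarrow> x \<in> U \<Longrightarrow> y \<in> U \<Longrightarrow> i \<in> I \<Longrightarrow> \<bar>F i x - F i y\<bar> \<le> 1 / (3 * (real q + 1))"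
    and count: "card \<U> * 2 ^ card I < q ^ Suc n" and q: "q \<ge> 1"
  obtains \<xi> :: "'i \<Rightarrow> nat" where "\<And>i. i \<in> I \<Longrightarrow> 1 \<le> \<xi> i \<and> \<xi> i \<le> q"
    "\<And>x. x \<in> X \<Longrightarrow> card {i \<in> I. \<bar>F i x - real (\<xi> i) / (real q + 1)\<bar> \<le> 1 / (4 * (real q + 1))} \<le> n"
proof -
  define near where "near i x a \<longleftrightarrow> \<bar>F i x - real a / (real q + 1)\<bar> \<le> 1 / (4 * (real q + 1))" for i x and a :: nat
  define \<Xi> where "\<Xi> = I \<rightarrow>\<^sub>E {1..q}"
  define Bad where "Bad z = {\<xi> \<in> \<Xi>. \<exists>x\<in>fst z. \<forall>i\<in>snd z. near i x (\<xi> i)}" for z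
  define Q where "Q = \<U> \<times> {S. S \<subseteq> I \<and> card S = Suc n}"
  have fin\<Xi>: "finite \<Xi>" and card\<Xi>: "card \<Xi> = q ^ card I"
    using I by (auto simp: \<Xi>_def finite_PiE card_PiE)
  have tri: "\<bar>A - B\<bar> \<le> c + c' + c"
    if "\<bar>u - v\<bar> \<le> c'" "\<bar>u - A\<bar> \<le> c" "\<bar>v - B\<bar> \<le> c" for A B c c' u v :: real
    using that by linarith
  \<comment> \<open>The tolerances are chosen so that \<open>1/4 + 1/3 + 1/4 < 1\<close>: on one
    cover element each coordinate comes near at most one grid value.\<close>
  have uniq: "a = b" if "U \<in> \<U>" "x \<in> U" "y \<in> U" "i \<in> I" "near i x a" "near i y b" for U x y i a b
  proof -
    have "\<bar>real a / (real q + 1) - real b / (real q + 1)\<bar>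
        \<le> 1 / (4 * (real q + 1)) + 1 / (3 * (real q + 1)) + 1 / (4 * (real q + 1))"
      using osc[OF that(1-4)] that(5,6) unfolding near_def by (rule tri)
    also have "\<dots> = 5/6 * (1 / (real q + 1))" by (simp add: divide_simps) (simp add: algebra_simps)
    also have "\<dots> < 1 * (1 / (real q + 1))" by (rule mult_strict_right_mono) auto
    also have "\<dots> = 1 / (real q + 1)" by (rule mult_1)
    finally have "\<bar>real a - real b\<bar> / (real q + 1) < 1 / (real q + 1)"
      by (simp add: diff_divide_distrib[symmetric] abs_divide)
    then have "\<bar>real a - real b\<bar> < 1" by (simp add: divide_less_cancel)
    then show "a = b" by linarith
  qed
  have bad: "card (Bad z) \<le> q ^ (card I - Suc n)" if z: "z \<in> Q" for z
  proof -
    obtain U S where US: "z = (U, S)" "U \<in> \<U>" "S \<subseteq> I" "card S = Suc n" using z by (auto simp: Q_def)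
    have "inj_on (\<lambda>\<xi>. restrict \<xi> (I - S)) (Bad z)"
    proof (rule inj_onI)
      fix \<xi> \<zeta> assume a: "\<xi> \<in> Bad z" "\<zeta> \<in> Bad z" "restrict \<xi> (I - S) = restrict \<zeta> (I - S)"
      obtain x y where xy: "x \<in> U" "y \<in> U" "\<And>i. i \<in> S \<Longrightarrow> near i x (\<xi> i)" "\<And>i. i \<in> S \<Longrightarrow> near i y (\<zeta> i)"
        using a(1,2) US(1) by (auto simp: Bad_def)
      show "\<xi> = \<zeta>"
      proof (rule PiE_ext[of _ I "\<lambda>_. {1..q}"])
        show "\<xi> \<in> I \<rightarrow>\<^sub>E {1..q}" "\<zeta> \<in> I \<rightarrow>\<^sub>E {1..q}" using a by (auto simp: Bad_def \<Xi>_def)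
        fix i assume i: "i \<in> I"
        show "\<xi> i = \<zeta> i"
        proof (cases "i \<in> S")
          case True
          then show ?thesis using uniq[OF US(2) xy(1,2) i] xy(3,4) by blast
        next
          case False
          then show ?thesis using fun_cong[OF a(3), of i] i by simp
        qed
      qed
    qed
    moreover have "(\<lambda>\<xi>. restrict \<xi> (I - S)) ` Bad z \<subseteq> (I - S) \<rightarrow>\<^sub>E {1..q}"
    proof (rule image_subsetI)
      fix \<xi> assume "\<xi> \<in> Bad z"
      then have "\<xi> \<in> I \<rightarrow>\<^sub>E {1..q}" by (simp add: Bad_def \<Xi>_def)
      then show "restrict \<xi> (I - S) \<in> (I - S) \<rightarrow>\<^sub>E {1..q}"
        unfolding restrict_PiE_iff using PiE_mem by blast
    qed
    ultimately have "card (Bad z) \<le> card ((I - S) \<rightarrow>\<^sub>E {1..q})"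
      using I by (intro card_inj_on_le finite_PiE) auto
    also have "\<dots> = q ^ (card I - Suc n)"
      using I US(3,4) by (simp add: card_PiE card_Diff_subset finite_subset)
    finally show ?thesis .
  qed
  have finQ: "finite Q" using I \<U> by (simp add: Q_def)
  have "\<exists>\<xi>\<in>\<Xi>. \<forall>z\<in>Q. \<xi> \<notin> Bad z"
  proof (cases "Suc n \<le> card I")
    case True
    have "card (\<Union>z\<in>Q. Bad z) \<le> (\<Sum>z\<in>Q. card (Bad z))" using finQ by (rule card_UN_le)
    also have "\<dots> \<le> card Q * q ^ (card I - Suc n)" using sum_bounded_above[of Q "\<lambda>z. card (Bad z)"] bad by simp
    also have "card Q \<le> card \<U> * 2 ^ card I"
    proof -
      have "card {S. S \<subseteq> I \<and> card S = Suc n} \<le> card (Pow I)" using I by (intro card_mono) auto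
      then show ?thesis using I by (simp add: Q_def card_cartesian_product card_Pow)
    qed
    also have "card \<U> * 2 ^ card I * q ^ (card I - Suc n) < q ^ Suc n * q ^ (card I - Suc n)"
      using count q by (intro mult_strict_right_mono) auto
    also have "\<dots> = card \<Xi>" by (simp only: card\<Xi> power_add[symmetric] le_add_diff_inverse[OF True])
    finally have "card (\<Union>z\<in>Q. Bad z) < card \<Xi>" by simp
    moreover have "finite (\<Union>z\<in>Q. Bad z)" using finQ fin\<Xi> by (auto simp: Bad_def)
    ultimately have "\<not> \<Xi> \<subseteq> (\<Union>z\<in>Q. Bad z)" using card_mono by (metis not_less)
    then show ?thesis by blast
  next
    case False
    \<comment> \<open>With fewer than \<open>n + 1\<close> coordinates nothing is bad, and any grid
      point serves.\<close>
    have "card S \<noteq> Suc n" if "S \<subseteq> I" for S using card_mono[OF I that] False by simp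
    then have "{S. S \<subseteq> I \<and> card S = Suc n} = {}" by blast
    then have "Q = {}" unfolding Q_def by (simp only: Sigma_empty2)
    moreover have "card \<Xi> \<noteq> 0" using card\<Xi> q by simp
    then have "\<Xi> \<noteq> {}" by (metis card.empty)
    ultimately show ?thesis by blast
  qed
  then obtain \<xi> where \<xi>: "\<xi> \<in> \<Xi>" "\<And>z. z \<in> Q \<Longrightarrow> \<xi> \<notin> Bad z" by blast
  show ?thesis
  proof (rule that)
    show "1 \<le> \<xi> i \<and> \<xi> i \<le> q" if "i \<in> I" for i using \<xi>(1) that by (auto simp: \<Xi>_def)
    fix x assume "x \<in> X"
    then obtain U where U: "U \<in> \<U>" "x \<in> U" using \<U>(2) by blast
    define B where "B = {i \<in> I. near i x (\<xi> i)}"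
    have "card B \<le> n"
    proof (rule ccontr)
      assume "\<not> card B \<le> n"
      then have "Suc n \<le> card B" by simp
      then obtain S where S: "S \<subseteq> B" "card S = Suc n" by (rule obtain_subset_with_card_n)
      have "S \<subseteq> I" using S(1) by (auto simp: B_def)
      then have "(U, S) \<in> Q" using U(1) S(2) by (simp add: Q_def)
      moreover have "\<forall>i\<in>S. near i x (\<xi> i)" using S(1) by (auto simp: B_def)
      then have "\<xi> \<in> Bad (U, S)" using \<xi>(1) U(2) by (auto simp: Bad_def)
      ultimately show False using \<xi>(2) by blast
    qed
    then show "card {i \<in> I. \<bar>F i x - real (\<xi> i) / (real q + 1)\<bar> \<le> 1 / (4 * (real q + 1))} \<le> n"
      by (simp add: B_def near_def)
  qed
qed

text \<open>On the compact set where \<open>D\<close> is at least \<open>e\<close>, the distance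
  \<open>d\<close> attains a positive minimum, which serves as \<open>r\<close>.\<close>

lemma cont_pseudometric_dominates:
  assumes "compact X" "cont_pseudometric X d" "cont_pseudometric X D"
    and "\<And>x y. x \<in> X \<Longrightarrow> y \<in> X \<Longrightarrow> d x y = 0 \<Longrightarrow> D x y < e"
  obtains r where "r > 0" "\<And>x y. x \<in> X \<Longrightarrow> y \<in> X \<Longrightarrow> d x y < r \<Longrightarrow> D x y < e"
proof -
  define K where "K = {z \<in> X \<times> X. e \<le> D (fst z) (snd z)}"
  have "closedin (top_of_set (X \<times> X)) ((X \<times> X) \<inter> (\<lambda>z. D (fst z) (snd z)) -` {e..})"
    by (rule continuous_closedin_preimage[OF cont_pseudometricD(1)[OF assms(3)]]) simp
  moreover have "K = (X \<times> X) \<inter> (\<lambda>z. D (fst z) (snd z)) -` {e..}" by (auto simp: K_def)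
  ultimately have K: "compact K"
    using closedin_compact[OF compact_Times[OF assms(1,1)]] by simp
  show ?thesis
  proof (cases "K = {}")
    case True
    then show ?thesis using that[of 1] by (force simp: K_def not_le)
  next
    case False
    then have "\<exists>z\<in>K. \<forall>w\<in>K. d (fst z) (snd z) \<le> d (fst w) (snd w)"
      by (intro continuous_attains_inf[OF K] continuous_on_subset[OF cont_pseudometricD(1)[OF assms(2)]])
        (auto simp: K_def)
    then obtain z where z: "z \<in> K" "\<And>w. w \<in> K \<Longrightarrow> d (fst z) (snd z) \<le> d (fst w) (snd w)" by blast
    have zX: "fst z \<in> X" "snd z \<in> X" "e \<le> D (fst z) (snd z)" using z(1) by (auto simp: K_def)
    then have "0 < d (fst z) (snd z)"
      using cont_pseudometric_nonneg[OF assms(2), of "fst z" "snd z"] assms(4)[of "fst z" "snd z"] by fastforce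
    moreover have "D x y < e" if "x \<in> X" "y \<in> X" "d x y < d (fst z) (snd z)" for x y
      using z(2)[of "(x, y)"] that by (force simp: K_def)
    ultimately show ?thesis using that by blast
  qed
qed

lemma separating_uniform:
  assumes "compact X" "cont_pseudometric X d" "\<And>x y. x \<in> X \<Longrightarrow> y \<in> X \<Longrightarrow> d x y = 0 \<Longrightarrow> x = y" "e > 0"
  obtains r where "r > 0" "\<And>x y. x \<in> X \<Longrightarrow> y \<in> X \<Longrightarrow> d x y < r \<Longrightarrow> dist x y < e"
proof (rule cont_pseudometric_dominates[OF assms(1,2) cont_pseudometric_dist])
  show "dist x y < e" if "x \<in> X" "y \<in> X" "d x y = 0" for x y
    using assms(3)[OF that] assms(4) by simp
qed (rule that)

section \<open>From covering numbers to widim\<close>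

context Zk_action
begin

text \<open>\<open>count\<close> dictates the choice of \<open>n\<close>: it is the number of
  coordinates that the grid point may leave undecided, and so the dimension of the skeleton that the
  modified orbit map reaches.\<close>

lemma widim_le_of_cover_num:
  assumes d: "cont_pseudometric X d" and Z: "finite Z" "Z \<subseteq> X" "\<And>x. x \<in> X \<Longrightarrow> \<exists>z\<in>Z. d x z < r/2"
    and r: "r > 0" "\<And>x y. x \<in> X \<Longrightarrow> y \<in> X \<Longrightarrow> d x y < r \<Longrightarrow> dist x y < e0/2" and e0: "e0 > 0"
    and N: "N \<ge> 1" and e: "e > 0" "2 / r * e \<le> 1 / (3 * (real q + 1))" and q: "q \<ge> 1"
    and count: "cover_num X (dyn N d) e * 2 ^ (card Z * N ^ CARD('k)) < q ^ Suc n"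
  shows "widim X (dyn N dist) e0 \<le> n"
proof -
  have cube: "finite (cube N :: (int^'k) set)" "(cube N :: (int^'k) set) \<noteq> {}"
    by (rule finite_cube, rule cube_nonempty[OF N])
  note pm = cont_pseudometric_dyn[OF d cube]
  obtain \<U> where \<U>: "small_cover X (dyn N d) e \<U>"
    "card \<U> = cover_num X (dyn N d) e"
    using cover_numE[OF compact_X pm e(1)] by blast
  define I :: "('a \<times> (int^'k)) set" where "I = Z \<times> cube N"
  \<comment> \<open>Equal to 1 within \<open>d\<close>-distance \<open>r/2\<close> of the centre and
    to 0 beyond \<open>r\<close>, with slope \<open>2 / r\<close>. Hypothesis \<open>e\<close> thus
    bounds its oscillation on a cover element by a third of the grid spacing.\<close>
  define F where "F i x = max 0 (min 1 (2 - 2 / r * d (T (snd i) x) (fst i)))" for i :: "'a \<times> (int^'k)" and x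
  have I: "finite I" "card I = card Z * N ^ CARD('k)"
    using Z(1) cube(1) by (simp_all add: I_def card_cartesian_product card_cube)
  have clamp: "\<bar>max 0 (min 1 a) - max 0 (min 1 b)\<bar> \<le> \<bar>a - b\<bar>" for a b :: real
    by (auto simp: max_def min_def)
  have lip: "\<bar>(2 - c * a) - (2 - c * b)\<bar> = c * \<bar>a - b\<bar>" if "c \<ge> 0" for a b c :: real
  proof -
    have "(2 - c * a) - (2 - c * b) = c * (b - a)" by (simp add: algebra_simps)
    then show ?thesis using that by (simp add: abs_mult abs_minus_commute)
  qed
  have osc: "\<bar>F i x - F i y\<bar> \<le> 1 / (3 * (real q + 1))"
    if U: "U \<in> \<U>" "x \<in> U" "y \<in> U" and i: "i \<in> I" for U x y i
  proof -
    have UX: "U \<subseteq> X" "diam_wrt (dyn N d) U < e" using \<U>(1) U(1) by (auto simp: small_cover_def)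
    then have xy: "x \<in> X" "y \<in> X" using U by auto
    have zp: "fst i \<in> X" "snd i \<in> cube N" using i Z(2) by (auto simp: I_def)
    have "d (T (snd i) x) (T (snd i) y) \<le> dyn N d x y"
      by (rule dyn_metric_ge[OF cube(1) zp(2)])
    also have "\<dots> < e" using le_diam_wrt[OF compact_X pm UX(1) U(2,3)] UX(2) by linarith
    finally have le: "d (T (snd i) x) (T (snd i) y) \<le> e" by simp
    have "\<bar>F i x - F i y\<bar> \<le> \<bar>(2 - 2 / r * d (T (snd i) x) (fst i)) - (2 - 2 / r * d (T (snd i) y) (fst i))\<bar>"
      unfolding F_def by (rule clamp)
    also have "\<dots> = 2 / r * \<bar>d (T (snd i) x) (fst i) - d (T (snd i) y) (fst i)\<bar>"
      using r(1) by (intro lip) simp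
    also have "\<dots> \<le> 2 / r * e"
    proof (rule mult_left_mono)
      have "d (T (snd i) x) (fst i) \<le> d (T (snd i) x) (T (snd i) y) + d (T (snd i) y) (fst i)"
        "d (T (snd i) y) (fst i) \<le> d (T (snd i) y) (T (snd i) x) + d (T (snd i) x) (fst i)"
        "d (T (snd i) y) (T (snd i) x) = d (T (snd i) x) (T (snd i) y)"
        by (intro cont_pseudometricD[OF d] T_in xy zp)+
      then show "\<bar>d (T (snd i) x) (fst i) - d (T (snd i) y) (fst i)\<bar> \<le> e" using le by linarith
    qed (use r(1) in simp)
    finally show ?thesis using e(2) by linarith
  qed
  define \<kappa> where "\<kappa> = 1 / (4 * (real q + 1))"
  obtain \<xi> where \<xi>: "\<And>i. i \<in> I \<Longrightarrow> 1 \<le> \<xi> i \<and> \<xi> i \<le> q"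
    "\<And>x. x \<in> X \<Longrightarrow> card {i \<in> I. \<bar>F i x - real (\<xi> i) / (real q + 1)\<bar> \<le> \<kappa>} \<le> n"
  proof (rule grid_point_exists[of I \<U> X F q n])
    show "finite \<U>" "X \<subseteq> \<Union>\<U>" using \<U>(1) by (auto simp: small_cover_def)
    show "card \<U> * 2 ^ card I < q ^ Suc n" using count \<U>(2) I(2) by simp
  qed (use I(1) osc q in \<open>auto simp: \<kappa>_def\<close>)
  define c where "c i = real (\<xi> i) / (real q + 1)" for i
  \<comment> \<open>Stretches the window of half-width \<open>\<kappa>\<close> about
    \<open>c i\<close> onto \<open>[0,1]\<close> and clamps the rest. The window stays strictly
    between 0 and 1, so the values 0 and 1 of \<open>F i\<close> are kept.\<close>
  define g where "g i x = max 0 (min 1 ((F i x - c i + \<kappa>) / (2 * \<kappa>)))" for i x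
  have \<kappa>: "\<kappa> > 0" by (simp add: \<kappa>_def)
  have c: "\<kappa> < c i" "c i + \<kappa> < 1" if "i \<in> I" for i
  proof -
    have "1 / (real q + 1) \<le> c i" "c i \<le> real q / (real q + 1)"
      unfolding c_def using \<xi>(1)[OF that] by (auto intro!: divide_right_mono)
    moreover have "1 / (real q + 1) = 4 * \<kappa>" "real q / (real q + 1) = 1 - 4 * \<kappa>"
      by (simp_all add: \<kappa>_def divide_simps)
    ultimately show "\<kappa> < c i" "c i + \<kappa> < 1" using \<kappa> by linarith+
  qed
  have g0: "0 < g i x \<longleftrightarrow> c i - \<kappa> < F i x" for i x
    using \<kappa> by (auto simp: g_def max_def min_def zero_less_divide_iff)
  have g1: "g i x < 1 \<longleftrightarrow> F i x < c i + \<kappa>" for i x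
    using \<kappa> by (auto simp: g_def max_def min_def divide_less_eq_1 less_divide_eq_1)
  have "small_map X (dyn N dist) e0 n"
  proof (rule small_map_from_cube[of I X g])
    show "finite I" by fact
    show "continuous_on X (g i)" if i: "i \<in> I" for i
    proof -
      have "continuous_on X (\<lambda>x. d (T (snd i) x) (fst i))"
        using i Z(2) by (intro cont_pseudometric_compose[OF d] T_cont continuous_intros) (auto simp: I_def T_in)
      then have "continuous_on X (F i)" unfolding F_def
        by (intro continuous_on_max continuous_on_min continuous_intros)
      then show ?thesis unfolding g_def using \<kappa>
        by (intro continuous_on_max continuous_on_min continuous_intros) auto
    qed
    show "card {i \<in> I. 0 < g i x \<and> g i x < 1} \<le> n" if x: "x \<in> X" for x
    proof -
      have "\<bar>F i x - c i\<bar> \<le> \<kappa>" if "0 < g i x" "g i x < 1" for i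
        using that unfolding g0 g1 by linarith
      then have "card {i \<in> I. 0 < g i x \<and> g i x < 1} \<le> card {i \<in> I. \<bar>F i x - real (\<xi> i) / (real q + 1)\<bar> \<le> \<kappa>}"
        using I(1) by (intro card_mono) (auto simp: c_def)
      then show ?thesis using \<xi>(2)[OF x] by linarith
    qed
    fix x y A assume xy: "x \<in> X" "y \<in> X" and A: "A \<subseteq> I"
      and pos: "\<And>i. i \<in> A \<Longrightarrow> 0 < g i x \<and> 0 < g i y" and lt: "\<And>i. i \<in> I - A \<Longrightarrow> g i x < 1 \<and> g i y < 1"
    \<comment> \<open>For a net point \<open>z\<close> near \<open>T p x\<close> the bump at
      \<open>(z, p)\<close> is 1 at \<open>x\<close>, so its index lies in \<open>A\<close>. Hence
      it is positive at \<open>y\<close> as well, and \<open>T p x\<close> and \<open>T p y\<close>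
      are both within \<open>r\<close> of \<open>z\<close>.\<close>
    have "dist (T p x) (T p y) < e0" if p: "p \<in> cube N" for p
    proof -
      have T: "T p x \<in> X" "T p y \<in> X" using xy T_in by auto
      obtain z where z: "z \<in> Z" "d (T p x) z < r/2" using Z(3)[OF T(1)] by blast
      then have zX: "z \<in> X" using Z(2) by blast
      have i: "(z, p) \<in> I" using z(1) p by (simp add: I_def)
      have "2 / r * d (T p x) z \<le> 1" using z(2) r(1) by (simp add: field_simps)
      then have "F (z, p) x = 1" by (simp add: F_def)
      then have "\<not> g (z, p) x < 1" using c(2)[OF i] g1 by simp
      then have "(z, p) \<in> A" using lt i by blast
      then have "0 < F (z, p) y" using pos g0 c(1)[OF i] by fastforce
      then have "2 / r * d (T p y) z < 2" by (auto simp: F_def max_def min_def split: if_splits)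
      then have "d (T p y) z < r" using r(1) by (simp add: field_simps)
      then have "dist (T p y) z < e0/2" using r(2) T zX by blast
      moreover have "dist (T p x) z < e0/2" using r z T zX by (intro r(2)) auto
      moreover have "dist (T p x) (T p y) \<le> dist (T p x) z + dist (T p y) z" by (rule dist_triangle2)
      ultimately show ?thesis by linarith
    qed
    then show "dyn N dist x y < e0" by (simp add: dyn_metric_less_iff[OF cube])
  qed
  then show ?thesis
    by (rule widim_le[OF compact_X cont_pseudometric_dyn[OF cont_pseudometric_dist cube] e0 nonempty])
qed

text \<open>The summand \<open>card Z * ln 2\<close> pays for the choice of a coordinate set in the
  grid argument. It is a constant per site and disappears after division by
  \<open>\<bar>ln e\<bar>\<close>.\<close>

lemma widim_rate_le_cover_rate:
  assumes d: "cont_pseudometric X d" and Z: "finite Z" "Z \<subseteq> X" "\<And>x. x \<in> X \<Longrightarrow> \<exists>z\<in>Z. d x z < r/2"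
    and r: "r > 0" "\<And>x y. x \<in> X \<Longrightarrow> y \<in> X \<Longrightarrow> d x y < r \<Longrightarrow> dist x y < e0/2" and e0: "e0 > 0"
    and e: "e > 0" "2 / r * e \<le> 1 / (3 * (real q + 1))" and q: "q \<ge> 2"
  shows "widim_rate e0 \<le> (cover_rate d e + real (card Z) * ln 2) / ln (real q)"
proof -
  let ?w = "\<lambda>N. widim_avg e0 N"
  let ?c = "\<lambda>N. cover_avg d e N"
  have lim: "(\<lambda>N. (?c N + real (card Z) * ln 2) / ln (real q)) \<longlonglongrightarrow> (cover_rate d e + real (card Z) * ln 2) / ln (real q)"
    using q by (intro tendsto_divide tendsto_add cover_tendsto d e(1) tendsto_const) auto
  show ?thesis
  proof (rule LIMSEQ_le[OF widim_tendsto[OF e0] lim], intro exI[of _ 1] allI impI)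
    fix N :: nat assume N: "1 \<le> N"
    define M where "M = cover_num X (dyn N d) e"
    define a where "a = ln (real M) + real (card Z * N ^ CARD('k)) * ln 2"
    \<comment> \<open>The least \<open>n\<close> that meets the counting condition.\<close>
    define n where "n = nat \<lfloor>a / ln (real q)\<rfloor>"
    have M: "1 \<le> M" unfolding M_def
      using cover_num_pos[OF compact_X cont_pseudometric_dyn[OF d finite_cube cube_nonempty[OF N]] e(1) nonempty] .
    have a0: "0 \<le> a" unfolding a_def using M by simp
    have lq: "0 < ln (real q)" using q by simp
    have nle: "real n \<le> a / ln (real q)" unfolding n_def using a0 lq by simp
    have "a / ln (real q) < real (Suc n)" unfolding n_def using a0 lq by linarith
    then have "a < real (Suc n) * ln (real q)" using lq by (simp add: divide_less_eq)
    moreover have "a = ln (real (M * 2 ^ (card Z * N ^ CARD('k))))"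
      using M by (simp add: a_def ln_mult ln_realpow)
    moreover have "real (Suc n) * ln (real q) = ln (real (q ^ Suc n))"
      using q ln_realpow[of "real q" "Suc n"] by simp
    ultimately have "real (M * 2 ^ (card Z * N ^ CARD('k))) < real (q ^ Suc n)"
      using M q by (subst ln_less_cancel_iff[symmetric]) (auto simp del: of_nat_mult of_nat_power)
    then have "M * 2 ^ (card Z * N ^ CARD('k)) < q ^ Suc n" using of_nat_less_iff by blast
    then have "widim X (dyn N dist) e0 \<le> n"
      unfolding M_def using q by (intro widim_le_of_cover_num[OF d Z r e0 N e]) auto
    then have "?w N \<le> (a / ln (real q)) / real N ^ CARD('k)"
      using nle by (intro divide_right_mono) auto
    also have "\<dots> = (?c N + real (card Z) * ln 2) / ln (real q)"
    proof -
      have "a / real N ^ CARD('k) = ?c N + real (card Z) * ln 2"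
        unfolding a_def M_def using N by (simp add: add_divide_distrib)
      moreover have "(a / ln (real q)) / real N ^ CARD('k) = (a / real N ^ CARD('k)) / ln (real q)"
        by (simp add: mult.commute)
      ultimately show ?thesis by simp
    qed
    finally show "?w N \<le> (?c N + real (card Z) * ln 2) / ln (real q)" .
  qed
qed

theorem mdim_le_mdim_M:
  assumes d: "cont_pseudometric X d" and sep: "\<And>x y. x \<in> X \<Longrightarrow> y \<in> X \<Longrightarrow> d x y = 0 \<Longrightarrow> x = y"
  shows "mdim X T \<le> mdim_M X T d"
  unfolding mdim_eq mdim_M_eq[OF d]
proof (rule SUP_least)
  fix e0 :: real assume "e0 \<in> {0<..}"
  then have e0: "e0 > 0" by simp
  obtain r where r: "r > 0" "\<And>x y. x \<in> X \<Longrightarrow> y \<in> X \<Longrightarrow> d x y < r \<Longrightarrow> dist x y < e0/2"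
    using separating_uniform[OF compact_X d sep, of "e0/2"] e0 by (metis half_gt_zero)
  obtain Z where Z: "finite Z" "Z \<subseteq> X" "\<And>x. x \<in> X \<Longrightarrow> \<exists>z\<in>Z. d x z < r/2"
    using cont_pseudometric_net[OF compact_X d, of "r/2"] r(1) by (metis half_gt_zero)
  define w where "w = widim_rate e0"
  define C where "C = real (card Z) * ln 2"
  \<comment> \<open>\<open>- ln e + ln (r/12)\<close> is the logarithm of
    \<open>r / (12 * e)\<close>, a lower bound for the grid size \<open>q\<close> available at scale
    \<open>e\<close>.\<close>
  define g where "g e = (w * (- ln e + ln (r/12)) - C) / - ln e" for e :: real
  have w0: "0 \<le> w" unfolding w_def widim_rate_def by (intro cINF_greatest) auto
  have "(g \<longlongrightarrow> w) (at_right 0)"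
  proof -
    have l: "filterlim (\<lambda>e::real. - ln e) at_top (at_right 0)" by real_asymp
    have "((\<lambda>e. w + (w * ln (r/12) - C) / - ln e) \<longlongrightarrow> w + 0) (at_right 0)"
      by (rule tendsto_add[OF tendsto_const real_tendsto_divide_at_top[OF tendsto_const l]])
    moreover have "\<forall>\<^sub>F e in at_right 0. w + (w * ln (r/12) - C) / - ln e = g e"
      unfolding eventually_at_right_field g_def
    proof (intro exI[of _ 1] conjI allI impI)
      fix y :: real assume "0 < y" "y < 1"
      then have "ln y < 0" by simp
      then show "w + (w * ln (r/12) - C) / - ln y = (w * (- ln y + ln (r/12)) - C) / - ln y"
        by (simp add: divide_simps) (simp add: algebra_simps)
    qed simp
    ultimately show ?thesis by (simp add: tendsto_cong)
  qed
  then have "Liminf (at_right 0) (\<lambda>e. ereal (g e)) = ereal w"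
    by (intro lim_imp_Liminf) auto
  moreover have "Liminf (at_right 0) (\<lambda>e. ereal (g e)) \<le> Liminf (at_right 0) (\<lambda>e. ereal (cover_rate d e / \<bar>ln e\<bar>))"
  proof (rule Liminf_mono)
    show "\<forall>\<^sub>F e in at_right 0. ereal (g e) \<le> ereal (cover_rate d e / \<bar>ln e\<bar>)"
      unfolding eventually_at_right_field
    proof (intro exI[of _ "min 1 (r/36)"] conjI allI impI)
      show "0 < min 1 (r/36)" using r(1) by simp
      fix e :: real assume e: "0 < e" "e < min 1 (r/36)"
      \<comment> \<open>The largest \<open>q\<close> with
        \<open>3 * (q + 1) \<le> r / (2 * e)\<close>, as the oscillation bound demands. For
        \<open>e < r/36\<close> the rounding loses at most a factor 2, which turns
        \<open>r/6\<close> into \<open>r/12\<close>.\<close>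
      define q where "q = nat (\<lfloor>r / (6 * e)\<rfloor> - 1)"
      have big: "r / (6 * e) > 6" using e by (simp add: field_simps)
      then have qr: "real q + 1 \<le> r / (6 * e)" "r / (6 * e) < real q + 2" unfolding q_def by linarith+
      then have q2: "q \<ge> 2" using big by linarith
      have "2 / r * e \<le> 1 / (3 * (real q + 1))"
        using qr(1) r(1) e by (simp add: field_simps)
      then have "w \<le> (cover_rate d e + C) / ln (real q)"
        unfolding w_def C_def by (intro widim_rate_le_cover_rate[OF d Z r e0 e(1) _ q2])
      then have "w * ln (real q) \<le> cover_rate d e + C" using q2 by (simp add: le_divide_eq)
      moreover have "w * (- ln e + ln (r/12)) \<le> w * ln (real q)"
      proof (rule mult_left_mono[OF _ w0])
        have "r / (12 * e) = r / (6 * e) / 2" by simp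
        then have "r / (12 * e) \<le> real q" using qr(2) big by linarith
        then have "ln (r / (12 * e)) \<le> ln (real q)" using r(1) e by (intro ln_mono) auto
        moreover have "ln (r / (12 * e)) = ln (r/12) - ln e"
          using ln_div[of "r/12" e] r(1) e by simp
        ultimately show "- ln e + ln (r/12) \<le> ln (real q)" by linarith
      qed
      ultimately have "w * (- ln e + ln (r/12)) - C \<le> cover_rate d e" by linarith
      moreover have "ln e < 0" using e by simp
      ultimately show "ereal (g e) \<le> ereal (cover_rate d e / \<bar>ln e\<bar>)"
        unfolding g_def by (simp add: divide_right_mono_neg abs_of_neg)
    qed
  qed
  ultimately show "ereal (widim_rate e0) \<le> Liminf (at_right 0) (\<lambda>e. ereal (cover_rate d e / \<bar>ln e\<bar>))"
    by (simp add: w_def)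
qed

end

section \<open>Power diagrams of lattice points\<close>

definition rvec :: "int^'k \<Rightarrow> real^'k" where
  "rvec n = (\<chi> i. real_of_int (n $ i))"

lemma rvec_nth [simp]: "rvec n $ i = real_of_int (n $ i)"
  by (simp add: rvec_def)

lemma rvec_add: "rvec (m + n) = rvec m + rvec n"
  and rvec_diff: "rvec (m - n) = rvec m - rvec n"
  and rvec_uminus: "rvec (- m) = - rvec m"
  and rvec_zero [simp]: "rvec 0 = 0"
  by (simp_all add: vec_eq_iff)

lemma rvec_eq_iff [simp]: "rvec m = rvec n \<longleftrightarrow> m = n"
  by (simp add: vec_eq_iff)

lemma finite_rvec_ball: "finite {n :: int^'k::finite. norm (rvec n - u) \<le> R}"
proof (rule finite_subset)
  show "{n :: int^'k. norm (rvec n - u) \<le> R}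
      \<subseteq> vec_lambda ` (\<Pi>\<^sub>E i\<in>UNIV. {\<lfloor>u $ i - R\<rfloor>..\<lceil>u $ i + R\<rceil>})"
  proof
    fix n :: "int^'k" assume n: "n \<in> {n. norm (rvec n - u) \<le> R}"
    have "n $ i \<in> {\<lfloor>u $ i - R\<rfloor>..\<lceil>u $ i + R\<rceil>}" for i
    proof -
      have "\<bar>real_of_int (n $ i) - u $ i\<bar> \<le> R"
        using component_le_norm_cart[of "rvec n - u" i] n by simp
      then have "u $ i - R \<le> real_of_int (n $ i)" "real_of_int (n $ i) \<le> u $ i + R" by linarith+
      then show ?thesis by (simp add: floor_le_iff le_ceiling_iff)
    qed
    then have "($) n \<in> (\<Pi>\<^sub>E i\<in>UNIV. {\<lfloor>u $ i - R\<rfloor>..\<lceil>u $ i + R\<rceil>})" by auto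
    then show "n \<in> vec_lambda ` (\<Pi>\<^sub>E i\<in>UNIV. {\<lfloor>u $ i - R\<rfloor>..\<lceil>u $ i + R\<rceil>})"
      by (rule image_eqI[rotated]) (simp add: vec_nth_inverse)
  qed
qed (intro finite_imageI finite_PiE; simp)

lemma finite_rvec_ball0: "finite {n :: int^'k::finite. norm (rvec n) \<le> R}"
  using finite_rvec_ball[of 0 R] by simp

lemma norm_rvec_floor: "norm (u - rvec (\<chi> i. \<lfloor>u $ i\<rfloor>)) \<le> real CARD('k)" for u :: "real^'k::finite"
proof -
  have "norm (u - rvec (\<chi> i. \<lfloor>u $ i\<rfloor>)) \<le> (\<Sum>i\<in>UNIV. \<bar>(u - rvec (\<chi> i. \<lfloor>u $ i\<rfloor>)) $ i\<bar>)"
    by (rule norm_le_l1_cart)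
  also have "\<dots> \<le> (\<Sum>i\<in>(UNIV::'k set). 1)" by (intro sum_mono) (simp add: abs_le_iff, linarith)
  finally show ?thesis by simp
qed

text \<open>As a function of the point, the difference of the squared distances to two fixed centres
  is affine, with gradient of norm \<open>2 * norm (n - m)\<close>.\<close>

lemma power_diff_shift:
  fixes p w m n :: "'b::real_inner"
  shows "(norm (w - m))\<^sup>2 - (norm (w - n))\<^sup>2 - 2 * norm (p - w) * norm (n - m)
    \<le> (norm (p - m))\<^sup>2 - (norm (p - n))\<^sup>2"
proof -
  have "((norm (p - m))\<^sup>2 - (norm (p - n))\<^sup>2) - ((norm (w - m))\<^sup>2 - (norm (w - n))\<^sup>2) = 2 * ((p - w) \<bullet> (n - m))"
    by (simp add: power2_norm_eq_inner algebra_simps inner_commute)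
  moreover have "- (norm (p - w) * norm (n - m)) \<le> (p - w) \<bullet> (n - m)"
    using Cauchy_Schwarz_ineq2[of "p - w" "n - m"] by linarith
  ultimately show ?thesis by linarith
qed

text \<open>Shrinking a cell of the power diagram with weights \<open>v / t\<close> towards its centre by the factor
  \<open>t\<close> lands, with a margin, inside the corresponding cell of the diagram with weights \<open>v\<close>.\<close>
lemma power_cell_shrink:
  fixes u n m :: "'b::real_inner"
  assumes "0 < t" "(norm (u - n))\<^sup>2 + vn / t \<le> (norm (u - m))\<^sup>2 + vm / t"
  shows "(1 - t) * (norm (n - m))\<^sup>2
    \<le> (norm (n + t *\<^sub>R (u - n) - m))\<^sup>2 - (norm (n + t *\<^sub>R (u - n) - n))\<^sup>2 + vm - vn"
proof -
  define a where "a = u - n"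
  define b where "b = n - m"
  have um: "u - m = a + b" by (simp add: a_def b_def)
  have "(norm a)\<^sup>2 + vn / t \<le> (norm (a + b))\<^sup>2 + vm / t"
    using assms(2) unfolding um[symmetric] by (simp add: a_def)
  moreover have "(norm (a + b))\<^sup>2 = (norm a)\<^sup>2 + 2 * (a \<bullet> b) + (norm b)\<^sup>2"
    by (simp add: power2_norm_eq_inner algebra_simps inner_commute)
  ultimately have "(vn - vm) / t \<le> (norm b)\<^sup>2 + 2 * (a \<bullet> b)"
    by (simp add: diff_divide_distrib)
  then have *: "vn - vm \<le> t * ((norm b)\<^sup>2 + 2 * (a \<bullet> b))"
    using assms(1) by (simp add: divide_le_eq mult.commute)
  have eqs: "n + t *\<^sub>R (u - n) - m = t *\<^sub>R a + b" "n + t *\<^sub>R (u - n) - n = t *\<^sub>R a"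
    by (simp_all add: a_def b_def)
  have "(norm (c + b))\<^sup>2 - (norm c)\<^sup>2 = (norm b)\<^sup>2 + 2 * (c \<bullet> b)" for c
    by (simp add: power2_norm_eq_inner algebra_simps inner_commute)
  from this[of "t *\<^sub>R a"] have sq: "(norm (t *\<^sub>R a + b))\<^sup>2 - (norm (t *\<^sub>R a))\<^sup>2 = (norm b)\<^sup>2 + 2 * t * (a \<bullet> b)"
    by simp
  have "(1 - t) * (norm b)\<^sup>2 + t * ((norm b)\<^sup>2 + 2 * (a \<bullet> b)) = (norm b)\<^sup>2 + 2 * t * (a \<bullet> b)"
    by (simp add: algebra_simps)
  then show ?thesis using * sq unfolding eqs b_def[symmetric] by linarith
qed

text \<open>The site \<open>p\<close> lies with margin \<open>r\<close> in the cell of \<open>n\<close> of the power diagram with weights \<open>v\<close>.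
  Only competitors at distance at least \<open>M\<close> are tested, since active markers will be \<open>M\<close>-separated.\<close>
definition good_site :: "(int^'k \<Rightarrow> real) \<Rightarrow> real \<Rightarrow> real \<Rightarrow> real \<Rightarrow> int^'k::finite \<Rightarrow> int^'k \<Rightarrow> bool" where
  "good_site v R M r p n \<longleftrightarrow> norm (rvec p - rvec n) \<le> R + CARD('k) \<and> v n \<le> R\<^sup>2 \<and>
     (\<forall>m. M \<le> norm (rvec n - rvec m) \<longrightarrow> r * norm (rvec n - rvec m)
        \<le> (norm (rvec p - rvec m))\<^sup>2 - (norm (rvec p - rvec n))\<^sup>2 + v m - v n)"

text \<open>A comparison of volumes. The cells with weights \<open>v / t\<close> cover a cube;
  shrunk by \<open>t\<close>, they become disjoint, keep \<open>t ^ CARD('k)\<close> of the volume,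
  and each of their points rounds down to a good site. So the unit cubes based at the good sites
  cover that volume.\<close>

lemma good_sites_density:
  fixes v :: "int^'k::finite \<Rightarrow> real" and t r R M :: real
  assumes v0: "\<And>n. 0 \<le> v n" and cov: "\<And>u. \<exists>n. v n = 0 \<and> norm (u - rvec n) \<le> R"
    and t: "0 < t" "t < 1" and M: "r + 2 * real CARD('k) \<le> (1 - t) * M" and R: "0 < R" and L: "2 * R \<le> real L"
  shows "t ^ CARD('k) * (real L - 2 * R) ^ CARD('k) \<le> real (card {p \<in> cube L. \<exists>n. good_site v R M r p n})"
proof -
  define C where "C n = {u. \<forall>m. (norm (u - rvec n))\<^sup>2 + v n / t \<le> (norm (u - rvec m))\<^sup>2 + v m / t}" for n :: "int^'k"
  define \<phi> where "\<phi> n u = rvec n + t *\<^sub>R (u - rvec n)" for n :: "int^'k" and u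
  \<comment> \<open>The map \<open>\<phi> n\<close> moves points of the cell of \<open>n\<close> by
    less than \<open>R\<close>, so a cube with a collar of width \<open>R\<close> removed is mapped
    into the full cube.\<close>
  define lo hi :: "real^'k" where "lo = (\<chi> i. R)" and "hi = (\<chi> i. real L - R)"
  define B where "B = cbox lo hi"
  define E where "E n = C n \<inter> B" for n
  define G where "G = {p \<in> cube L. \<exists>n. good_site v R M r p n}"
  have near: "norm (u - rvec n) \<le> R" "v n \<le> R\<^sup>2" if u: "u \<in> C n" for u n
  proof -
    obtain m where m: "v m = 0" "norm (u - rvec m) \<le> R" using cov by blast
    have "(norm (u - rvec m))\<^sup>2 \<le> R\<^sup>2" using m(2) by (intro power_mono) auto
    moreover have "(norm (u - rvec n))\<^sup>2 + v n / t \<le> (norm (u - rvec m))\<^sup>2 + v m / t"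
      using u by (simp add: C_def)
    ultimately have le: "(norm (u - rvec n))\<^sup>2 + v n / t \<le> R\<^sup>2" using m(1) by simp
    have vt: "v n \<le> v n / t" using v0[of n] t by (simp add: le_divide_eq mult_left_le)
    then show "v n \<le> R\<^sup>2" using le zero_le_power2[of "norm (u - rvec n)"] by linarith
    have "(norm (u - rvec n))\<^sup>2 \<le> R\<^sup>2" using le vt v0[of n] by linarith
    then show "norm (u - rvec n) \<le> R" by (rule power2_le_imp_le) (use R in simp)
  qed
  have cells: "\<exists>n. u \<in> C n" for u
  proof -
    \<comment> \<open>A site of weight 0 within \<open>R\<close> beats every site farther away, so
      the minimum is taken over a finite set.\<close>
    define S where "S = {n :: int^'k. norm (rvec n - u) \<le> R}"
    define f where "f n = (norm (u - rvec n))\<^sup>2 + v n / t" for n :: "int^'k"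
    have "finite S" unfolding S_def by (rule finite_rvec_ball)
    obtain n0 where n0: "v n0 = 0" "norm (u - rvec n0) \<le> R" using cov by blast
    then have n0S: "n0 \<in> S" by (simp add: S_def norm_minus_commute)
    define n where "n = arg_min_on f S"
    have "S \<noteq> {}" using n0S by blast
    have n: "n \<in> S" "\<And>m. m \<in> S \<Longrightarrow> f n \<le> f m"
      unfolding n_def using arg_min_if_finite(1)[OF \<open>finite S\<close> \<open>S \<noteq> {}\<close>]
        arg_min_least[OF \<open>finite S\<close> \<open>S \<noteq> {}\<close>] by auto
    have "f n \<le> f m" for m
    proof (cases "m \<in> S")
      case False
      then have "R < norm (u - rvec m)" by (simp add: S_def norm_minus_commute)
      then have "R\<^sup>2 \<le> (norm (u - rvec m))\<^sup>2" using R by (intro power_mono) auto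
      moreover have "0 \<le> v m / t" using v0 t by simp
      moreover have "f n0 \<le> R\<^sup>2" using n0 by (simp add: f_def power_mono)
      ultimately have "f n0 \<le> f m" by (simp add: f_def)
      then show ?thesis using n(2)[OF n0S] by linarith
    qed (use n in auto)
    then show ?thesis by (auto simp: C_def f_def)
  qed
  have margin: "(1 - t) * (norm (rvec n - rvec m))\<^sup>2
      \<le> (norm (\<phi> n u - rvec m))\<^sup>2 - (norm (\<phi> n u - rvec n))\<^sup>2 + v m - v n" if "u \<in> C n" for u n m
    unfolding \<phi>_def using that by (intro power_cell_shrink t) (simp add: C_def)
  have "closed (C n)" for n
    unfolding C_def by (intro closed_Collect_all closed_Collect_le continuous_intros)
  then have cE: "compact (E n)" for n unfolding E_def B_def by (intro closed_Int_compact compact_cbox)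
  have cont\<phi>: "continuous_on S (\<phi> n)" for S n unfolding \<phi>_def by (intro continuous_intros)
  have c\<phi>: "compact (\<phi> n ` E n)" for n by (intro compact_continuous_image cont\<phi> cE)
  define N0 where "N0 = {n. E n \<noteq> {}}"
  have "finite N0"
  proof -
    obtain b where b: "\<And>u. u \<in> B \<Longrightarrow> norm u \<le> b" using bounded_iff[of B] bounded_cbox B_def by metis
    have "N0 \<subseteq> {n. norm (rvec n) \<le> b + R}"
    proof
      fix n assume "n \<in> N0"
      then obtain u where u: "u \<in> C n" "u \<in> B" by (auto simp: N0_def E_def)
      have "norm (rvec n) \<le> norm u + norm (u - rvec n)" using norm_triangle_ineq4[of u "u - rvec n"] by simp
      then show "n \<in> {n. norm (rvec n) \<le> b + R}" using b[OF u(2)] near(1)[OF u(1)] by simp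
    qed
    then show ?thesis using finite_rvec_ball0 finite_subset by blast
  qed
  define Q where "Q p = cbox (rvec p) (rvec p + (\<chi> i. 1))" for p :: "int^'k"
  have mQ: "measure lebesgue (Q p) = 1" for p
  proof -
    have "Q p \<noteq> {}" by (auto simp: Q_def interval_ne_empty_cart)
    then show ?thesis unfolding Q_def by (simp add: content_cbox_cart)
  qed
  have finG: "finite G" unfolding G_def by (rule finite_subset[OF _ finite_cube]) auto
  have sub: "(\<Union>n\<in>N0. \<phi> n ` E n) \<subseteq> (\<Union>p\<in>G. Q p)"
  proof
    fix w assume "w \<in> (\<Union>n\<in>N0. \<phi> n ` E n)"
    then obtain n u where u: "u \<in> C n" "u \<in> B" "w = \<phi> n u" by (auto simp: E_def)
    define p :: "int^'k" where "p = (\<chi> i. \<lfloor>w $ i\<rfloor>)"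
    have wp: "norm (w - rvec p) \<le> CARD('k)" unfolding p_def by (rule norm_rvec_floor)
    have wn: "norm (w - rvec n) \<le> R"
    proof -
      have "norm (w - rvec n) = t * norm (u - rvec n)" using t by (simp add: u(3) \<phi>_def)
      also have "\<dots> \<le> 1 * R" using near(1)[OF u(1)] t by (intro mult_mono) auto
      finally show ?thesis by simp
    qed
    have wu: "norm (w - u) < R"
    proof -
      have "w - u = (t - 1) *\<^sub>R (u - rvec n)" by (simp add: u(3) \<phi>_def algebra_simps)
      then have "norm (w - u) = (1 - t) * norm (u - rvec n)" using t by simp
      also have "\<dots> \<le> (1 - t) * R" using near(1)[OF u(1)] t by (intro mult_left_mono) auto
      also have "\<dots> < R" using t R by simp
      finally show ?thesis .
    qed
    have "0 \<le> w $ i \<and> w $ i < real L" for i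
    proof -
      have "\<bar>w $ i - u $ i\<bar> < R" using component_le_norm_cart[of "w - u" i] wu by simp
      moreover have "R \<le> u $ i" "u $ i \<le> real L - R" using u(2) by (auto simp: B_def lo_def hi_def mem_box_cart)
      ultimately show ?thesis by linarith
    qed
    then have pL: "p \<in> cube L" by (simp add: cube_def p_def floor_less_iff)
    have "good_site v R M r p n" unfolding good_site_def
    proof (intro conjI allI impI)
      have "norm (rvec p - rvec n) \<le> norm (w - rvec p) + norm (w - rvec n)"
        using norm_triangle_ineq4[of "w - rvec n" "w - rvec p"] by simp
      then show "norm (rvec p - rvec n) \<le> R + CARD('k)" using wp wn by linarith
      show "v n \<le> R\<^sup>2" using near(2)[OF u(1)] .
      fix m assume m: "M \<le> norm (rvec n - rvec m)"
      let ?b = "norm (rvec n - rvec m)"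
      \<comment> \<open>Rounding \<open>w\<close> down to \<open>p\<close> costs at most
        \<open>2 * CARD('k) * ?b\<close>, the reason for the second summand in hypothesis
        \<open>M\<close>.\<close>
      have "2 * norm (rvec p - w) * ?b \<le> 2 * real CARD('k) * ?b"
        using wp by (intro mult_right_mono) (auto simp: norm_minus_commute)
      then have "(1 - t) * ?b\<^sup>2 - 2 * real CARD('k) * ?b
          \<le> (norm (rvec p - rvec m))\<^sup>2 - (norm (rvec p - rvec n))\<^sup>2 + v m - v n"
        using margin[OF u(1), of m] power_diff_shift[of w "rvec m" "rvec n" "rvec p"]
        unfolding u(3)[symmetric] by linarith
      moreover have "r * ?b \<le> (1 - t) * ?b\<^sup>2 - 2 * real CARD('k) * ?b"
      proof -
        have "(1 - t) * M \<le> (1 - t) * ?b" using m t by (intro mult_left_mono) auto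
        then have "(r + 2 * real CARD('k)) * ?b \<le> ((1 - t) * ?b) * ?b" using M by (intro mult_right_mono) auto
        then show ?thesis by (simp add: algebra_simps power2_eq_square)
      qed
      ultimately show "r * ?b \<le> (norm (rvec p - rvec m))\<^sup>2 - (norm (rvec p - rvec n))\<^sup>2 + v m - v n"
        by linarith
    qed
    then have "p \<in> G" using pL by (auto simp: G_def)
    moreover have "w \<in> Q p"
    proof -
      have "real_of_int \<lfloor>w $ i\<rfloor> \<le> w $ i \<and> w $ i \<le> real_of_int \<lfloor>w $ i\<rfloor> + 1" for i by linarith
      then show ?thesis by (simp add: Q_def mem_box_cart p_def)
    qed
    ultimately show "w \<in> (\<Union>p\<in>G. Q p)" by blast
  qed
  have disj: "disjoint_family_on (\<lambda>n. \<phi> n ` E n) N0"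
    unfolding disjoint_family_on_def
  proof (intro ballI impI)
    fix n n' :: "int^'k" assume "n \<noteq> n'"
    show "\<phi> n ` E n \<inter> \<phi> n' ` E n' = {}"
    proof (rule ccontr)
      assume "\<phi> n ` E n \<inter> \<phi> n' ` E n' \<noteq> {}"
      then obtain u u' where u: "u \<in> C n" "u' \<in> C n'" "\<phi> n u = \<phi> n' u'" by (auto simp: E_def)
      \<comment> \<open>At a common point the right-hand sides of the two margins are opposite
        numbers.\<close>
      have "(1 - t) * (norm (rvec n - rvec n'))\<^sup>2 + (1 - t) * (norm (rvec n' - rvec n))\<^sup>2 \<le> 0"
        using margin[OF u(1), of n'] margin[OF u(2), of n] u(3) by simp
      then have "(1 - t) * (norm (rvec n - rvec n'))\<^sup>2 \<le> 0" by (simp add: norm_minus_commute)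
      then show False using t \<open>n \<noteq> n'\<close> by (simp add: mult_le_0_iff)
    qed
  qed
  have "(real L - 2 * R) ^ CARD('k) = measure lebesgue B"
  proof -
    have "B \<noteq> {}" using L by (auto simp: B_def lo_def hi_def interval_ne_empty_cart)
    then show ?thesis unfolding B_def by (simp add: content_cbox_cart lo_def hi_def algebra_simps)
  qed
  also have "\<dots> \<le> measure lebesgue (\<Union>n\<in>N0. E n)"
  proof (rule measure_mono_fmeasurable)
    show "B \<subseteq> (\<Union>n\<in>N0. E n)" using cells by (fastforce simp: N0_def E_def)
    show "(\<Union>n\<in>N0. E n) \<in> lmeasurable"
      using \<open>finite N0\<close> cE lmeasurable_compact by (intro fmeasurable.finite_UN) auto
  qed (simp add: B_def)
  also have "\<dots> \<le> (\<Sum>n\<in>N0. measure lebesgue (E n))"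
    using \<open>finite N0\<close> cE lmeasurable_compact by (intro measure_UNION_le) (auto simp: fmeasurableD)
  finally have "t ^ CARD('k) * (real L - 2 * R) ^ CARD('k) \<le> t ^ CARD('k) * (\<Sum>n\<in>N0. measure lebesgue (E n))"
    using t by (intro mult_left_mono) auto
  also have "\<dots> = (\<Sum>n\<in>N0. measure lebesgue (\<phi> n ` E n))"
  proof -
    have "measure lebesgue (\<phi> n ` E n) = t ^ CARD('k) * measure lebesgue (E n)" for n
    proof -
      have "\<phi> n = (\<lambda>u. t *\<^sub>R u + (rvec n - t *\<^sub>R rvec n))" by (auto simp: \<phi>_def algebra_simps)
      then show ?thesis using measure_lebesgue_affine[of t "rvec n - t *\<^sub>R rvec n" "E n"] t by simp
    qed
    then show ?thesis by (simp add: sum_distrib_left)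
  qed
  also have "\<dots> = measure lebesgue (\<Union>n\<in>N0. \<phi> n ` E n)"
  proof (rule measure_finite_Union[symmetric, OF \<open>finite N0\<close> _ disj])
    show "(\<lambda>n. \<phi> n ` E n) ` N0 \<subseteq> sets lebesgue"
      using fmeasurableD[OF lmeasurable_compact[OF c\<phi>]] by blast
    show "emeasure lebesgue (\<phi> n ` E n) \<noteq> \<infinity>" for n
      using fmeasurableD2[OF lmeasurable_compact[OF c\<phi>]] by simp
  qed
  also have "\<dots> \<le> measure lebesgue (\<Union>p\<in>G. Q p)"
  proof (rule measure_mono_fmeasurable[OF sub])
    show "(\<Union>n\<in>N0. \<phi> n ` E n) \<in> sets lebesgue"
      using \<open>finite N0\<close> c\<phi> lmeasurable_compact by (intro sets.finite_UN) (auto simp: fmeasurableD)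
    show "(\<Union>p\<in>G. Q p) \<in> lmeasurable"
      using finG by (intro fmeasurable.finite_UN) (auto simp: Q_def)
  qed
  also have "\<dots> \<le> (\<Sum>p\<in>G. measure lebesgue (Q p))"
    using finG by (intro measure_UNION_le) (auto simp: Q_def)
  also have "\<dots> = real (card G)" by (simp add: mQ)
  finally show ?thesis by (simp add: G_def)
qed

section \<open>Tilings from markers\<close>

context Zk_action
begin

text \<open>\<open>h\<close> is a rescaled and truncated distance to the complement of an open
  marker set. Compactness reduces the covering by translates to finitely many with one common
  threshold, and the rescaling lifts that threshold to the value 1.\<close>

lemma marker_function:
  assumes "marker_property X T"
  obtains h :: "'a \<Rightarrow> real" and R :: real where "continuous_on X h" "\<And>x. x \<in> X \<Longrightarrow> 0 \<le> h x \<and> h x \<le> 1" "R > 0"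
    "\<And>x m n. x \<in> X \<Longrightarrow> 0 < h (T m x) \<Longrightarrow> 0 < h (T n x) \<Longrightarrow> m \<noteq> n \<Longrightarrow> M \<le> norm (rvec m - rvec n)"
    "\<And>x. x \<in> X \<Longrightarrow> \<exists>n. norm (rvec n) \<le> R \<and> h (T n x) = 1"
proof -
  define e :: "int^'k" where "e = (\<chi> i. 1)"
  have e0: "e \<noteq> 0" by (simp add: e_def vec_eq_iff)
  \<comment> \<open>The nonzero vector \<open>e\<close> forces \<open>U \<noteq> X\<close>, since
    \<open>X\<close> is nonempty and invariant. Otherwise the complement would be empty and
    \<open>infdist\<close> identically 0.\<close>
  define F where "F = insert e {n. norm (rvec n) \<le> M}"
  have "finite F" unfolding F_def using finite_rvec_ball0 by simp
  then obtain U where U: "openin (top_of_set X) U" "X = (\<Union>n. T n ` U)"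
    "\<And>n. n \<in> F \<Longrightarrow> n \<noteq> 0 \<Longrightarrow> U \<inter> T n ` U = {}"
    using assms unfolding marker_property_def by meson
  have UX: "U \<subseteq> X" using U(1) openin_imp_subset by blast
  have "U \<noteq> X" using U(3)[of e] e0 nonempty T_image[of e] by (auto simp: F_def)
  then have ne: "X - U \<noteq> {}" using UX by blast
  have "closedin (top_of_set X) (X - U)" using U(1) by (simp add: closedin_diff)
  then have cl: "closed (X - U)"
    using closedin_closed_trans compact_imp_closed[OF compact_X] by blast
  define g where "g x = infdist x (X - U)" for x
  have gc: "continuous_on A g" for A unfolding g_def by (intro continuous_intros)
  have gpos: "0 < g x \<longleftrightarrow> x \<in> U" if "x \<in> X" for x
    using in_closed_iff_infdist_zero[OF cl ne, of x] infdist_nonneg[of x "X - U"] that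
    unfolding g_def by auto
  define W where "W z = {x \<in> X. 1 / (real (snd z) + 1) < g (T (- fst z) x)}" for z :: "(int^'k) \<times> nat"
  have Wopen: "openin (top_of_set X) (W z)" for z
  proof -
    have "continuous_on X (\<lambda>x. g (T (- fst z) x))"
      by (rule continuous_on_compose2[OF gc[of UNIV] T_cont]) simp
    from continuous_openin_preimage_gen[OF this, of "{1 / (real (snd z) + 1)<..}"]
    have "openin (top_of_set X) (X \<inter> (\<lambda>x. g (T (- fst z) x)) -` {1 / (real (snd z) + 1)<..})" by simp
    moreover have "W z = X \<inter> (\<lambda>x. g (T (- fst z) x)) -` {1 / (real (snd z) + 1)<..}" by (auto simp: W_def)
    ultimately show ?thesis by simp
  qed
  have cover: "X \<subseteq> \<Union>(range W)"
  proof
    fix x assume x: "x \<in> X"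
    then obtain n u where u: "u \<in> U" "x = T n u" using U(2) by blast
    then have "T (- n) x = u" using UX by (simp add: T_add T_zero subset_iff)
    then have "0 < g (T (- n) x)" using gpos u(1) UX by auto
    then obtain j where "inverse (real (Suc j)) < g (T (- n) x)" using reals_Archimedean by blast
    then have "x \<in> W (n, j)" using x by (simp add: W_def inverse_eq_divide add.commute)
    then show "x \<in> \<Union>(range W)" by blast
  qed
  have "\<exists>D\<subseteq>range W. finite D \<and> X \<subseteq> \<Union>D"
    using spec[OF compact_X[unfolded compact_eq_openin_cover], of "range W"] cover Wopen by auto
  then obtain D where D: "D \<subseteq> range W" "finite D" "X \<subseteq> \<Union>D" by blast
  obtain P where "finite P" "D = W ` P" using finite_subset_image[OF D(2,1)] by blast
  with D(3) have P: "finite P" "X \<subseteq> \<Union>(W ` P)" by auto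
  define j0 where "j0 = Max (insert 0 (snd ` P))"
  define R where "R = Max (insert 1 ((\<lambda>z. norm (rvec (fst z))) ` P))"
  define h where "h x = min 1 ((real j0 + 1) * g x)" for x
  show ?thesis
  proof (rule that[of h R])
    show "continuous_on X h" unfolding h_def by (intro continuous_on_min continuous_intros gc)
    show "0 \<le> h x \<and> h x \<le> 1" for x by (simp add: h_def g_def infdist_nonneg)
    have "1 \<le> R" unfolding R_def using P(1) by (intro Max_ge) auto
    then show "R > 0" by simp
    fix x assume x: "x \<in> X"
    then obtain z where z: "z \<in> P" "x \<in> W z" using P(2) by blast
    have "snd z \<le> j0" unfolding j0_def using z(1) P(1) by (intro Max_ge) auto
    then have "1 / (real j0 + 1) \<le> 1 / (real (snd z) + 1)" by (intro divide_left_mono) auto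
    also have "\<dots> < g (T (- fst z) x)" using z(2) by (simp add: W_def)
    finally have "1 < (real j0 + 1) * g (T (- fst z) x)" by (simp add: divide_less_eq mult.commute)
    then have "h (T (- fst z) x) = 1" by (simp add: h_def)
    moreover have "norm (rvec (- fst z)) \<le> R"
      unfolding R_def rvec_uminus norm_minus_cancel using z(1) P(1) by (intro Max_ge) auto
    ultimately show "\<exists>n. norm (rvec n) \<le> R \<and> h (T n x) = 1" by blast
  next
    fix x m n assume a: "x \<in> X" "0 < h (T m x)" "0 < h (T n x)" "m \<noteq> n"
    have "T m x \<in> U" "T n x \<in> U"
      using a gpos T_in by (auto simp: h_def zero_less_mult_iff)
    moreover have "T m x = T (m - n) (T n x)" using a(1) by (simp add: T_add)
    ultimately have "T m x \<in> U \<inter> T (m - n) ` U" by blast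
    then have "m - n \<notin> F" using U(3)[of "m - n"] a(4) by auto
    then have "\<not> norm (rvec (m - n)) \<le> M" by (simp add: F_def)
    then show "M \<le> norm (rvec m - rvec n)" by (simp add: rvec_diff)
  qed
qed

text \<open>\<open>\<theta> n (T p x)\<close> measures how well \<open>p\<close> sits inside the
  cell with centre \<open>p + n\<close>. Centres are recorded relative to the site because a
  function on \<open>X\<close> sees the orbit only from the current point.\<close>

lemma tiling_functions:
  fixes N :: nat and t :: real
  assumes "marker_property X T" and t: "0 < t" "t < 1"
  obtains C :: "(int^'k) set" and \<theta> :: "int^'k \<Rightarrow> 'a \<Rightarrow> real" and R :: real
  where "finite C" "R > 0" "\<And>n. continuous_on X (\<theta> n)" "\<And>n x. x \<in> X \<Longrightarrow> 0 \<le> \<theta> n x \<and> \<theta> n x \<le> 1"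
    "\<And>x p p' n n'. x \<in> X \<Longrightarrow> n \<in> C \<Longrightarrow> n' \<in> C \<Longrightarrow> norm (rvec p - rvec p') \<le> 2 * real CARD('k) * real N \<Longrightarrow>
       0 < \<theta> n (T p x) \<Longrightarrow> 0 < \<theta> n' (T p' x) \<Longrightarrow> p + n = p' + n'"
    "\<And>x L. x \<in> X \<Longrightarrow> 2 * R \<le> real L \<Longrightarrow> t ^ CARD('k) * (real L - 2 * R) ^ CARD('k)
       \<le> real (card {p \<in> cube L. \<exists>n\<in>C. \<theta> n (T p x) = 1})"
proof -
  define \<kappa> where "\<kappa> = real CARD('k)"
  have \<kappa>: "\<kappa> > 0" by (simp add: \<kappa>_def)
  \<comment> \<open>The largest possible distance between sites whose boxes of side \<open>N\<close>
    meet.\<close>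
  define r where "r = 2 * \<kappa> * real N"
  \<comment> \<open>\<open>good_sites_density\<close> is applied with margin \<open>r + 1\<close>,
    which gives the numerator; \<open>1 \<le> M\<close> keeps the divisors in \<open>w\<close> away
    from 0.\<close>
  define M where "M = max 1 ((r + 1 + 2 * \<kappa>) / (1 - t))"
  have r0: "0 \<le> r" using \<kappa> by (simp add: r_def)
  have M: "r + 1 + 2 * \<kappa> \<le> (1 - t) * M" "1 \<le> M"
  proof -
    have "(1 - t) * ((r + 1 + 2 * \<kappa>) / (1 - t)) \<le> (1 - t) * M" using t by (intro mult_left_mono) (auto simp: M_def)
    then show "r + 1 + 2 * \<kappa> \<le> (1 - t) * M" using t by simp
    show "1 \<le> M" by (simp add: M_def)
  qed
  show ?thesis
  proof (rule marker_function[OF assms(1), of M])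
    fix h :: "'a \<Rightarrow> real" and R0 :: real
    assume h: "continuous_on X h" "\<And>x. x \<in> X \<Longrightarrow> 0 \<le> h x \<and> h x \<le> 1" "R0 > 0"
      and sep: "\<And>x m n. x \<in> X \<Longrightarrow> 0 < h (T m x) \<Longrightarrow> 0 < h (T n x) \<Longrightarrow> m \<noteq> n \<Longrightarrow> M \<le> norm (rvec m - rvec n)"
      and cov: "\<And>x. x \<in> X \<Longrightarrow> \<exists>n. norm (rvec n) \<le> R0 \<and> h (T n x) = 1"
    \<comment> \<open>A point of space is first rounded to a site, at cost \<open>\<kappa>\<close>,
      from which a marker of value 1 is found within \<open>R0\<close>.\<close>
    define R where "R = R0 + \<kappa>"
    have R: "R > 0" using h(3) \<kappa> by (simp add: R_def)
    \<comment> \<open>Full markers get weight 0. A point with \<open>h = 0\<close> gets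
      \<open>2 * R\<^sup>2\<close>, too much to win against a full marker within \<open>R\<close>,
      so cells appear and vanish continuously. A good centre has weight at most
      \<open>R\<^sup>2\<close>, that is \<open>h\<close> at least \<open>1/2\<close>, where the
      first factor of \<open>\<theta>\<close> is 1.\<close>
    define v where "v x n = 2 * R\<^sup>2 * (1 - h (T n x))" for x n
    define C where "C = {n :: int^'k. norm (rvec n) \<le> R + \<kappa>}"
    \<comment> \<open>Testing finitely many competitors keeps \<open>\<theta>\<close> a finite
      product of continuous functions. The radius suffices for uniqueness: the centre chosen by a
      site at distance at most \<open>r\<close> lies within \<open>R + \<kappa> + r\<close>.\<close>
    define Q where "Q n = {m :: int^'k. norm (rvec m) \<le> R + \<kappa> + r \<and> M \<le> norm (rvec n - rvec m)}" for n
    define \<Delta> where "\<Delta> n m x = (norm (rvec m))\<^sup>2 - (norm (rvec n))\<^sup>2 + v x m - v x n" for n m x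
    \<comment> \<open>A ramp in the normalised margin, 0 up to \<open>r\<close> and 1 from
      \<open>r + 1\<close> on: positivity yields the margin used for uniqueness, and good sites of
      margin \<open>r + 1\<close> attain the value 1.\<close>
    define w where "w n m x = max 0 (min 1 (\<Delta> n m x / norm (rvec n - rvec m) - r))" for n m x
    define \<theta> where "\<theta> n x = min 1 (2 * h (T n x)) * (\<Prod>m\<in>Q n. w n m x)" for n x
    have finQ: "finite (Q n)" for n
      unfolding Q_def by (rule finite_subset[OF _ finite_rvec_ball0[of "R + \<kappa> + r"]]) auto
    have w01: "0 \<le> w n m x \<and> w n m x \<le> 1" for n m x by (simp add: w_def)
    have prod01: "0 \<le> (\<Prod>m\<in>Q n. w n m x)" "(\<Prod>m\<in>Q n. w n m x) \<le> 1" for n x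
      using w01 by (auto intro: prod_nonneg prod_le_1)
    have hT: "0 \<le> h (T n x) \<and> h (T n x) \<le> 1" if "x \<in> X" for n x using h(2) T_in that by blast
    have hTc: "continuous_on X (\<lambda>x. h (T n x))" for n
      by (rule continuous_on_compose2[OF h(1) T_cont]) (auto simp: T_in)
    have vshift: "v (T p x) m = v x (p + m)" if "x \<in> X" for x p m
      using that by (simp add: v_def T_add add.commute)
    have \<Delta>shift: "\<Delta> n m (T p x) = (norm (rvec p - rvec (p + m)))\<^sup>2 - (norm (rvec p - rvec (p + n)))\<^sup>2
        + v x (p + m) - v x (p + n)" if "x \<in> X" for x p n m
      using that by (simp add: \<Delta>_def vshift rvec_add)
    have \<theta>pos: "0 < h (T n x) \<and> (\<forall>m\<in>Q n. r * norm (rvec n - rvec m) < \<Delta> n m x)" if "x \<in> X" "0 < \<theta> n x" for n x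
    proof -
      have "0 \<le> min 1 (2 * h (T n x))" using hT[OF that(1)] by simp
      then have a: "0 < min 1 (2 * h (T n x))" "0 < (\<Prod>m\<in>Q n. w n m x)"
        using that(2) prod01(1)[where x = x and n = n] unfolding \<theta>_def by (auto simp: zero_less_mult_iff)
      have "r * norm (rvec n - rvec m) < \<Delta> n m x" if m: "m \<in> Q n" for m
      proof -
        have "w n m x \<noteq> 0" using a(2) m finQ by (metis less_irrefl prod_zero)
        then have "r < \<Delta> n m x / norm (rvec n - rvec m)"
          by (auto simp: w_def max_def min_def split: if_splits)
        moreover have "0 < norm (rvec n - rvec m)" using m M(2) unfolding Q_def mem_Collect_eq by linarith
        ultimately show ?thesis by (simp add: less_divide_eq)
      qed
      then show ?thesis using a(1) by simp
    qed
    show ?thesis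
    proof (rule that[of C R \<theta>])
      show "finite C" unfolding C_def by (rule finite_rvec_ball0)
      show "R > 0" by fact
      show "continuous_on X (\<theta> n)" for n
      proof -
        have "continuous_on X (w n m)" if "m \<in> Q n" for m
        proof -
          have "norm (rvec n - rvec m) \<noteq> 0" using that M(2) unfolding Q_def mem_Collect_eq by linarith
          then show ?thesis unfolding w_def \<Delta>_def v_def
            by (intro continuous_on_max continuous_on_min continuous_intros hTc) auto
        qed
        then show ?thesis unfolding \<theta>_def
          by (intro continuous_on_mult continuous_on_min continuous_on_prod continuous_on_const hTc)
      qed
      show "0 \<le> \<theta> n x \<and> \<theta> n x \<le> 1" if "x \<in> X" for n x
        using hT[OF that, of n] prod01[of n x] unfolding \<theta>_def by (auto intro!: mult_le_one)
    next
      fix x p p' n n'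
      assume x: "x \<in> X" and n: "n \<in> C" "n' \<in> C" and pp: "norm (rvec p - rvec p') \<le> 2 * real CARD('k) * real N"
        and pos: "0 < \<theta> n (T p x)" "0 < \<theta> n' (T p' x)"
      have px: "T p x \<in> X" "T p' x \<in> X" using T_in x by auto
      show "p + n = p' + n'"
      proof (rule ccontr)
        assume ne: "p + n \<noteq> p' + n'"
        define b where "b = norm (rvec (p + n) - rvec (p' + n'))"
        have "M \<le> b" unfolding b_def using \<theta>pos[OF px(1) pos(1)] \<theta>pos[OF px(2) pos(2)] x
          by (intro sep[OF x _ _ ne]) (simp_all add: T_add add.commute)
        then have b: "0 < b" "M \<le> b" using M(2) by auto
        have e1: "rvec n - rvec (p' + n' - p) = rvec (p + n) - rvec (p' + n')"
          and e2: "rvec n' - rvec (p + n - p') = rvec (p' + n') - rvec (p + n)"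
          by (simp_all add: rvec_add rvec_diff)
        have "norm (rvec (p' + n' - p)) \<le> norm (rvec n') + norm (rvec p - rvec p')"
          using norm_triangle_ineq4[of "rvec n'" "rvec p - rvec p'"] by (simp add: rvec_add rvec_diff algebra_simps)
        then have "p' + n' - p \<in> Q n" using n(2) pp b(2) unfolding Q_def mem_Collect_eq e1 b_def
          by (simp add: C_def r_def \<kappa>_def)
        then have d1: "r * b < (norm (rvec p - rvec (p' + n')))\<^sup>2 - (norm (rvec p - rvec (p + n)))\<^sup>2
            + v x (p' + n') - v x (p + n)"
          using \<theta>pos[OF px(1) pos(1)] \<Delta>shift[OF x, of n "p' + n' - p" p] unfolding b_def e1[symmetric] by fastforce
        have "norm (rvec (p + n - p')) \<le> norm (rvec n) + norm (rvec p - rvec p')"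
          using norm_triangle_ineq[of "rvec n" "rvec p - rvec p'"] by (simp add: rvec_add rvec_diff algebra_simps)
        then have "p + n - p' \<in> Q n'" using n(1) pp b(2) unfolding Q_def mem_Collect_eq e2 b_def
          by (simp add: C_def r_def \<kappa>_def norm_minus_commute)
        then have d2: "r * b < (norm (rvec p' - rvec (p + n)))\<^sup>2 - (norm (rvec p' - rvec (p' + n')))\<^sup>2
            + v x (p + n) - v x (p' + n')"
          using \<theta>pos[OF px(2) pos(2)] \<Delta>shift[OF x, of n' "p + n - p'" p'] unfolding b_def
            norm_minus_commute[of "rvec (p + n)"] e2[symmetric] by fastforce
        \<comment> \<open>By \<open>d1\<close> and \<open>d2\<close> the power difference changes by
          more than \<open>2 * r * b\<close> between \<open>p\<close> and \<open>p'\<close>. But it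
          is Lipschitz with constant \<open>2 * b\<close>, and the sites are at distance at most
          \<open>r\<close>.\<close>
        have "(norm (rvec p - rvec (p' + n')))\<^sup>2 - (norm (rvec p - rvec (p + n)))\<^sup>2 - 2 * norm (rvec p' - rvec p) * b
            \<le> (norm (rvec p' - rvec (p' + n')))\<^sup>2 - (norm (rvec p' - rvec (p + n)))\<^sup>2"
          unfolding b_def by (rule power_diff_shift)
        then have "2 * (r * b) < 2 * (norm (rvec p' - rvec p) * b)" using d1 d2 by linarith
        then have "r * b < norm (rvec p' - rvec p) * b" by simp
        moreover have "norm (rvec p' - rvec p) * b \<le> r * b"
          using pp b(1) by (intro mult_right_mono) (auto simp: r_def \<kappa>_def norm_minus_commute)
        ultimately show False by linarith
      qed
    next
      fix x L assume x: "x \<in> X" and L: "2 * R \<le> real L"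
      have "t ^ CARD('k) * (real L - 2 * R) ^ CARD('k) \<le> real (card {p \<in> cube L. \<exists>n. good_site (v x) R M (r + 1) p n})"
      proof (rule good_sites_density[OF _ _ t _ R L])
        show "0 \<le> v x n" for n using hT[OF x, of n] by (simp add: v_def)
        show "\<exists>n. v x n = 0 \<and> norm (u - rvec n) \<le> R" for u
        proof -
          define p :: "int^'k" where "p = (\<chi> i. \<lfloor>u $ i\<rfloor>)"
          have up: "norm (u - rvec p) \<le> \<kappa>" unfolding p_def \<kappa>_def by (rule norm_rvec_floor)
          obtain n where n: "norm (rvec n) \<le> R0" "h (T n (T p x)) = 1" using cov[OF T_in[OF x]] by blast
          have "v x (n + p) = 0" using n(2) x by (simp add: v_def T_add)
          moreover have "norm (u - rvec (n + p)) \<le> norm (u - rvec p) + norm (rvec n)"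
            using norm_triangle_ineq4[of "u - rvec p" "rvec n"] by (simp add: rvec_add algebra_simps)
          ultimately show ?thesis using up n(1) unfolding R_def by (intro exI[of _ "n + p"]) auto
        qed
        show "r + 1 + 2 * real CARD('k) \<le> (1 - t) * M" using M(1) by (simp add: \<kappa>_def)
      qed
      also have "\<dots> \<le> real (card {p \<in> cube L. \<exists>n\<in>C. \<theta> n (T p x) = 1})"
      proof -
        have "\<exists>n\<in>C. \<theta> n (T p x) = 1" if good: "good_site (v x) R M (r + 1) p c" for p c
        proof (rule bexI[of _ "c - p"])
          have "norm (rvec p - rvec c) \<le> R + \<kappa>" using good by (simp add: good_site_def \<kappa>_def)
          then show "c - p \<in> C" by (simp add: C_def rvec_diff norm_minus_commute)
          have "2 * R\<^sup>2 * (1 - h (T c x)) \<le> R\<^sup>2" using good by (simp add: good_site_def v_def)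
          then have "R\<^sup>2 * (2 * (1 - h (T c x))) \<le> R\<^sup>2 * 1" by (simp add: algebra_simps)
          then have "2 * (1 - h (T c x)) \<le> 1" using R by (subst (asm) mult_le_cancel_left_pos) auto
          then have "min 1 (2 * h (T (c - p) (T p x))) = 1" using x by (simp add: T_add)
          moreover have "w (c - p) m (T p x) = 1" if m: "m \<in> Q (c - p)" for m
          proof -
            have e: "rvec (c - p) - rvec m = rvec c - rvec (p + m)" by (simp add: rvec_add rvec_diff)
            have b: "M \<le> norm (rvec c - rvec (p + m))" using m unfolding Q_def mem_Collect_eq e[symmetric] by blast
            have "(r + 1) * norm (rvec c - rvec (p + m)) \<le> \<Delta> (c - p) m (T p x)"
              using good b \<Delta>shift[OF x, of "c - p" m p] unfolding good_site_def by simp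
            then have "r + 1 \<le> \<Delta> (c - p) m (T p x) / norm (rvec (c - p) - rvec m)"
            proof -
              have "0 < norm (rvec c - rvec (p + m))" using b M(2) by linarith
              then show ?thesis using \<open>(r + 1) * _ \<le> _\<close> unfolding e by (simp only: pos_le_divide_eq)
            qed
            then show ?thesis by (simp add: w_def)
          qed
          ultimately show "\<theta> (c - p) (T p x) = 1" by (simp add: \<theta>_def)
        qed
        then have "card {p \<in> cube L. \<exists>n. good_site (v x) R M (r + 1) p n} \<le> card {p \<in> cube L. \<exists>n\<in>C. \<theta> n (T p x) = 1}"
          by (intro card_mono finite_subset[OF _ finite_cube[of L]]) auto
        then show ?thesis by simp
      qed
      finally show "t ^ CARD('k) * (real L - 2 * R) ^ CARD('k)
         \<le> real (card {p \<in> cube L. \<exists>n\<in>C. \<theta> n (T p x) = 1})" .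
    qed
  qed
qed

end

text \<open>The box of the grid \<open>n + N\<int>\<close> that contains the origin has lower corner \<open>box_corner N n\<close>.\<close>
definition box_corner :: "nat \<Rightarrow> int^'k \<Rightarrow> int^'k" where
  "box_corner N n = (\<chi> i. - ((- n $ i) mod int N))"

lemma uminus_box_corner: "N \<ge> 1 \<Longrightarrow> - box_corner N n \<in> cube N"
  by (simp add: cube_def box_corner_def)

lemma rvec_cube_dist:
  fixes p q b :: "int^'k::finite"
  assumes "p - b \<in> cube N" "q - b \<in> cube N"
  shows "norm (rvec p - rvec q) \<le> real CARD('k) * real N"
proof -
  have "norm (rvec p - rvec q) \<le> (\<Sum>i\<in>UNIV. \<bar>(rvec p - rvec q) $ i\<bar>)" by (rule norm_le_l1_cart)
  also have "\<dots> \<le> (\<Sum>i\<in>(UNIV::'k set). real N)"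
  proof (intro sum_mono)
    fix i
    have "0 \<le> p $ i - b $ i" "p $ i - b $ i < int N" "0 \<le> q $ i - b $ i" "q $ i - b $ i < int N"
      using assms by (auto simp: cube_def)
    then have "\<bar>p $ i - q $ i\<bar> \<le> int N" by linarith
    then have "\<bar>real_of_int (p $ i - q $ i)\<bar> \<le> real N" by linarith
    then show "\<bar>(rvec p - rvec q) $ i\<bar> \<le> real N" by simp
  qed
  finally show ?thesis by simp
qed

text \<open>Boxes that meet come from sites at distance at most \<open>2 * CARD('k) * N\<close> and
  hence share the centre \<open>p + n\<close>. Corners are congruent to the centre modulo
  \<open>N\<close>, so such boxes coincide. Distinct boxes are therefore disjoint, and all lie in a
  cube of side \<open>L + 2 * N\<close>.\<close>

lemma box_count:
  fixes S :: "((int^'k::finite) \<times> (int^'k)) set"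
  assumes N: "N \<ge> 1" and S: "fst ` S \<subseteq> cube L" "finite S"
    and uniq: "\<And>p n p' n'. (p, n) \<in> S \<Longrightarrow> (p', n') \<in> S \<Longrightarrow>
       norm (rvec p - rvec p') \<le> 2 * real CARD('k) * real N \<Longrightarrow> p + n = p' + n'"
  shows "card ((\<lambda>z. fst z + box_corner N (snd z)) ` S) * N ^ CARD('k) \<le> (L + 2 * N) ^ CARD('k)"
proof -
  define Bs where "Bs = (\<lambda>z. fst z + box_corner N (snd z)) ` S"
  define box where "box b = (+) b ` (cube N :: (int^'k) set)" for b
  have inbox: "q \<in> box b \<longleftrightarrow> q - b \<in> cube N" for q b :: "int^'k"
    by (auto simp: box_def image_iff) (metis add_diff_cancel_left' diff_add_cancel add.commute)
  have disj: "box b \<inter> box b' = {}" if b: "b \<in> Bs" "b' \<in> Bs" "b \<noteq> b'" for b b'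
  proof (rule ccontr)
    assume "box b \<inter> box b' \<noteq> {}"
    then obtain q where q: "q - b \<in> cube N" "q - b' \<in> cube N" using inbox by blast
    obtain p n p' n' where z: "(p, n) \<in> S" "(p', n') \<in> S" "b = p + box_corner N n" "b' = p' + box_corner N n'"
      using b by (auto simp: Bs_def)
    have "p - b \<in> cube N" "p' - b' \<in> cube N" using z uminus_box_corner[OF N] by (metis add_diff_cancel_left' diff_minus_eq_add minus_diff_eq)+
    then have "norm (rvec p - rvec q) \<le> real CARD('k) * real N" "norm (rvec p' - rvec q) \<le> real CARD('k) * real N"
      using rvec_cube_dist q by blast+
    then have "norm (rvec p - rvec p') \<le> 2 * real CARD('k) * real N"
      using norm_triangle_ineq4[of "rvec p - rvec q" "rvec p' - rvec q"] by simp
    then have c: "p + n = p' + n'" using uniq z by blast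
    have "b $ i = b' $ i" for i
    proof -
      have m: "(p + box_corner N n) $ i mod int N = (p + n) $ i mod int N" for p n :: "int^'k"
      proof -
        have "int N dvd (p + n) $ i - (p + box_corner N n) $ i"
        proof -
          have "(p + n) $ i - (p + box_corner N n) $ i = - ((- n $ i) - (- n $ i) mod int N)"
            by (simp add: box_corner_def)
          then show ?thesis by (simp only: dvd_minus_iff dvd_minus_mod)
        qed
        then show ?thesis by (metis mod_eq_dvd_iff)
      qed
      have "b $ i mod int N = b' $ i mod int N" unfolding z(3,4) m c ..
      then have "int N dvd b $ i - b' $ i" by (simp add: mod_eq_dvd_iff)
      moreover have "\<bar>b $ i - b' $ i\<bar> < int N" using q by (auto simp: cube_def abs_less_iff) (smt (verit))+
      ultimately show ?thesis using dvd_imp_le_int[of "b $ i - b' $ i" "int N"] by fastforce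
    qed
    then show False using b(3) by (simp add: vec_eq_iff)
  qed
  have finBs: "finite Bs" using S(2) by (simp add: Bs_def)
  have cbox: "card (box b) = N ^ CARD('k)" "finite (box b)" for b
    by (simp_all add: box_def card_image card_cube finite_cube)
  have "card Bs * N ^ CARD('k) = (\<Sum>b\<in>Bs. card (box b))" by (simp add: cbox)
  also have "\<dots> = card (\<Union>b\<in>Bs. box b)"
    using finBs cbox disj by (intro card_UN_disjoint[symmetric]) auto
  also have "\<dots> \<le> card ((+) (\<chi> i. - int N) ` (cube (L + 2 * N) :: (int^'k) set))"
  proof (rule card_mono)
    show "(\<Union>b\<in>Bs. box b) \<subseteq> (+) (\<chi> i. - int N) ` cube (L + 2 * N)"
    proof
      fix q assume "q \<in> (\<Union>b\<in>Bs. box b)"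
      then obtain p n where q: "(p, n) \<in> S" "q - (p + box_corner N n) \<in> cube N" using inbox by (auto simp: Bs_def)
      have p: "p \<in> cube L" using S(1) q(1) by force
      have "0 \<le> q $ i + int N \<and> q $ i + int N < int (L + 2 * N)" for i
      proof -
        have "0 \<le> q $ i - p $ i + (- n $ i) mod int N" "q $ i - p $ i + (- n $ i) mod int N < int N"
          using q(2) by (auto simp: cube_def box_corner_def algebra_simps dest: spec[of _ i])
        moreover have "0 \<le> (- n $ i) mod int N" "(- n $ i) mod int N < int N" using N by auto
        moreover have "0 \<le> p $ i" "p $ i < int L" using p by (auto simp: cube_def)
        ultimately show ?thesis by linarith
      qed
      then have "q - (\<chi> i. - int N) \<in> cube (L + 2 * N)" by (simp add: cube_def)
      then show "q \<in> (+) (\<chi> i. - int N) ` cube (L + 2 * N)" by (metis image_eqI add_diff_cancel_left' diff_add_cancel add.commute)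
    qed
  qed (simp add: finite_cube)
  also have "\<dots> = (L + 2 * N) ^ CARD('k)" by (simp add: card_image card_cube)
  finally show ?thesis by (simp add: Bs_def)
qed

section \<open>Coding orbits\<close>

lemma cont_pseudometric_abs_diff:
  fixes f :: "'a::metric_space \<Rightarrow> real"
  assumes "continuous_on X f"
  shows "cont_pseudometric X (\<lambda>x y. \<bar>f x - f y\<bar>)"
  unfolding cont_pseudometric_def
proof (intro conjI ballI)
  show "continuous_on (X \<times> X) (\<lambda>z. \<bar>f (fst z) - f (snd z)\<bar>)"
    by (intro continuous_intros continuous_on_compose2[OF assms]) auto
qed auto

lemma cont_pseudometric_add:
  assumes "cont_pseudometric X D" "cont_pseudometric X E"
  shows "cont_pseudometric X (\<lambda>x y. D x y + E x y)"
  unfolding cont_pseudometric_def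
proof (intro conjI ballI)
  show "continuous_on (X \<times> X) (\<lambda>z. D (fst z) (snd z) + E (fst z) (snd z))"
    by (rule continuous_on_add[OF cont_pseudometricD(1)[OF assms(1)] cont_pseudometricD(1)[OF assms(2)]])
  fix x y z assume xyz: "x \<in> X" "y \<in> X" "z \<in> X"
  show "D x z + E x z \<le> D x y + E x y + (D y z + E y z)"
    using cont_pseudometricD(4)[OF assms(1) xyz] cont_pseudometricD(4)[OF assms(2) xyz] by linarith
next
  fix x y assume xy: "x \<in> X" "y \<in> X"
  show "D x x + E x x = 0"
    using cont_pseudometricD(2)[OF assms(1) xy(1)] cont_pseudometricD(2)[OF assms(2) xy(1)] by simp
  show "D x y + E x y = D y x + E y x"
    using cont_pseudometricD(3)[OF assms(1) xy] cont_pseudometricD(3)[OF assms(2) xy] by simp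
qed

lemma cont_pseudometric_sum_abs:
  fixes f :: "'i \<Rightarrow> 'a::metric_space \<Rightarrow> real"
  assumes "finite I" "\<And>i. i \<in> I \<Longrightarrow> continuous_on X (f i)"
  shows "cont_pseudometric X (\<lambda>x y. \<Sum>i\<in>I. \<bar>f i x - f i y\<bar>)"
  using assms
proof (induction rule: finite_induct)
  case empty
  then show ?case by (simp add: cont_pseudometric_def)
next
  case (insert i I)
  then show ?case using cont_pseudometric_add[OF cont_pseudometric_abs_diff[of X "f i"]] by simp
qed

lemma cont_pseudometric_Max_abs:
  fixes f :: "'i \<Rightarrow> 'a::metric_space \<Rightarrow> real"
  assumes "finite I" "I \<noteq> {}" "\<And>i. i \<in> I \<Longrightarrow> continuous_on X (f i)"
  shows "cont_pseudometric X (\<lambda>x y. Max ((\<lambda>i. \<bar>f i x - f i y\<bar>) ` I))"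
  using assms
proof (induction rule: finite_ne_induct)
  case (singleton i)
  then show ?case using cont_pseudometric_abs_diff[of X "f i"] by simp
next
  case (insert i I)
  then show ?case using cont_pseudometric_max[OF cont_pseudometric_abs_diff[of X "f i"]] by simp
qed

section \<open>Lipschitz extension and rounding of coordinates\<close>

lemma continuous_on_pseudo_Lipschitz:
  fixes G :: "'a::metric_space \<Rightarrow> real"
  assumes "compact X" "cont_pseudometric X \<omega>" "0 \<le> c"
    and "\<And>x y. x \<in> X \<Longrightarrow> y \<in> X \<Longrightarrow> \<bar>G x - G y\<bar> \<le> c * \<omega> x y"
  shows "continuous_on X G"
  unfolding continuous_on_iff
proof (intro ballI allI impI)
  fix x and e :: real assume x: "x \<in> X" and e: "0 < e"
  obtain r where r: "r > 0" "\<And>x y. x \<in> X \<Longrightarrow> y \<in> X \<Longrightarrow> dist x y < r \<Longrightarrow> \<omega> x y < e / (c + 1)"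
    by (rule cont_pseudometric_small[OF assms(1,2), of "e / (c + 1)"]) (use e assms(3) in auto)
  show "\<exists>d>0. \<forall>y\<in>X. dist y x < d \<longrightarrow> dist (G y) (G x) < e"
  proof (intro exI[of _ r] conjI ballI impI)
    fix y assume y: "y \<in> X" "dist y x < r"
    have "c * \<omega> y x \<le> c * (e / (c + 1))" using r(2)[OF y(1) x y(2)] assms(3) by (intro mult_left_mono) auto
    also have "\<dots> < e" using e assms(3) by (simp add: field_simps)
    finally show "dist (G y) (G x) < e" using assms(4)[OF y(1) x] by (simp add: dist_real_def)
  qed (rule r(1))
qed

text \<open>McShane's extension formula, relative to the pseudometric \<open>\<omega>\<close>.\<close>
definition mcshane :: "'a set \<Rightarrow> ('a \<Rightarrow> real) \<Rightarrow> real \<Rightarrow> ('a \<Rightarrow> 'a \<Rightarrow> real) \<Rightarrow> 'a \<Rightarrow> real" where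
  "mcshane X f c \<omega> x = (INF y\<in>X. f y + c * \<omega> x y)"

lemma mcshane_le:
  assumes "\<And>y. y \<in> X \<Longrightarrow> 0 \<le> f y" "cont_pseudometric X \<omega>" "0 \<le> c" "x \<in> X" "y \<in> X"
  shows "mcshane X f c \<omega> x \<le> f y + c * \<omega> x y"
  unfolding mcshane_def
proof (rule cINF_lower)
  have "0 \<le> f y + c * \<omega> x y" if "y \<in> X" for y
    using assms(1)[OF that] assms(3) cont_pseudometric_nonneg[OF assms(2,4) that] by simp
  then show "bdd_below ((\<lambda>y. f y + c * \<omega> x y) ` X)"
    by (intro bdd_belowI2[of _ 0])
qed fact

lemma mcshane_Lipschitz:
  assumes "\<And>y. y \<in> X \<Longrightarrow> 0 \<le> f y" "cont_pseudometric X \<omega>" "0 \<le> c" "x \<in> X" "x' \<in> X"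
  shows "\<bar>mcshane X f c \<omega> x - mcshane X f c \<omega> x'\<bar> \<le> c * \<omega> x x'"
proof -
  have *: "mcshane X f c \<omega> a - c * \<omega> a b \<le> mcshane X f c \<omega> b" if ab: "a \<in> X" "b \<in> X" for a b
    unfolding mcshane_def[of X f c \<omega> b]
  proof (rule cINF_greatest)
    show "X \<noteq> {}" using ab by blast
    fix y assume y: "y \<in> X"
    have "c * \<omega> a y \<le> c * (\<omega> a b + \<omega> b y)"
      using cont_pseudometricD(4)[OF assms(2) ab y] assms(3) by (intro mult_left_mono)
    then show "mcshane X f c \<omega> a - c * \<omega> a b \<le> f y + c * \<omega> b y"
      using mcshane_le[of X f \<omega> c a y] assms(1,2,3) ab(1) y by (simp add: distrib_left)
  qed
  show ?thesis
    using *[OF assms(4,5)] *[OF assms(5,4)] cont_pseudometricD(3)[OF assms(2,4,5)] by simp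
qed

text \<open>Beyond \<open>\<omega>\<close>-distance \<open>\<kappa>\<close> the penalty is at least
  \<open>B\<close> and outweighs every value of \<open>f\<close>, so only nearby values of
  \<open>f\<close> compete in the infimum.\<close>

lemma mcshane_close:
  assumes f: "\<And>y. y \<in> X \<Longrightarrow> 0 \<le> f y \<and> f y \<le> B" and "cont_pseudometric X \<omega>" "0 \<le> c" "x \<in> X"
    and near: "\<And>y. y \<in> X \<Longrightarrow> \<omega> x y < \<kappa> \<Longrightarrow> f x \<le> f y + s" and "B \<le> c * \<kappa>" "0 \<le> s"
  shows "\<bar>mcshane X f c \<omega> x - f x\<bar> \<le> s"
proof -
  have "mcshane X f c \<omega> x \<le> f x + c * \<omega> x x"
    using f by (intro mcshane_le assms) auto
  then have "mcshane X f c \<omega> x \<le> f x" using cont_pseudometricD(2)[OF assms(2,4)] by simp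
  moreover have "f x - s \<le> mcshane X f c \<omega> x"
    unfolding mcshane_def
  proof (rule cINF_greatest)
    show "X \<noteq> {}" using assms(4) by blast
    fix y assume y: "y \<in> X"
    have nn: "0 \<le> \<omega> x y" using cont_pseudometric_nonneg[OF assms(2,4) y] .
    show "f x - s \<le> f y + c * \<omega> x y"
    proof (cases "\<omega> x y < \<kappa>")
      case True
      have "0 \<le> c * \<omega> x y" using assms(3) nn by simp
      then show ?thesis using near[OF y True] by linarith
    next
      case False
      then have "c * \<kappa> \<le> c * \<omega> x y" using assms(3) by (intro mult_left_mono) auto
      then show ?thesis using f[OF y] f[OF assms(4)] assms(6,7) by linarith
    qed
  qed
  ultimately show ?thesis using assms(7) by linarith
qed

lemma floor_eq_imp_close:
  fixes a b :: real
  assumes "nat \<lfloor>real q * a\<rfloor> = nat \<lfloor>real q * b\<rfloor>" "0 \<le> a" "0 \<le> b" "q \<ge> 1"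
  shows "\<bar>a - b\<bar> \<le> 1 / real q"
proof -
  have "\<lfloor>real q * a\<rfloor> = \<lfloor>real q * b\<rfloor>" using assms(1-3) by (simp add: eq_nat_nat_iff)
  then have "\<bar>real q * a - real q * b\<bar> < 1" by linarith
  then have "real q * \<bar>a - b\<bar> < 1" using assms(4) by (simp add: abs_mult flip: right_diff_distrib)
  then show ?thesis using assms(4) by (simp add: field_simps)
qed

text \<open>Up to \<open>2 n / q\<close>, barycentric coordinates in an \<open>n\<close>-dimensional simplex are determined by
  rounding all but one of them.\<close>
lemma simplex_code:
  assumes t: "small_param X D e n P t" and q: "q \<ge> 1"
  obtains code :: "'a::topological_space \<Rightarrow> nat set \<times> (nat \<Rightarrow> nat)" and K where "finite K"
    "card K \<le> 2 ^ P * (q + 1) ^ n" "code ` X \<subseteq> K"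
    "\<And>x y. x \<in> X \<Longrightarrow> y \<in> X \<Longrightarrow> code x = code y \<Longrightarrow> (\<Sum>i<P. \<bar>t i x - t i y\<bar>) \<le> 2 * real n / real q"
proof -
  note tD = small_paramD[OF t]
  define S where "S x = {i. i < P \<and> t i x \<noteq> 0}" for x
  \<comment> \<open>Recording the support costs at most \<open>2 ^ P\<close>, independently of
    \<open>q\<close>. Leaving out the vertex \<open>Min (S x)\<close> brings the exponent of
    \<open>q + 1\<close> down from \<open>n + 1\<close> to \<open>n\<close>, the true
    dimension.\<close>
  define code where "code x = (S x, restrict (\<lambda>i. nat \<lfloor>real q * t i x\<rfloor>) (S x - {Min (S x)}))" for x
  define A where "A = {S. S \<subseteq> {..<P} \<and> S \<noteq> {} \<and> card S \<le> Suc n}"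
  define K where "K = Sigma A (\<lambda>S. (S - {Min S}) \<rightarrow>\<^sub>E {..q})"
  have finA: "finite A" "card A \<le> 2 ^ P"
  proof -
    have "A \<subseteq> Pow {..<P}" by (auto simp: A_def)
    then show "finite A" "card A \<le> 2 ^ P"
      using card_mono[of "Pow {..<P}" A] by (auto simp: card_Pow intro: finite_subset)
  qed
  have finS: "finite S" if "S \<in> A" for S using that finite_subset by (auto simp: A_def)
  have S: "S x \<in> A" if x: "x \<in> X" for x
  proof -
    have "\<exists>i<P. t i x \<noteq> 0" using tD(3)[OF x] by (metis lessThan_iff sum.neutral zero_neq_one)
    then show ?thesis using tD(4)[OF x] by (auto simp: A_def S_def)
  qed
  have t1: "t i x \<le> 1" if "x \<in> X" "i < P" for x i
  proof -
    have "t i x \<le> (\<Sum>j<P. t j x)" using that tD(2) by (intro member_le_sum) auto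
    then show ?thesis using tD(3)[OF that(1)] by simp
  qed
  show ?thesis
  proof (rule that[of K code])
    show "finite K" unfolding K_def using finA(1) finS by (intro finite_SigmaI finite_PiE) auto
    have "card K = (\<Sum>S\<in>A. card ((S - {Min S}) \<rightarrow>\<^sub>E {..q}))"
      unfolding K_def using finA(1) finS by (intro card_SigmaI) (auto intro!: finite_PiE)
    also have "\<dots> \<le> (\<Sum>S\<in>A. (q + 1) ^ n)"
    proof (rule sum_mono)
      fix S assume SA: "S \<in> A"
      have "finite S" by (rule finS[OF SA])
      moreover have "S \<noteq> {}" "card S \<le> Suc n" using SA by (auto simp: A_def)
      ultimately have "card (S - {Min S}) \<le> n" by (simp add: card_Diff_singleton)
      then show "card ((S - {Min S}) \<rightarrow>\<^sub>E {..q}) \<le> (q + 1) ^ n"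
        using \<open>finite S\<close> by (simp only: card_PiE finite_Diff prod_constant card_atMost Suc_eq_plus1 power_increasing)
    qed
    also have "\<dots> \<le> 2 ^ P * (q + 1) ^ n" using finA(2) by simp
    finally show "card K \<le> 2 ^ P * (q + 1) ^ n" .
    show "code ` X \<subseteq> K"
    proof (rule image_subsetI)
      fix x assume x: "x \<in> X"
      have "nat \<lfloor>real q * t i x\<rfloor> \<le> q" if "i < P" for i
      proof -
        have "real q * t i x \<le> real q * 1" using t1[OF x that] by (intro mult_left_mono) auto
        then have "\<lfloor>real q * t i x\<rfloor> \<le> int q" by linarith
        then show ?thesis by linarith
      qed
      then have "restrict (\<lambda>i. nat \<lfloor>real q * t i x\<rfloor>) (S x - {Min (S x)}) \<in> (S x - {Min (S x)}) \<rightarrow>\<^sub>E {..q}"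
        unfolding restrict_PiE_iff by (auto simp: S_def)
      then show "code x \<in> K" using S[OF x] by (simp add: K_def code_def)
    qed
    fix x y assume xy: "x \<in> X" "y \<in> X" and eq: "code x = code y"
    define s where "s = S x"
    define v where "v = Min s"
    have sy: "S y = s" using eq by (simp add: code_def s_def)
    have sA: "s \<in> A" using S[OF xy(1)] by (simp add: s_def)
    then have s: "s \<noteq> {}" "s \<subseteq> {..<P}" "card s \<le> Suc n" by (auto simp: A_def)
    have fs: "finite s" by (rule finS[OF sA])
    note s = fs s
    have v: "v \<in> s" unfolding v_def using s by (intro Min_in)
    have rs: "restrict (\<lambda>i. nat \<lfloor>real q * t i x\<rfloor>) (s - {v}) = restrict (\<lambda>i. nat \<lfloor>real q * t i y\<rfloor>) (s - {v})"
      using eq sy by (simp add: code_def s_def v_def)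
    have fl: "nat \<lfloor>real q * t i x\<rfloor> = nat \<lfloor>real q * t i y\<rfloor>" if "i \<in> s - {v}" for i
      using fun_cong[OF rs, of i] that by simp
    have c1: "\<bar>t i x - t i y\<bar> \<le> 1 / real q" if "i \<in> s - {v}" for i
      using that s(3) tD(2) xy by (intro floor_eq_imp_close[OF fl[OF that] _ _ q]) auto
    have J: "(\<Sum>i\<in>s - {v}. \<bar>t i x - t i y\<bar>) \<le> real n / real q"
    proof -
      have "(\<Sum>i\<in>s - {v}. \<bar>t i x - t i y\<bar>) \<le> real (card (s - {v})) * (1 / real q)"
        using c1 by (rule sum_bounded_above)
      also have "\<dots> \<le> real n * (1 / real q)"
        using s v by (intro mult_right_mono) (auto simp: card_Diff_singleton)
      finally show ?thesis by simp
    qed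
    have restr: "(\<Sum>i<P. g i) = g v + (\<Sum>i\<in>s - {v}. g i)" if "\<And>i. i < P \<Longrightarrow> i \<notin> s \<Longrightarrow> g i = 0" for g :: "nat \<Rightarrow> real"
    proof -
      have "(\<Sum>i<P. g i) = (\<Sum>i\<in>s. g i)" using s that by (intro sum.mono_neutral_right) auto
      then show ?thesis using s(1) v by (simp add: sum.remove)
    qed
    have zx: "t i x = 0" if "i < P" "i \<notin> s" for i using that by (simp add: s_def S_def)
    have zy: "t i y = 0" if "i < P" "i \<notin> s" for i using that sy by (auto simp: S_def)
    \<comment> \<open>The omitted coordinate errs by at most the total error of the others, whence
      the factor 2 in the bound.\<close>
    have "t v x - t v y = - (\<Sum>i\<in>s - {v}. t i x - t i y)"
      using restr[of "\<lambda>i. t i x"] restr[of "\<lambda>i. t i y"] zx zy tD(3)[OF xy(1)] tD(3)[OF xy(2)]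
      by (simp add: sum_subtractf)
    then have "\<bar>t v x - t v y\<bar> \<le> (\<Sum>i\<in>s - {v}. \<bar>t i x - t i y\<bar>)"
      using sum_abs[of "\<lambda>i. t i x - t i y" "s - {v}"] by simp
    then show "(\<Sum>i<P. \<bar>t i x - t i y\<bar>) \<le> 2 * real n / real q"
      using restr[of "\<lambda>i. \<bar>t i x - t i y\<bar>"] zx zy J by simp
  qed
qed

section \<open>Counting orbit codes\<close>

context Zk_action
begin

text \<open>An orbit segment is coded by the good sites with their centres, the code of the orbit
  point at the corner of each box, and the rounded values of all \<open>f z\<close> at the bad
  sites; these give the three factors. A corner may lie outside \<open>cube L\<close>, which does no
  harm since \<open>code\<close> applies to \<open>T b x\<close> for every \<open>b\<close>.\<close>

lemma cover_num_coding:
  fixes L N q B b1 b2 :: nat and C :: "(int^'k) set" and f :: "'z \<Rightarrow> 'a \<Rightarrow> real"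
  assumes LNq: "L \<ge> 1" "q \<ge> 1" and C: "finite C"
    and Z: "finite Z" "Z \<noteq> {}" and f: "\<And>z. z \<in> Z \<Longrightarrow> continuous_on X (f z)"
      "\<And>z x. z \<in> Z \<Longrightarrow> x \<in> X \<Longrightarrow> \<bar>f z x\<bar> \<le> real B"
    and K: "finite K" "code ` X \<subseteq> K"
      "\<And>x y. x \<in> X \<Longrightarrow> y \<in> X \<Longrightarrow> code x = code y \<Longrightarrow> \<omega> x y \<le> e1"
    and G: "\<And>z j x y. z \<in> Z \<Longrightarrow> x \<in> X \<Longrightarrow> y \<in> X \<Longrightarrow> \<bar>G z j x - G z j y\<bar> \<le> c * \<omega> x y" "0 \<le> c"
    and fG: "\<And>z x n. z \<in> Z \<Longrightarrow> x \<in> X \<Longrightarrow> n \<in> C \<Longrightarrow> \<theta> n x = 1 \<Longrightarrow>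
        f z x = G z (- box_corner N n) (T (box_corner N n) x)"
    and b1: "\<And>x. x \<in> X \<Longrightarrow> card ((\<lambda>z. fst z + box_corner N (snd z)) `
        {z \<in> cube L \<times> C. \<theta> (snd z) (T (fst z) x) = 1}) \<le> b1"
    and b2: "\<And>x. x \<in> X \<Longrightarrow> card {p \<in> cube L. \<not> (\<exists>n\<in>C. \<theta> n (T p x) = 1)} \<le> b2"
    and e: "c * e1 < e" "1 / real q < e"
  shows "cover_num X (dyn L (\<lambda>x y. Max ((\<lambda>z. \<bar>f z x - f z y\<bar>) ` Z))) e
    \<le> 2 ^ (L ^ CARD('k) * card C) * card K ^ b1 * (2 * q * B + 1) ^ (b2 * card Z)"
proof -
  define \<rho> where "\<rho> = (\<lambda>x y. Max ((\<lambda>z. \<bar>f z x - f z y\<bar>) ` Z))"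
  have cube: "finite (cube L :: (int^'k) set)" "(cube L :: (int^'k) set) \<noteq> {}"
    by (rule finite_cube, rule cube_nonempty[OF LNq(1)])
  have pm: "cont_pseudometric X (dyn L \<rho>)"
    unfolding \<rho>_def by (intro cont_pseudometric_dyn cont_pseudometric_Max_abs Z f cube)
  define Good where "Good x = {z \<in> cube L \<times> C. \<theta> (snd z) (T (fst z) x) = 1}" for x
  define Bs where "Bs g = (\<lambda>z. fst z + box_corner N (snd z)) ` g" for g :: "((int^'k) \<times> (int^'k)) set"
  define Bad where "Bad g = cube L - fst ` g" for g :: "((int^'k) \<times> (int^'k)) set"
  \<comment> \<open>The shift by \<open>B\<close> makes the values nonnegative, so
    \<open>nat\<close> loses nothing and \<open>2 * q * B + 1\<close> rounded values occur at
    most.\<close>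
  define cd where "cd x = (Good x, restrict (\<lambda>b. code (T b x)) (Bs (Good x)),
      restrict (\<lambda>w. nat \<lfloor>real q * (f (snd w) (T (fst w) x) + real B)\<rfloor>) (Bad (Good x) \<times> Z))" for x
  define W where "W = Sigma (Good ` X) (\<lambda>g. (Bs g \<rightarrow>\<^sub>E K) \<times> ((Bad g \<times> Z) \<rightarrow>\<^sub>E {..2 * q * B}))"
  have GX: "Good ` X \<subseteq> Pow (cube L \<times> C)" by (auto simp: Good_def)
  have finG: "finite (Good ` X)" using finite_subset[OF GX] cube(1) C by simp
  have fing: "finite g" if "g \<in> Good ` X" for g using that GX cube(1) C finite_subset by blast
  have finB: "finite (Bs g)" "finite (Bad g)" if "g \<in> Good ` X" for g
    using fing[OF that] cube(1) by (auto simp: Bs_def Bad_def)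
  have Kne: "1 \<le> card K" using K(1,2) nonempty by (metis One_nat_def Suc_leI card_gt_0_iff image_is_empty subset_empty)
  have finW: "finite W"
    unfolding W_def using finG finB K(1) Z(1) by (intro finite_SigmaI finite_cartesian_product finite_PiE) auto
  have cdW: "cd ` X \<subseteq> W"
  proof (rule image_subsetI)
    fix x assume x: "x \<in> X"
    have "restrict (\<lambda>b. code (T b x)) (Bs (Good x)) \<in> Bs (Good x) \<rightarrow>\<^sub>E K"
      unfolding restrict_PiE_iff using K(2) T_in[OF x] by blast
    moreover have "restrict (\<lambda>w. nat \<lfloor>real q * (f (snd w) (T (fst w) x) + real B)\<rfloor>) (Bad (Good x) \<times> Z)
        \<in> (Bad (Good x) \<times> Z) \<rightarrow>\<^sub>E {..2 * q * B}"
      unfolding restrict_PiE_iff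
    proof
      fix w assume w: "w \<in> Bad (Good x) \<times> Z"
      have "real q * (f (snd w) (T (fst w) x) + real B) \<le> real q * (2 * real B)"
        using f(2)[of "snd w" "T (fst w) x"] w T_in[OF x] by (intro mult_left_mono) fastforce+
      also have "\<dots> = real_of_int (int (2 * q * B))" by simp
      finally have "\<lfloor>real q * (f (snd w) (T (fst w) x) + real B)\<rfloor> \<le> int (2 * q * B)" by linarith
      then show "nat \<lfloor>real q * (f (snd w) (T (fst w) x) + real B)\<rfloor> \<in> {..2 * q * B}" by (simp add: nat_le_iff)
    qed
    ultimately show "cd x \<in> W" using x by (simp add: W_def cd_def)
  qed
  have same: "dyn L \<rho> x y \<le> max (c * e1) (1 / real q)"
    if xy: "x \<in> X" "y \<in> X" and eq: "cd x = cd y" for x y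
    unfolding dyn_metric_le_iff[OF cube]
  proof
    fix p :: "int^'k" assume p: "p \<in> cube L"
    have Txy: "T a x \<in> X" "T a y \<in> X" for a using xy T_in by auto
    have g: "Good y = Good x" using eq by (simp add: cd_def)
    have cb: "code (T b x) = code (T b y)" if "b \<in> Bs (Good x)" for b
    proof -
      have "restrict (\<lambda>b. code (T b x)) (Bs (Good x)) = restrict (\<lambda>b. code (T b y)) (Bs (Good x))"
        using eq unfolding cd_def prod.inject g by blast
      then show ?thesis using that by (metis restrict_apply')
    qed
    have cf: "nat \<lfloor>real q * (f z (T p x) + real B)\<rfloor> = nat \<lfloor>real q * (f z (T p y) + real B)\<rfloor>"
      if "p \<in> Bad (Good x)" "z \<in> Z" for z
    proof -
      have "restrict (\<lambda>w. nat \<lfloor>real q * (f (snd w) (T (fst w) x) + real B)\<rfloor>) (Bad (Good x) \<times> Z)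
        = restrict (\<lambda>w. nat \<lfloor>real q * (f (snd w) (T (fst w) y) + real B)\<rfloor>) (Bad (Good x) \<times> Z)"
        using eq unfolding cd_def prod.inject g by blast
      from fun_cong[OF this, of "(p, z)"] show ?thesis using that by simp
    qed
    have "\<bar>f z (T p x) - f z (T p y)\<bar> \<le> max (c * e1) (1 / real q)" if z: "z \<in> Z" for z
    proof (cases "p \<in> Bad (Good x)")
      case True
      have "\<bar>(f z (T p x) + real B) - (f z (T p y) + real B)\<bar> \<le> 1 / real q"
        using f(2)[OF z Txy(1)[of p]] f(2)[OF z Txy(2)[of p]]
        by (intro floor_eq_imp_close[OF cf[OF True z] _ _ LNq(2)]) linarith+
      then show ?thesis by simp
    next
      case False
      then obtain n where n: "(p, n) \<in> Good x" using p by (force simp: Bad_def)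
      then have "(p, n) \<in> Good y" using g by simp
      with n have nC: "n \<in> C" "\<theta> n (T p x) = 1" "\<theta> n (T p y) = 1" by (auto simp: Good_def)
      \<comment> \<open>The site \<open>p\<close> has offset \<open>- box_corner N n\<close> in its
        box, so its value is read off at the corner.\<close>
      have b: "p + box_corner N n \<in> Bs (Good x)" unfolding Bs_def using n by force
      have "f z (T p x) = G z (- box_corner N n) (T (p + box_corner N n) x)"
        "f z (T p y) = G z (- box_corner N n) (T (p + box_corner N n) y)"
        using fG[OF z Txy(1) nC(1,2)] fG[OF z Txy(2) nC(1,3)] xy by (simp_all add: T_add add.commute)
      then have "\<bar>f z (T p x) - f z (T p y)\<bar> \<le> c * \<omega> (T (p + box_corner N n) x) (T (p + box_corner N n) y)"
        using G(1)[OF z Txy] by simp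
      also have "\<dots> \<le> c * e1" using K(3)[OF Txy cb[OF b]] G(2) by (rule mult_left_mono)
      finally show ?thesis by simp
    qed
    then show "\<rho> (T p x) (T p y) \<le> max (c * e1) (1 / real q)" unfolding \<rho>_def using Z by simp
  qed
  have lt: "max (c * e1) (1 / real q) < e" using e by simp
  have nn: "0 \<le> max (c * e1) (1 / real q)" by (simp add: le_max_iff_disj)
  have "cover_num X (dyn L \<rho>) e \<le> card (cd ` X)"
    by (rule cover_num_le_code[OF compact_X pm lt nn finite_subset[OF cdW finW] same])
  also have "\<dots> \<le> card W" using finW cdW by (rule card_mono)
  also have "\<dots> = (\<Sum>g\<in>Good ` X. card ((Bs g \<rightarrow>\<^sub>E K) \<times> ((Bad g \<times> Z) \<rightarrow>\<^sub>E {..2 * q * B})))"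
    unfolding W_def using finG finB K(1) Z(1) by (intro card_SigmaI) (auto intro!: finite_cartesian_product finite_PiE)
  also have "\<dots> \<le> (\<Sum>g\<in>Good ` X. card K ^ b1 * (2 * q * B + 1) ^ (b2 * card Z))"
  proof (rule sum_mono)
    fix g assume g: "g \<in> Good ` X"
    then obtain x where x: "x \<in> X" "g = Good x" by blast
    have 1: "card (Bs g) \<le> b1" using b1[OF x(1)] by (simp add: x(2) Bs_def Good_def)
    have "Bad g = {p \<in> cube L. \<not> (\<exists>n\<in>C. \<theta> n (T p x) = 1)}" by (force simp: Bad_def x(2) Good_def)
    then have 2: "card (Bad g) \<le> b2" using b2[OF x(1)] by simp
    have "card ((Bs g \<rightarrow>\<^sub>E K) \<times> ((Bad g \<times> Z) \<rightarrow>\<^sub>E {..2 * q * B}))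
        = card K ^ card (Bs g) * (2 * q * B + 1) ^ (card (Bad g) * card Z)"
      using finB[OF g] Z(1) by (simp add: card_cartesian_product card_PiE)
    also have "\<dots> \<le> card K ^ b1 * (2 * q * B + 1) ^ (b2 * card Z)"
      using 1 2 Kne by (intro mult_le_mono power_increasing) auto
    finally show "card ((Bs g \<rightarrow>\<^sub>E K) \<times> ((Bad g \<times> Z) \<rightarrow>\<^sub>E {..2 * q * B}))
      \<le> card K ^ b1 * (2 * q * B + 1) ^ (b2 * card Z)" .
  qed
  also have "\<dots> = card (Good ` X) * (card K ^ b1 * (2 * q * B + 1) ^ (b2 * card Z))" by simp
  also have "\<dots> \<le> 2 ^ (L ^ CARD('k) * card C) * (card K ^ b1 * (2 * q * B + 1) ^ (b2 * card Z))"
  proof (rule mult_le_mono1)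
    have "card (Good ` X) \<le> card (Pow ((cube L :: (int^'k) set) \<times> C))" by (rule card_mono[OF _ GX]) (use cube(1) C in simp)
    also have "\<dots> = 2 ^ (L ^ CARD('k) * card C)"
      using cube(1) C by (simp add: card_Pow card_cartesian_product card_cube)
    finally show "card (Good ` X) \<le> 2 ^ (L ^ CARD('k) * card C)" .
  qed
  finally show ?thesis by (simp add: \<rho>_def mult.assoc)
qed

end

text \<open>The bracket is free of \<open>q\<close>, so for large \<open>q\<close> only
  \<open>a + b\<close> matters: \<open>a\<close> bounds the dimension of complexes used per site,
  \<open>b\<close> the number of reals stored per site.\<close>

lemma log_count_estimate:
  fixes M l C K b1 q B b2 m P n :: nat and a b :: real
  assumes M: "1 \<le> M" "M \<le> 2 ^ (l * C) * K ^ b1 * (2 * q * B + 1) ^ (b2 * m)" and K: "K \<le> 2 ^ P * (q + 1) ^ n"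
    and l: "1 \<le> l" and q: "1 \<le> q" and a: "real (b1 * n) \<le> a * real l" and b: "real (b2 * m) \<le> b * real l"
  shows "ln (real M) / real l
    \<le> (real C * ln 2 + real (b1 * P) * ln 2 / real l + a * ln 2 + b * ln (2 * real B + 1)) + (a + b) * ln (real q)"
proof -
  have l0: "0 < real l" using l by simp
  have "K ^ b1 \<le> (2 ^ P * (q + 1) ^ n) ^ b1" using K by (rule power_mono) simp
  then have "M \<le> 2 ^ (l * C) * (2 ^ P * (q + 1) ^ n) ^ b1 * (2 * q * B + 1) ^ (b2 * m)"
    using M(2) by (meson le_trans mult_le_mono1 mult_le_mono2)
  then have "real M \<le> real (2 ^ (l * C) * (2 ^ P * (q + 1) ^ n) ^ b1 * (2 * q * B + 1) ^ (b2 * m))"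
    by (rule of_nat_mono)
  then have "real M \<le> 2 ^ (l * C) * (2 ^ P * (real q + 1) ^ n) ^ b1 * (2 * real q * real B + 1) ^ (b2 * m)"
    by (simp add: algebra_simps)
  then have "ln (real M) \<le> ln (2 ^ (l * C) * (2 ^ P * (real q + 1) ^ n) ^ b1 * (2 * real q * real B + 1) ^ (b2 * m))"
    using M(1) by (intro ln_mono) auto
  also have "\<dots> = real (l * C) * ln 2 + real b1 * (real P * ln 2 + real n * ln (real q + 1))
      + real (b2 * m) * ln (2 * real q * real B + 1)"
  proof -
    have "0 < 2 * real q * real B + 1" by (simp add: add_nonneg_pos)
    then show ?thesis by (simp add: ln_mult ln_realpow)
  qed
  also have "\<dots> = real l * (real C * ln 2) + real (b1 * P) * ln 2 + real (b1 * n) * ln (real q + 1)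
      + real (b2 * m) * ln (2 * real q * real B + 1)"
    by (simp add: algebra_simps)
  also have "real (b1 * n) * ln (real q + 1) \<le> (a * real l) * (ln (real q) + ln 2)"
  proof (rule mult_mono[OF a])
    have "ln (real q + 1) \<le> ln (real q * 2)" using q by (intro ln_mono) auto
    then show "ln (real q + 1) \<le> ln (real q) + ln 2" using q by (simp add: ln_mult)
    show "0 \<le> a * real l" using a of_nat_0_le_iff order_trans by blast
  qed simp
  also have "real (b2 * m) * ln (2 * real q * real B + 1) \<le> (b * real l) * (ln (real q) + ln (2 * real B + 1))"
  proof (rule mult_mono[OF b])
    have p: "0 < 2 * real q * real B + 1" "0 < 2 * real B + 1" by (simp_all add: add_nonneg_pos)
    have "2 * real q * real B + 1 \<le> real q * (2 * real B + 1)" using q by (simp add: algebra_simps)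
    then have "ln (2 * real q * real B + 1) \<le> ln (real q * (2 * real B + 1))" using p by (intro ln_mono) auto
    then show "ln (2 * real q * real B + 1) \<le> ln (real q) + ln (2 * real B + 1)" using q p by (simp add: ln_mult)
    show "0 \<le> b * real l" using b of_nat_0_le_iff order_trans by blast
    show "0 \<le> ln (2 * real q * real B + 1)" by simp
  qed
  finally have "ln (real M) \<le> real l * (real C * ln 2) + real (b1 * P) * ln 2
      + (a * real l) * (ln (real q) + ln 2) + (b * real l) * (ln (real q) + ln (2 * real B + 1))"
    by simp
  then have "ln (real M) / real l \<le> (real l * (real C * ln 2) + real (b1 * P) * ln 2
      + (a * real l) * (ln (real q) + ln 2) + (b * real l) * (ln (real q) + ln (2 * real B + 1))) / real l"
    using l0 by (intro divide_right_mono) auto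
  also have "\<dots> = real C * ln 2 + real (b1 * P) * ln 2 / real l
      + a * (ln (real q) + ln 2) + b * (ln (real q) + ln (2 * real B + 1))"
    using l0 by (simp add: add_divide_distrib)
  finally show ?thesis by (simp add: algebra_simps)
qed

section \<open>One approximation step\<close>

context Zk_action
begin

text \<open>The scale is not prescribed, only bounded by \<open>\<epsilon>0\<close>: it is
  proportional to \<open>1 / q\<close>, and \<open>q\<close> must be large in terms of all other
  choices. Bounding the covers already at \<open>\<epsilon> / 4\<close> leaves room for later
  changes of the metric.\<close>

lemma pseudometric_perturbation:
  assumes marker: "marker_property X T" and \<sigma>: "cont_pseudometric X \<sigma>"
    and rate: "\<And>\<delta>. \<delta> > 0 \<Longrightarrow> widim_rate \<delta> \<le> D" and D: "0 \<le> D"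
    and \<tau>: "\<tau> > 0" and \<eta>: "\<eta> > 0" and \<epsilon>0: "\<epsilon>0 > 0"
  obtains \<rho> \<epsilon> L where "cont_pseudometric X \<rho>" "\<And>x y. x \<in> X \<Longrightarrow> y \<in> X \<Longrightarrow> \<bar>\<rho> x y - \<sigma> x y\<bar> \<le> \<tau>"
    "0 < \<epsilon>" "\<epsilon> < \<epsilon>0" "\<epsilon> < 1" "(1::nat) \<le> L"
    "cover_avg \<rho> (\<epsilon> / 4) L \<le> (D + \<eta>) * \<bar>ln \<epsilon>\<bar>"
proof -
  define k where "k = CARD('k)"
  \<comment> \<open>Four errors of size \<open>s\<close> occur: two from replacing \<open>f\<close>
    by \<open>g\<close> at both points, two from the net.\<close>
  define s where "s = \<tau> / 4"
  have s: "s > 0" using \<tau> by (simp add: s_def)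
  obtain Z where Z: "finite Z" "Z \<subseteq> X" "\<And>x. x \<in> X \<Longrightarrow> \<exists>z\<in>Z. \<sigma> x z < s"
    using cont_pseudometric_net[OF compact_X \<sigma> s] by metis
  have Zne: "Z \<noteq> {}" using Z(3) nonempty by blast
  define m where "m = card Z"
  \<comment> \<open>A Kuratowski embedding along the net: the maximum over \<open>z\<close> of
    \<open>\<bar>f z x - f z y\<bar>\<close> differs from \<open>\<sigma> x y\<close> by at most
    \<open>2 * s\<close>.\<close>
  define f where "f z x = \<sigma> x z" for z x
  have fc: "continuous_on X (f z)" if "z \<in> Z" for z
    unfolding f_def using that Z(2) by (intro cont_pseudometric_compose[OF \<sigma>] continuous_intros) auto
  obtain B0 where B0: "B0 > 0" "\<And>x y. x \<in> X \<Longrightarrow> y \<in> X \<Longrightarrow> \<sigma> x y \<le> B0"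
    using cont_pseudometric_bounded[OF compact_X \<sigma>] by metis
  have f0: "0 \<le> f z x \<and> f z x \<le> B0" if "z \<in> Z" "x \<in> X" for z x
    using B0(2)[of x z] cont_pseudometric_nonneg[OF \<sigma>, of x z] that Z(2) by (auto simp: f_def)
  obtain \<delta> where \<delta>: "\<delta> > 0" "\<And>x y. x \<in> X \<Longrightarrow> y \<in> X \<Longrightarrow> dist x y < \<delta> \<Longrightarrow> \<sigma> x y < s"
    using cont_pseudometric_small[OF compact_X \<sigma> s] by metis
  \<comment> \<open>The slack \<open>\<eta>/8\<close> grows to \<open>\<eta>/4\<close> through boxes
    at the boundary of the large cube; the bad sites take another \<open>\<eta>/4\<close> and the
    constants the remaining \<open>\<eta>/2\<close>.\<close>
  have "widim_rate \<delta> < D + \<eta>/8" using rate[OF \<delta>(1)] \<eta> by linarith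
  then obtain N where N: "N \<ge> 1" "real (widim X (dyn N dist) \<delta>) / real N ^ k < D + \<eta>/8"
    unfolding k_def by (rule widim_rate_less)
  define n where "n = widim X (dyn N dist) \<delta>"
  have cubeN: "finite (cube N :: (int^'k) set)" "(cube N :: (int^'k) set) \<noteq> {}"
    by (rule finite_cube, rule cube_nonempty[OF N(1)])
  note pmN = cont_pseudometric_dyn[OF cont_pseudometric_dist cubeN]
  obtain P tt where tt: "small_param X (dyn N dist) \<delta> n P tt"
    using small_map_widim[OF compact_X pmN \<delta>(1) nonempty] unfolding small_map_def n_def by blast
  note ttD = small_paramD[OF tt]
  define \<omega> where "\<omega> x y = (\<Sum>i<P. \<bar>tt i x - tt i y\<bar>)" for x y
  have \<omega>: "cont_pseudometric X \<omega>"
    unfolding \<omega>_def by (rule cont_pseudometric_sum_abs) (auto intro: ttD(1))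
  have zero: "dyn N dist x y < \<delta>" if "x \<in> X" "y \<in> X" "\<omega> x y = 0" for x y
  proof (rule ttD(5)[OF that(1,2)])
    fix i assume "i < P"
    moreover have "\<forall>i\<in>{..<P}. \<bar>tt i x - tt i y\<bar> = 0"
      using that(3) unfolding \<omega>_def by (subst (asm) sum_nonneg_eq_0_iff) auto
    ultimately show "tt i x = tt i y" by simp
  qed
  have "\<exists>\<kappa>>0. \<forall>x\<in>X. \<forall>y\<in>X. \<omega> x y < \<kappa> \<longrightarrow> dyn N dist x y < \<delta>"
    by (rule cont_pseudometric_dominates[OF compact_X \<omega> pmN zero]) blast+
  then obtain \<kappa> where \<kappa>: "\<kappa> > 0"
    "\<And>x y. x \<in> X \<Longrightarrow> y \<in> X \<Longrightarrow> \<omega> x y < \<kappa> \<Longrightarrow> dyn N dist x y < \<delta>"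
    by blast
  \<comment> \<open>The slope for which the penalty at \<open>\<omega>\<close>-distance
    \<open>\<kappa>\<close> reaches the bound \<open>B0\<close> on \<open>f\<close>.\<close>
  define c where "c = B0 / \<kappa>"
  have c: "0 \<le> c" "B0 \<le> c * \<kappa>" using B0(1) \<kappa>(1) by (auto simp: c_def)
  \<comment> \<open>\<open>G z j\<close> predicts \<open>f z\<close> at the site with offset
    \<open>j\<close> from the barycentric coordinates at the corner alone, being Lipschitz for
    \<open>\<omega>\<close>.\<close>
  define G where "G z j = mcshane X (\<lambda>y. f z (T j y)) c \<omega>" for z j
  have GL: "\<bar>G z j x - G z j y\<bar> \<le> c * \<omega> x y" if "z \<in> Z" "x \<in> X" "y \<in> X" for z j x y
    unfolding G_def using f0[OF that(1)] T_in that by (intro mcshane_Lipschitz \<omega> c) auto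
  have Gc: "continuous_on X (G z j)" if "z \<in> Z" for z j
    using GL[OF that] by (intro continuous_on_pseudo_Lipschitz[OF compact_X \<omega> c(1)]) auto
  have Gf: "\<bar>G z j x - f z (T j x)\<bar> \<le> s" if z: "z \<in> Z" and j: "j \<in> cube N" and x: "x \<in> X" for z j x
    unfolding G_def
  proof (rule mcshane_close[OF _ \<omega> c(1) x _ c(2)])
    show "0 \<le> f z (T j y) \<and> f z (T j y) \<le> B0" if "y \<in> X" for y using f0[OF z T_in[OF that]] .
    show "0 \<le> s" using s by simp
    fix y assume y: "y \<in> X" "\<omega> x y < \<kappa>"
    have "dist (T j x) (T j y) < \<delta>"
      using \<kappa>(2)[OF x y] dyn_metric_ge[OF cubeN(1) j, where D = dist] by (rule le_less_trans[rotated])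
    then have "\<sigma> (T j x) (T j y) < s" using \<delta>(2) T_in x y(1) by blast
    moreover have "\<sigma> (T j x) z \<le> \<sigma> (T j x) (T j y) + \<sigma> (T j y) z"
      using z Z(2) by (intro cont_pseudometricD(4)[OF \<sigma>] T_in x y(1)) auto
    ultimately show "f z (T j x) \<le> f z (T j y) + s" by (simp add: f_def)
  qed
  \<comment> \<open>Every bad site stores \<open>m\<close> reals at a cost of about
    \<open>ln q\<close> each, so the bad fraction, near \<open>1 - t ^ k\<close>, must be small
    against \<open>1 / m\<close>.\<close>
  have "\<exists>t. 0 < t \<and> t < 1 \<and> (1 - t ^ k) * real m < \<eta>/8"
  proof -
    have "((\<lambda>t. (1 - t ^ k) * real m) \<longlongrightarrow> (1 - 1 ^ k) * real m) (at_left 1)"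
      by (intro tendsto_intros)
    then have "\<forall>\<^sub>F t in at_left 1. (1 - t ^ k) * real m < \<eta>/8"
      using \<eta> by (intro order_tendstoD(2)) auto
    moreover have "\<forall>\<^sub>F t in at_left (1::real). 0 < t \<and> t < 1"
      unfolding eventually_at_left_field by (intro exI[of _ 0]) auto
    ultimately have "\<forall>\<^sub>F t in at_left (1::real). 0 < t \<and> t < 1 \<and> (1 - t ^ k) * real m < \<eta>/8"
      by eventually_elim simp
    then show ?thesis using eventually_happens'[of "at_left (1::real)"] by simp
  qed
  then obtain t where t: "0 < t" "t < 1" "(1 - t ^ k) * real m < \<eta>/8" by blast
  show ?thesis
  proof (rule tiling_functions[OF marker t(1,2), of N])
    fix C :: "(int^'k) set" and \<theta> :: "int^'k \<Rightarrow> 'a \<Rightarrow> real" and R :: real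
    assume C: "finite C" and R: "R > 0" and \<theta>c: "\<And>n. continuous_on X (\<theta> n)"
      and \<theta>01: "\<And>n x. x \<in> X \<Longrightarrow> 0 \<le> \<theta> n x \<and> \<theta> n x \<le> 1"
      and uniq: "\<And>x p p' n n'. x \<in> X \<Longrightarrow> n \<in> C \<Longrightarrow> n' \<in> C \<Longrightarrow> norm (rvec p - rvec p') \<le> 2 * real CARD('k) * real N \<Longrightarrow>
         0 < \<theta> n (T p x) \<Longrightarrow> 0 < \<theta> n' (T p' x) \<Longrightarrow> p + n = p' + n'"
      and dens: "\<And>x L. x \<in> X \<Longrightarrow> 2 * R \<le> real L \<Longrightarrow> t ^ CARD('k) * (real L - 2 * R) ^ CARD('k)
         \<le> real (card {p \<in> cube L. \<exists>n\<in>C. \<theta> n (T p x) = 1})"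
    \<comment> \<open>At most one \<open>\<theta> n\<close> with \<open>n \<in> C\<close> is
      positive at a point (uniqueness with \<open>p = p' = 0\<close>), so \<open>g z x\<close> lies
      between \<open>f z x\<close> and a single prediction, and equals the prediction where
      \<open>\<theta> n x = 1\<close>.\<close>
    define g where "g z x = f z x + (\<Sum>n\<in>C. \<theta> n x * (G z (- box_corner N n) (T (box_corner N n) x) - f z x))" for z x
    have Tc: "continuous_on X (\<lambda>x. G z j (T n x))" if "z \<in> Z" for z j n
      by (rule continuous_on_compose2[OF Gc[OF that] T_cont]) (auto simp: T_in)
    have gc: "continuous_on X (g z)" if "z \<in> Z" for z
      unfolding g_def using that
      by (intro continuous_on_add continuous_on_sum continuous_on_mult continuous_on_diff fc Tc \<theta>c)
    have single: "g z x = f z x + \<theta> n x * (G z (- box_corner N n) (T (box_corner N n) x) - f z x)"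
      if x: "x \<in> X" and n: "n \<in> C" "0 < \<theta> n x" for z x n
    proof -
      have "\<theta> n' x = 0" if "n' \<in> C - {n}" for n'
        using uniq[OF x n(1), of n' 0 0] that n(2) \<theta>01[OF x, of n'] x by (force simp: T_zero)
      then have "(\<Sum>n'\<in>C - {n}. \<theta> n' x * (G z (- box_corner N n') (T (box_corner N n') x) - f z x)) = 0"
        by (intro sum.neutral) auto
      then show ?thesis unfolding g_def using C n(1) by (simp add: sum.remove)
    qed
    have gf: "\<bar>g z x - f z x\<bar> \<le> s" if z: "z \<in> Z" and x: "x \<in> X" for z x
    proof (cases "\<exists>n\<in>C. 0 < \<theta> n x")
      case True
      then obtain n where n: "n \<in> C" "0 < \<theta> n x" by blast
      have "\<bar>G z (- box_corner N n) (T (box_corner N n) x) - f z x\<bar> \<le> s"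
        using Gf[OF z uminus_box_corner[OF N(1)] T_in[OF x], of n "box_corner N n"] x by (simp add: T_add T_zero)
      then have "\<theta> n x * \<bar>G z (- box_corner N n) (T (box_corner N n) x) - f z x\<bar> \<le> 1 * s"
        using \<theta>01[OF x, of n] by (intro mult_mono) auto
      then show ?thesis using single[OF x n, of z] n(2) by (simp add: abs_mult)
    next
      case False
      then have "\<theta> n x = 0" if "n \<in> C" for n using \<theta>01[OF x, of n] that by (force simp: not_less)
      then have "(\<Sum>n\<in>C. \<theta> n x * (G z (- box_corner N n) (T (box_corner N n) x) - f z x)) = 0"
        by (intro sum.neutral) auto
      then show ?thesis using s by (simp add: g_def)
    qed
    define \<rho> where "\<rho> = (\<lambda>x y. Max ((\<lambda>z. \<bar>g z x - g z y\<bar>) ` Z))"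
    have \<rho>: "cont_pseudometric X \<rho>" unfolding \<rho>_def by (rule cont_pseudometric_Max_abs[OF Z(1) Zne gc])
    have \<rho>\<sigma>: "\<bar>\<rho> x y - \<sigma> x y\<bar> \<le> \<tau>" if xy: "x \<in> X" "y \<in> X" for x y
    proof -
      have "\<bar>g z x - g z y\<bar> \<le> \<sigma> x y + \<tau>" if z: "z \<in> Z" for z
      proof -
        have "\<sigma> x z \<le> \<sigma> x y + \<sigma> y z" "\<sigma> y z \<le> \<sigma> y x + \<sigma> x z" "\<sigma> y x = \<sigma> x y"
          using z Z(2) xy by (auto intro!: cont_pseudometricD(3,4)[OF \<sigma>])
        then have "\<bar>f z x - f z y\<bar> \<le> \<sigma> x y" by (simp add: f_def)
        then show ?thesis using gf[OF z xy(1)] gf[OF z xy(2)] s unfolding s_def by linarith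
      qed
      then have "\<rho> x y \<le> \<sigma> x y + \<tau>" unfolding \<rho>_def using Z(1) Zne by simp
      moreover have "\<sigma> x y - \<tau> \<le> \<rho> x y"
      proof -
        obtain z where z: "z \<in> Z" "\<sigma> x z < s" using Z(3)[OF xy(1)] by blast
        have zX: "z \<in> X" using z(1) Z(2) by blast
        have "\<sigma> x y \<le> \<sigma> x z + \<sigma> z y" "\<sigma> z y = \<sigma> y z"
          using cont_pseudometricD(3,4)[OF \<sigma>] xy zX by blast+
        then have "\<sigma> x y - 2 * s \<le> f z y - f z x" using z(2) by (simp add: f_def)
        then have "\<sigma> x y - \<tau> \<le> \<bar>g z x - g z y\<bar>"
          using gf[OF z(1) xy(1)] gf[OF z(1) xy(2)] unfolding s_def by linarith
        also have "\<dots> \<le> \<rho> x y" unfolding \<rho>_def using Z(1) z(1) by (intro Max_ge) auto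
        finally show ?thesis .
      qed
      ultimately show ?thesis by linarith
    qed
    define B where "B = nat \<lceil>B0 + s\<rceil>"
    have gB: "\<bar>g z x\<bar> \<le> real B" if "z \<in> Z" "x \<in> X" for z x
    proof -
      have "\<bar>g z x\<bar> \<le> B0 + s" using gf[OF that] f0[OF that] by linarith
      also have "\<dots> \<le> real B" unfolding B_def by (rule real_nat_ceiling_ge)
      finally show ?thesis .
    qed
    have "\<forall>\<^sub>F L in sequentially. ((real L + 2 * real N) / real L) ^ k * (D + \<eta>/8) < D + \<eta>/4"
    proof (rule order_tendstoD(2))
      have "(\<lambda>L. (real L + 2 * real N) / real L) \<longlonglongrightarrow> 1" by real_asymp
      then show "(\<lambda>L. ((real L + 2 * real N) / real L) ^ k * (D + \<eta>/8)) \<longlonglongrightarrow> 1 ^ k * (D + \<eta>/8)"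
        by (intro tendsto_intros)
    qed (use \<eta> in simp)
    moreover have "\<forall>\<^sub>F L in sequentially. (1 - t ^ k * ((real L - 2 * R) / real L) ^ k) * real m < \<eta>/4"
    proof (rule order_tendstoD(2))
      have "(\<lambda>L. (real L - 2 * R) / real L) \<longlonglongrightarrow> 1" by real_asymp
      then show "(\<lambda>L. (1 - t ^ k * ((real L - 2 * R) / real L) ^ k) * real m) \<longlonglongrightarrow> (1 - t ^ k * 1 ^ k) * real m"
        by (intro tendsto_intros)
    qed (use \<eta> t(3) in simp)
    moreover have "\<forall>\<^sub>F L in sequentially. 1 \<le> L \<and> 2 * R \<le> real L"
      using eventually_ge_at_top[of 1] filterlim_real_sequentially[unfolded filterlim_at_top, rule_format, of "2 * R"]
      by eventually_elim simp
    ultimately have "\<forall>\<^sub>F L in sequentially. ((real L + 2 * real N) / real L) ^ k * (D + \<eta>/8) < D + \<eta>/4 \<and>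
        (1 - t ^ k * ((real L - 2 * R) / real L) ^ k) * real m < \<eta>/4 \<and> 1 \<le> L \<and> 2 * R \<le> real L"
      by eventually_elim simp
    then obtain L where L: "((real L + 2 * real N) / real L) ^ k * (D + \<eta>/8) < D + \<eta>/4"
      "(1 - t ^ k * ((real L - 2 * R) / real L) ^ k) * real m < \<eta>/4" "1 \<le> L" "2 * R \<le> real L"
      using eventually_happens'[OF sequentially_bot] by blast
    have L0: "0 < real L ^ k" using L(3) by simp
    \<comment> \<open>\<open>b1\<close> bounds the number of boxes used by the cube and
      \<open>b2\<close> the number of its bad sites, uniformly in the point.\<close>
    define b1 where "b1 = (L + 2 * N) ^ k div N ^ k"
    define b2 where "b2 = nat \<lfloor>real L ^ k - t ^ k * (real L - 2 * R) ^ k\<rfloor>"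
    have tle: "t ^ k * (real L - 2 * R) ^ k \<le> real L ^ k"
    proof -
      have "t ^ k * (real L - 2 * R) ^ k \<le> 1 * real L ^ k"
        using t R L(4) by (intro mult_mono power_mono power_le_one) auto
      then show ?thesis by simp
    qed
    have b1: "card ((\<lambda>z. fst z + box_corner N (snd z)) ` {z \<in> cube L \<times> C. \<theta> (snd z) (T (fst z) x) = 1}) \<le> b1"
      if x: "x \<in> X" for x
    proof -
      have "card ((\<lambda>z. fst z + box_corner N (snd z)) ` {z \<in> cube L \<times> C. \<theta> (snd z) (T (fst z) x) = 1}) * N ^ k
          \<le> (L + 2 * N) ^ k"
        unfolding k_def
      proof (rule box_count[OF N(1)])
        show "fst ` {z \<in> cube L \<times> C. \<theta> (snd z) (T (fst z) x) = 1} \<subseteq> cube L" by auto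
        show "finite {z \<in> cube L \<times> C. \<theta> (snd z) (T (fst z) x) = 1}"
          by (rule finite_subset[of _ "cube L \<times> C"]) (auto simp: finite_cube C)
        fix p n p' n'
        assume "(p, n) \<in> {z \<in> cube L \<times> C. \<theta> (snd z) (T (fst z) x) = 1}"
          "(p', n') \<in> {z \<in> cube L \<times> C. \<theta> (snd z) (T (fst z) x) = 1}"
          "norm (rvec p - rvec p') \<le> 2 * real CARD('k) * real N"
        then show "p + n = p' + n'" by (intro uniq[OF x]) auto
      qed
      then show ?thesis unfolding b1_def using N(1) by (simp add: less_eq_div_iff_mult_less_eq)
    qed
    have b2: "card {p \<in> cube L. \<not> (\<exists>n\<in>C. \<theta> n (T p x) = 1)} \<le> b2" if x: "x \<in> X" for x
    proof -
      define Y where "Y = {p \<in> cube L. \<exists>n\<in>C. \<theta> n (T p x) = 1}"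
      have "{p \<in> cube L. \<not> (\<exists>n\<in>C. \<theta> n (T p x) = 1)} = cube L - Y" "Y \<subseteq> cube L" by (auto simp: Y_def)
      then have "real (card {p \<in> cube L. \<not> (\<exists>n\<in>C. \<theta> n (T p x) = 1)}) = real L ^ k - real (card Y)"
        using card_mono[OF finite_cube, of Y L] finite_subset[OF _ finite_cube, of Y L]
        by (simp add: card_Diff_subset card_cube of_nat_diff k_def)
      also have "\<dots> \<le> real L ^ k - t ^ k * (real L - 2 * R) ^ k"
        using dens[OF x L(4)] by (simp add: k_def Y_def)
      finally show ?thesis unfolding b2_def by linarith
    qed
    have a1: "real (b1 * n) \<le> (D + \<eta>/4) * real (L ^ k)"
    proof -
      have "real b1 \<le> real ((L + 2 * N) ^ k) / real (N ^ k)"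
        unfolding b1_def by (rule of_nat_div_le_of_nat)
      then have "real b1 * real n \<le> (real ((L + 2 * N) ^ k) / real (N ^ k)) * real n" by (rule mult_right_mono) simp
      also have "\<dots> = (real L + 2 * real N) ^ k * (real n / real N ^ k)" by simp
      also have "\<dots> \<le> (real L + 2 * real N) ^ k * (D + \<eta>/8)"
        using N(2) by (intro mult_left_mono) (auto simp: n_def)
      also have "\<dots> = ((real L + 2 * real N) / real L) ^ k * (D + \<eta>/8) * real L ^ k"
        using L0 by (simp add: power_divide)
      also have "\<dots> \<le> (D + \<eta>/4) * real L ^ k" using L(1) L0 by (intro mult_right_mono) auto
      finally show ?thesis by simp
    qed
    have a2: "real (b2 * m) \<le> (\<eta>/4) * real (L ^ k)"
    proof -
      have "real b2 \<le> real L ^ k - t ^ k * (real L - 2 * R) ^ k" unfolding b2_def using tle by linarith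
      then have "real b2 * real m \<le> (real L ^ k - t ^ k * (real L - 2 * R) ^ k) * real m" by (rule mult_right_mono) simp
      also have "\<dots> = (1 - t ^ k * ((real L - 2 * R) / real L) ^ k) * real m * real L ^ k"
        using L0 by (simp add: power_divide field_simps)
      also have "\<dots> \<le> (\<eta>/4) * real L ^ k" using L(2) L0 by (intro mult_right_mono) auto
      finally show ?thesis by simp
    qed
    \<comment> \<open>Equal codes determine \<open>\<rho>\<close> along the cube up to
      \<open>A / q\<close>: slope \<open>c\<close> times the rounding error \<open>2 * n / q\<close>
      in a box, or \<open>1 / q\<close> at a bad site. With \<open>\<epsilon> = 5 * A / q\<close>
      this is strictly below \<open>\<epsilon> / 4\<close>.\<close>
    define A where "A = 2 * c * real n + 1"
    have A: "A \<ge> 1" using c(1) by (simp add: A_def)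
    define c0 where "c0 = real (card C) * ln 2 + real (b1 * P) * ln 2 / real (L ^ k) + (D + \<eta>/4) * ln 2
        + (\<eta>/4) * ln (2 * real B + 1)"
    \<comment> \<open>Three demands on \<open>ln q\<close>: positivity rules out
      \<open>q = 0\<close>, where \<open>ln\<close> has the default value 0; the second entry lets
      \<open>\<eta>/2\<close> absorb all constants; the third makes \<open>\<epsilon>\<close>
      smaller than 1 and \<open>\<epsilon>0\<close>.\<close>
    define u where "u = max 1 (max ((c0 + (D + \<eta>) * ln (5 * A)) / (\<eta>/2)) (ln (5 * A / min 1 \<epsilon>0)))"
    have "\<forall>\<^sub>F q in sequentially. u + 1 \<le> ln (real q)"
    proof -
      have "filterlim (\<lambda>q::nat. ln (real q)) at_top sequentially" by real_asymp
      then show ?thesis unfolding filterlim_at_top by blast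
    qed
    then obtain q where q: "u + 1 \<le> ln (real q)" using eventually_happens'[OF sequentially_bot] by blast
    have q1: "1 \<le> q"
    proof (rule ccontr)
      assume "\<not> 1 \<le> q"
      then have "q = 0" by simp
      then show False using q by (simp add: u_def)
    qed
    define \<epsilon> where "\<epsilon> = 5 * A / real q"
    have ln\<epsilon>: "ln \<epsilon> = ln (5 * A) - ln (real q)" unfolding \<epsilon>_def using A q1 by (simp add: ln_div)
    have \<epsilon>: "0 < \<epsilon>" "\<epsilon> < min 1 \<epsilon>0"
    proof -
      show "0 < \<epsilon>" using A q1 by (simp add: \<epsilon>_def)
      have "ln (5 * A / min 1 \<epsilon>0) < ln (real q)" using q unfolding u_def by linarith
      then have "5 * A / min 1 \<epsilon>0 < real q" using A q1 \<epsilon>0 by (subst (asm) ln_less_cancel_iff) auto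
      moreover have "0 < min 1 \<epsilon>0" "0 < real q" using \<epsilon>0 q1 by auto
      ultimately show "\<epsilon> < min 1 \<epsilon>0"
        unfolding \<epsilon>_def by (simp only: pos_divide_less_eq mult.commute)
    qed
    have "\<exists>(code :: 'a \<Rightarrow> nat set \<times> (nat \<Rightarrow> nat)) K. finite K \<and> card K \<le> 2 ^ P * (q + 1) ^ n \<and> code ` X \<subseteq> K \<and>
        (\<forall>x\<in>X. \<forall>y\<in>X. code x = code y \<longrightarrow> \<omega> x y \<le> 2 * real n / real q)"
      unfolding \<omega>_def by (rule simplex_code[OF tt q1]) blast
    then obtain code :: "'a \<Rightarrow> nat set \<times> (nat \<Rightarrow> nat)" and K where code: "finite K" "card K \<le> 2 ^ P * (q + 1) ^ n" "code ` X \<subseteq> K"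
      "\<And>x y. x \<in> X \<Longrightarrow> y \<in> X \<Longrightarrow> code x = code y \<Longrightarrow> \<omega> x y \<le> 2 * real n / real q"
      by blast
    have "cover_num X (dyn L \<rho>) (\<epsilon>/4)
        \<le> 2 ^ (L ^ k * card C) * card K ^ b1 * (2 * q * B + 1) ^ (b2 * m)"
      unfolding \<rho>_def k_def m_def
    proof (rule cover_num_coding[OF L(3) q1 C Z(1) Zne gc gB code(1,3,4) GL c(1) _ b1 b2])
      show "g z x = G z (- box_corner N n) (T (box_corner N n) x)" if "x \<in> X" "n \<in> C" "\<theta> n x = 1" for z x n
        using single[OF that(1,2), of z] that(3) by simp
      have "A / real q < \<epsilon>/4" unfolding \<epsilon>_def using A q1 by (simp add: field_simps)
      moreover have "c * (2 * real n / real q) \<le> A / real q"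
        unfolding A_def using q1 by (simp add: field_simps)
      moreover have "1 / real q \<le> A / real q" using A by (intro divide_right_mono) auto
      ultimately show "c * (2 * real n / real q) < \<epsilon>/4" "1 / real q < \<epsilon>/4" by linarith+
    qed
    moreover have "1 \<le> cover_num X (dyn L \<rho>) (\<epsilon>/4)"
      using \<epsilon>(1) by (intro cover_num_pos compact_X nonempty cont_pseudometric_dyn \<rho> finite_cube cube_nonempty L(3)) auto
    moreover have "1 \<le> L ^ k" using L(3) by simp
    ultimately have "ln (real (cover_num X (dyn L \<rho>) (\<epsilon>/4))) / real (L ^ k)
        \<le> c0 + ((D + \<eta>/4) + \<eta>/4) * ln (real q)"
      unfolding c0_def by (intro log_count_estimate[OF _ _ code(2) _ q1 a1 a2])
    also have "\<dots> \<le> (D + \<eta>) * (ln (real q) - ln (5 * A))"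
    proof -
      have "(c0 + (D + \<eta>) * ln (5 * A)) / (\<eta>/2) \<le> ln (real q)" using q unfolding u_def by linarith
      then have "c0 + (D + \<eta>) * ln (5 * A) \<le> ln (real q) * (\<eta>/2)" using \<eta> by (simp only: pos_divide_le_eq half_gt_zero)
      then show ?thesis by (simp add: algebra_simps)
    qed
    also have "ln (real q) - ln (5 * A) = \<bar>ln \<epsilon>\<bar>"
    proof -
      have "ln \<epsilon> < 0" using \<epsilon> by simp
      then show ?thesis using ln\<epsilon> by linarith
    qed
    finally have "ln (real (cover_num X (dyn L \<rho>) (\<epsilon>/4))) / real L ^ CARD('k) \<le> (D + \<eta>) * \<bar>ln \<epsilon>\<bar>"
      by (simp add: k_def)
    then show ?thesis using that[OF \<rho> \<rho>\<sigma> \<epsilon>(1) _ _ L(3)] \<epsilon>(2) by simp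
  qed
qed

end

section \<open>A metric realising the mean dimension\<close>

text \<open>On the compact set \<open>X\<close> either distance is uniformly small once the other
  is, by \<open>cont_pseudometric_small\<close> and \<open>separating_uniform\<close>.\<close>

lemma mtopology_eq_top_of_set:
  assumes "compact X" "cont_pseudometric X d" "\<And>x y. x \<in> X \<Longrightarrow> y \<in> X \<Longrightarrow> d x y = 0 \<Longrightarrow> x = y"
    and "Metric_space X d"
  shows "Metric_space.mtopology X d = top_of_set X"
proof -
  interpret M: Metric_space X d by fact
  have "openin M.mtopology U \<longleftrightarrow> openin (top_of_set X) U" for U
  proof (cases "U \<subseteq> X")
    case True
    have "(\<exists>r>0. M.mball x r \<subseteq> U) \<longleftrightarrow> (\<exists>e>0. \<forall>x'\<in>X. dist x' x < e \<longrightarrow> x' \<in> U)" if x: "x \<in> U" for x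
    proof
      assume "\<exists>r>0. M.mball x r \<subseteq> U"
      then obtain r where r: "r > 0" "M.mball x r \<subseteq> U" by blast
      obtain e where e: "e > 0" "\<And>x y. x \<in> X \<Longrightarrow> y \<in> X \<Longrightarrow> dist x y < e \<Longrightarrow> d x y < r"
        using cont_pseudometric_small[OF assms(1,2) r(1)] by metis
      have "x' \<in> U" if "x' \<in> X" "dist x' x < e" for x'
      proof -
        have "d x x' < r" using e(2)[of x x'] x True that by (auto simp: dist_commute)
        then have "x' \<in> M.mball x r" using x True that by auto
        then show ?thesis using r(2) by blast
      qed
      then show "\<exists>e>0. \<forall>x'\<in>X. dist x' x < e \<longrightarrow> x' \<in> U" using e(1) by blast
    next
      assume "\<exists>e>0. \<forall>x'\<in>X. dist x' x < e \<longrightarrow> x' \<in> U"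
      then obtain e where e: "e > 0" "\<And>x'. x' \<in> X \<Longrightarrow> dist x' x < e \<Longrightarrow> x' \<in> U" by blast
      have "\<exists>r>0. \<forall>a\<in>X. \<forall>b\<in>X. d a b < r \<longrightarrow> dist a b < e"
        by (rule separating_uniform[OF assms(1,2,3) e(1)]) blast+
      then obtain r where r: "r > 0" "\<And>a b. a \<in> X \<Longrightarrow> b \<in> X \<Longrightarrow> d a b < r \<Longrightarrow> dist a b < e" by blast
      have "M.mball x r \<subseteq> U"
      proof
        fix x' assume "x' \<in> M.mball x r"
        then have "x' \<in> X" "dist x x' < e" using r(2) by auto
        then show "x' \<in> U" using e(2) by (simp add: dist_commute)
      qed
      then show "\<exists>r>0. M.mball x r \<subseteq> U" using r(1) by blast
    qed
    then show ?thesis using True unfolding M.openin_mtopology openin_euclidean_subtopology_iff by blast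
  next
    case False
    then show ?thesis unfolding M.openin_mtopology openin_euclidean_subtopology_iff by blast
  qed
  then show ?thesis by (simp add: topology_eq)
qed

section \<open>The limit metric\<close>

context Zk_action
begin

text \<open>One scale below \<open>1 / (j + 1)\<close> is enough: for a lower limit only a sequence
  of good scales is needed.\<close>

definition small_cover_rate :: "real \<Rightarrow> nat \<Rightarrow> ('a \<Rightarrow> 'a \<Rightarrow> real) \<Rightarrow> bool" where
  "small_cover_rate D j d \<longleftrightarrow>
     (\<exists>\<epsilon>. 0 < \<epsilon> \<and> \<epsilon> < 1 / (real j + 1) \<and> \<epsilon> < 1 \<and> cover_rate d \<epsilon> \<le> (D + 1 / (real j + 1)) * \<bar>ln \<epsilon>\<bar>)"

text \<open>The good metrics contain a uniform ball near any given pseudometric; the desired metric is then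
  found by a Baire category argument.\<close>
lemma robust_perturbation:
  assumes marker: "marker_property X T" and \<sigma>: "cont_pseudometric X \<sigma>"
    and rate: "\<And>\<delta>. \<delta> > 0 \<Longrightarrow> widim_rate \<delta> \<le> D" and D: "0 \<le> D" and \<tau>: "\<tau> > 0"
  shows "\<exists>\<sigma>' \<tau>'. cont_pseudometric X \<sigma>' \<and> 0 < \<tau>' \<and> \<tau>' \<le> \<tau> / 2 \<and>
    (\<forall>x\<in>X. \<forall>y\<in>X. \<bar>\<sigma>' x y - \<sigma> x y\<bar> \<le> \<tau> / 2) \<and>
    (\<forall>d. cont_pseudometric X d \<longrightarrow> (\<forall>x\<in>X. \<forall>y\<in>X. \<bar>d x y - \<sigma>' x y\<bar> \<le> \<tau>') \<longrightarrow>
       small_cover_rate D j d \<and> (\<forall>x\<in>X. \<forall>y\<in>X. 1 / (real j + 1) \<le> dist x y \<longrightarrow> 0 < d x y))"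
proof -
  define \<eta> where "\<eta> = 1 / (real j + 1)"
  have \<eta>: "\<eta> > 0" by (simp add: \<eta>_def)
  show ?thesis
  proof (rule pseudometric_perturbation[OF marker \<sigma> rate D _ \<eta> \<eta>, of "\<tau> / 4"])
    fix \<rho> :: "'a \<Rightarrow> 'a \<Rightarrow> real" and \<epsilon> :: real and L :: nat
    assume \<rho>: "cont_pseudometric X \<rho>" and \<rho>\<sigma>: "\<And>x y. x \<in> X \<Longrightarrow> y \<in> X \<Longrightarrow> \<bar>\<rho> x y - \<sigma> x y\<bar> \<le> \<tau> / 4"
      and \<epsilon>: "0 < \<epsilon>" "\<epsilon> < \<eta>" "\<epsilon> < 1" and L: "1 \<le> L"
      and bound: "cover_avg \<rho> (\<epsilon> / 4) L \<le> (D + \<eta>) * \<bar>ln \<epsilon>\<bar>"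
    obtain B where B: "B > 0" "\<And>x y. x \<in> X \<Longrightarrow> y \<in> X \<Longrightarrow> dist x y \<le> B"
      using cont_pseudometric_bounded[OF compact_X cont_pseudometric_dist] by metis
    \<comment> \<open>A small multiple of \<open>dist\<close> keeps \<open>\<sigma>'\<close> bounded
      below on pairs with \<open>dist x y\<close> at least \<open>\<eta>\<close>. Separation at one
      fixed scale, unlike separation of all points, survives uniform perturbation.\<close>
    define w where "w = min (\<tau> / 4) (\<epsilon> / 4) / B"
    have w: "w > 0" using \<tau> \<epsilon> B(1) by (simp add: w_def)
    have wB: "w * dist x y \<le> \<tau> / 4" "w * dist x y \<le> \<epsilon> / 4" "0 \<le> w * dist x y" if "x \<in> X" "y \<in> X" for x y
    proof -
      have "w * dist x y \<le> w * B" using B(2)[OF that] w by (intro mult_left_mono) auto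
      also have "\<dots> = min (\<tau> / 4) (\<epsilon> / 4)" using B(1) by (simp add: w_def)
      finally show "w * dist x y \<le> \<tau> / 4" "w * dist x y \<le> \<epsilon> / 4" by linarith+
      show "0 \<le> w * dist x y" using w by simp
    qed
    define \<sigma>' where "\<sigma>' x y = \<rho> x y + w * dist x y" for x y
    have "cont_pseudometric X (\<lambda>x y. w * dist x y)"
      unfolding cont_pseudometric_def
    proof (intro conjI ballI)
      show "continuous_on (X \<times> X) (\<lambda>z. w * dist (fst z) (snd z))" by (intro continuous_intros)
      fix x y z
      have "w * dist x z \<le> w * (dist x y + dist y z)" using w by (intro mult_left_mono dist_triangle) auto
      then show "w * dist x z \<le> w * dist x y + w * dist y z" by (simp add: distrib_left)
    qed (auto simp: dist_commute)
    then have \<sigma>': "cont_pseudometric X \<sigma>'" unfolding \<sigma>'_def by (rule cont_pseudometric_add[OF \<rho>])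
    \<comment> \<open>One term each for nesting of the balls, covering numbers and separation. The
      multiple of \<open>dist\<close> and \<open>\<tau>'\<close> contribute at most
      \<open>\<epsilon> / 4\<close> each, which fits between the scales
      \<open>\<epsilon> / 4\<close> and \<open>\<epsilon>\<close>.\<close>
    define \<tau>' where "\<tau>' = min (\<tau> / 2) (min (\<epsilon> / 4) (w * \<eta> / 2))"
    have \<tau>': "0 < \<tau>'" "\<tau>' \<le> \<tau> / 2" "\<tau>' \<le> \<epsilon> / 4" "\<tau>' \<le> w * \<eta> / 2"
      using \<tau> \<epsilon>(1) w \<eta> by (auto simp: \<tau>'_def)
    have "small_cover_rate D j d \<and> (\<forall>x\<in>X. \<forall>y\<in>X. \<eta> \<le> dist x y \<longrightarrow> 0 < d x y)"
      if d: "cont_pseudometric X d" and close: "\<forall>x\<in>X. \<forall>y\<in>X. \<bar>d x y - \<sigma>' x y\<bar> \<le> \<tau>'" for d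
    proof (intro conjI ballI impI)
      have cube: "finite (cube L :: (int^'k) set)" "(cube L :: (int^'k) set) \<noteq> {}"
        by (rule finite_cube, rule cube_nonempty[OF L])
      note pm = cont_pseudometric_dyn[OF d cube] cont_pseudometric_dyn[OF \<rho> cube]
      have "cover_num X (dyn L d) \<epsilon> \<le> cover_num X (dyn L \<rho>) (\<epsilon> / 4)"
      proof (rule cover_num_mono[OF compact_X pm(2,1)])
        fix x y assume xy: "x \<in> X" "y \<in> X"
        show "dyn L d x y \<le> dyn L \<rho> x y + \<epsilon> / 2"
          unfolding dyn_metric_le_iff[OF cube]
        proof
          fix n :: "int^'k" assume n: "n \<in> cube L"
          have Tn: "T n x \<in> X" "T n y \<in> X" using xy T_in by auto
          have "\<bar>d (T n x) (T n y) - \<sigma>' (T n x) (T n y)\<bar> \<le> \<tau>'" using close Tn by blast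
          then have "d (T n x) (T n y) \<le> \<rho> (T n x) (T n y) + \<epsilon> / 2"
            using wB(2)[OF Tn] \<tau>'(3) unfolding \<sigma>'_def by linarith
          then show "d (T n x) (T n y) \<le> dyn L \<rho> x y + \<epsilon> / 2"
            using dyn_metric_ge[OF cube(1) n, of \<rho> T x y] by linarith
        qed
      qed (use \<epsilon> in auto)
      moreover have "1 \<le> cover_num X (dyn L d) \<epsilon>"
        using cover_num_pos[OF compact_X pm(1) \<epsilon>(1) nonempty] .
      ultimately have "cover_avg d \<epsilon> L
          \<le> cover_avg \<rho> (\<epsilon> / 4) L"
        by (intro divide_right_mono ln_mono) auto
      then have "cover_rate d \<epsilon> \<le> (D + \<eta>) * \<bar>ln \<epsilon>\<bar>"
        using cover_rate_le[OF d \<epsilon>(1) L] bound by linarith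
      then show "small_cover_rate D j d"
        unfolding small_cover_rate_def \<eta>_def[symmetric] using \<epsilon> by (intro exI[of _ \<epsilon>]) simp
      fix x y assume xy: "x \<in> X" "y \<in> X" "\<eta> \<le> dist x y"
      have "w * \<eta> \<le> w * dist x y" using xy(3) w by (intro mult_left_mono) auto
      moreover have "\<bar>d x y - \<sigma>' x y\<bar> \<le> \<tau>'" using close xy by blast
      moreover have "0 < w * \<eta>" using w \<eta> by simp
      ultimately show "0 < d x y"
        using cont_pseudometric_nonneg[OF \<rho> xy(1,2)] \<tau>'(4) unfolding \<sigma>'_def by linarith
    qed
    moreover have "\<bar>\<sigma>' x y - \<sigma> x y\<bar> \<le> \<tau> / 2" if "x \<in> X" "y \<in> X" for x y
      using \<rho>\<sigma>[OF that] wB[OF that] unfolding \<sigma>'_def by linarith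
    ultimately show ?thesis unfolding \<eta>_def[symmetric] using \<sigma>' \<tau>'(1,2)
      by (intro exI[of _ \<sigma>'] exI[of _ \<tau>']) simp
  qed (use \<tau> in auto)
qed

text \<open>The limit of the nested balls lies in all of them and inherits every
  \<open>good j\<close>. Distinct points are at distance at least \<open>1 / (j + 1)\<close> for
  some \<open>j\<close>, and are separated by that property.\<close>

lemma metric_with_small_cover_rates:
  assumes marker: "marker_property X T" and rate: "\<And>\<delta>. \<delta> > 0 \<Longrightarrow> widim_rate \<delta> \<le> D" and D: "0 \<le> D"
  obtains d where "cont_pseudometric X d" "\<And>x y. x \<in> X \<Longrightarrow> y \<in> X \<Longrightarrow> d x y = 0 \<Longrightarrow> x = y"
    "\<And>j. small_cover_rate D j d" "\<And>x y. x \<notin> X \<or> y \<notin> X \<Longrightarrow> d x y = 0"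
proof -
  define near where "near c a b \<longleftrightarrow> (\<forall>x\<in>X. \<forall>y\<in>X. \<bar>a x y - b x y\<bar> \<le> (c::real))"
    for c and a b :: "'a \<Rightarrow> 'a \<Rightarrow> real"
  define good where "good j d \<longleftrightarrow> small_cover_rate D j d \<and>
      (\<forall>x\<in>X. \<forall>y\<in>X. 1 / (real j + 1) \<le> dist x y \<longrightarrow> 0 < d x y)" for j and d :: "'a \<Rightarrow> 'a \<Rightarrow> real"
  have "\<exists>F. \<forall>j. (cont_pseudometric X (fst (F j)) \<and> 0 < (snd (F j) :: real)) \<and>
      (snd (F (Suc j)) \<le> snd (F j) / 2 \<and> near (snd (F j) / 2) (fst (F (Suc j))) (fst (F j)) \<and>
       (\<forall>d. cont_pseudometric X d \<longrightarrow> near (snd (F (Suc j))) d (fst (F (Suc j))) \<longrightarrow> good j d))"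
  proof (rule dependent_nat_choice)
    show "\<exists>F :: ('a \<Rightarrow> 'a \<Rightarrow> real) \<times> real. cont_pseudometric X (fst F) \<and> 0 < snd F"
      using cont_pseudometric_dist by (intro exI[of _ "(dist, 1)"]) simp
    fix F :: "('a \<Rightarrow> 'a \<Rightarrow> real) \<times> real" and j :: nat
    assume F: "cont_pseudometric X (fst F) \<and> 0 < snd F"
    then show "\<exists>F'. (cont_pseudometric X (fst F') \<and> 0 < snd F') \<and>
        snd F' \<le> snd F / 2 \<and> near (snd F / 2) (fst F') (fst F) \<and>
       (\<forall>d. cont_pseudometric X d \<longrightarrow> near (snd F') d (fst F') \<longrightarrow> good j d)"
      using robust_perturbation[OF marker _ rate D, of "fst F" "snd F" j]
      unfolding near_def good_def by simp
  qed
  then obtain F where F: "\<And>j. cont_pseudometric X (fst (F j))" "\<And>j. 0 < (snd (F j) :: real)"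
    "\<And>j. snd (F (Suc j)) \<le> snd (F j) / 2" "\<And>j. near (snd (F j) / 2) (fst (F (Suc j))) (fst (F j))"
    "\<And>j d. cont_pseudometric X d \<Longrightarrow> near (snd (F (Suc j))) d (fst (F (Suc j))) \<Longrightarrow> good j d" by blast
  define s where "s j = fst (F j)" for j
  define \<tau> where "\<tau> j = snd (F j)" for j
  \<comment> \<open>A step moves by at most half the current radius, and halving makes this at most
    the drop \<open>\<tau> j - \<tau> (Suc j)\<close>; so the displacements telescope.\<close>
  have tail: "\<bar>s (j + i) x y - s j x y\<bar> \<le> \<tau> j - \<tau> (j + i)" if xy: "x \<in> X" "y \<in> X" for i j x y
  proof (induction i)
    case (Suc i)
    have "\<bar>s (Suc (j + i)) x y - s (j + i) x y\<bar> \<le> \<tau> (j + i) / 2"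
      using F(4)[of "j + i"] xy unfolding near_def s_def \<tau>_def by blast
    moreover have "\<tau> (Suc (j + i)) \<le> \<tau> (j + i) / 2" using F(3) unfolding \<tau>_def .
    ultimately show ?case using Suc unfolding add_Suc_right by linarith
  qed simp
  have \<tau>0: "\<tau> \<longlonglongrightarrow> 0"
  proof (rule tendsto_sandwich[OF _ _ tendsto_const])
    have "\<tau> j \<le> \<tau> 0 * (1 / 2) ^ j" for j
    proof (induction j)
      case (Suc j)
      then show ?case using F(3)[of j] unfolding \<tau>_def by simp
    qed simp
    then show "\<forall>\<^sub>F j in sequentially. \<tau> j \<le> \<tau> 0 * (1 / 2) ^ j" by simp
    show "(\<lambda>j. \<tau> 0 * (1 / 2) ^ j) \<longlonglongrightarrow> 0"
      by (intro tendsto_mult_right_zero LIMSEQ_realpow_zero) auto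
    show "\<forall>\<^sub>F j in sequentially. 0 \<le> \<tau> j" using F(2) by (simp add: \<tau>_def less_imp_le)
  qed
  have step: "\<bar>s i x y - s j x y\<bar> \<le> \<tau> j" if "x \<in> X" "y \<in> X" "j \<le> i" for i j x y
    using tail[OF that(1,2), of j "i - j"] that(3) F(2)[of i] by (simp add: \<tau>_def)
  have conv: "convergent (\<lambda>n. s n x y)" if xy: "x \<in> X" "y \<in> X" for x y
    unfolding Cauchy_convergent_iff[symmetric]
  proof (rule metric_CauchyI)
    fix e :: real assume "0 < e"
    then have "\<forall>\<^sub>F j in sequentially. \<tau> j < e / 2" by (intro order_tendstoD(2)[OF \<tau>0]) simp
    then obtain j where j: "\<tau> j < e / 2" using eventually_happens'[OF sequentially_bot] by blast
    have "dist (s m x y) (s n x y) < e" if "j \<le> m" "j \<le> n" for m n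
      using step[OF xy that(1)] step[OF xy that(2)] j by (simp add: dist_real_def)
    then show "\<exists>M. \<forall>m\<ge>M. \<forall>n\<ge>M. dist (s m x y) (s n x y) < e" by blast
  qed
  \<comment> \<open>\<open>Metric_space\<close> demands symmetry and nonnegativity on the whole
    type, hence a value outside \<open>X\<close>.\<close>
  define d where "d x y = (if x \<in> X \<and> y \<in> X then lim (\<lambda>n. s n x y) else 0)" for x y
  have lim: "(\<lambda>n. s n x y) \<longlonglongrightarrow> d x y" if "x \<in> X" "y \<in> X" for x y
    using conv[OF that] that by (simp add: d_def convergent_LIMSEQ_iff)
  have close: "\<bar>d x y - s j x y\<bar> \<le> \<tau> j" if xy: "x \<in> X" "y \<in> X" for x y j
  proof (rule LIMSEQ_le_const2)
    show "(\<lambda>n. \<bar>s n x y - s j x y\<bar>) \<longlonglongrightarrow> \<bar>d x y - s j x y\<bar>" by (intro tendsto_intros lim xy)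
    show "\<exists>N. \<forall>n\<ge>N. \<bar>s n x y - s j x y\<bar> \<le> \<tau> j" using step[OF xy] by blast
  qed
  note spm = F(1)[folded s_def]
  have d: "cont_pseudometric X d" unfolding cont_pseudometric_def
  proof (intro conjI ballI)
    show "continuous_on (X \<times> X) (\<lambda>z. d (fst z) (snd z))"
    proof (rule uniform_limit_theorem)
      show "\<forall>\<^sub>F n in sequentially. continuous_on (X \<times> X) (\<lambda>z. s n (fst z) (snd z))"
        by (intro always_eventually allI cont_pseudometricD(1) spm)
      show "uniform_limit (X \<times> X) (\<lambda>n z. s n (fst z) (snd z)) (\<lambda>z. d (fst z) (snd z)) sequentially"
      proof (rule uniform_limitI)
        fix e :: real assume "0 < e"
        then have "\<forall>\<^sub>F j in sequentially. \<tau> j < e" using order_tendstoD(2)[OF \<tau>0] by simp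
        then show "\<forall>\<^sub>F n in sequentially. \<forall>z\<in>X \<times> X. dist (s n (fst z) (snd z)) (d (fst z) (snd z)) < e"
        proof eventually_elim
          fix n assume n: "\<tau> n < e"
          show "\<forall>z\<in>X \<times> X. dist (s n (fst z) (snd z)) (d (fst z) (snd z)) < e"
          proof
            fix z assume "z \<in> X \<times> X"
            then have "\<bar>d (fst z) (snd z) - s n (fst z) (snd z)\<bar> \<le> \<tau> n" by (intro close) auto
            then show "dist (s n (fst z) (snd z)) (d (fst z) (snd z)) < e" using n by (simp add: dist_real_def)
          qed
        qed
      qed
    qed simp
    fix x y z assume xyz: "x \<in> X" "y \<in> X" "z \<in> X"
    show "d x z \<le> d x y + d y z"
      by (rule LIMSEQ_le[OF lim[OF xyz(1,3)] tendsto_add[OF lim[OF xyz(1,2)] lim[OF xyz(2,3)]]])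
        (use cont_pseudometricD(4)[OF spm xyz] in blast)
  next
    fix x y assume xy: "x \<in> X" "y \<in> X"
    show "d x x = 0" using LIMSEQ_unique[OF lim[OF xy(1,1)], of 0] cont_pseudometricD(2)[OF spm xy(1)] by simp
    show "d x y = d y x"
      using LIMSEQ_unique[OF lim[OF xy], of "d y x"] lim[OF xy(2,1)] cont_pseudometricD(3)[OF spm xy] by simp
  qed
  have good: "good j d" for j
    using close by (intro F(5)[OF d]) (auto simp: near_def s_def \<tau>_def)
  show ?thesis
  proof (rule that[OF d])
    fix x y assume xy: "x \<in> X" "y \<in> X" "d x y = 0"
    show "x = y"
    proof (rule ccontr)
      assume "x \<noteq> y"
      then obtain j where "inverse (real (Suc j)) < dist x y" using reals_Archimedean[of "dist x y"] by auto
      then have "1 / (real j + 1) \<le> dist x y" by (simp add: inverse_eq_divide add.commute)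
      then have "0 < d x y" using good[of j] xy(1,2) unfolding good_def by blast
      then show False using xy(3) by simp
    qed
  next
    show "small_cover_rate D j d" for j using good[of j] unfolding good_def by blast
    show "d x y = 0" if "x \<notin> X \<or> y \<notin> X" for x y using that by (auto simp: d_def)
  qed
qed

text \<open>The scales at which the quotient is at most \<open>D + 1 / (j + 1)\<close> accumulate at
  0, which bounds the lower limit.\<close>

lemma mdim_M_le:
  assumes d: "cont_pseudometric X d" and small: "\<And>j. small_cover_rate D j d"
  shows "mdim_M X T d \<le> ereal D"
proof (rule ccontr)
  assume "\<not> mdim_M X T d \<le> ereal D"
  then have "ereal D < mdim_M X T d" by simp
  then obtain y where y: "D < y" "ereal y < mdim_M X T d" using ereal_dense2 by (metis less_ereal.simps(1))
  have "\<forall>\<^sub>F e in at_right 0. ereal y < ereal (cover_rate d e / \<bar>ln e\<bar>)"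
    using y(2) unfolding mdim_M_eq[OF d] by (rule less_LiminfD)
  then obtain b where b: "b > 0" "\<And>e. 0 < e \<Longrightarrow> e < b \<Longrightarrow> y < cover_rate d e / \<bar>ln e\<bar>"
    unfolding eventually_at_right_field by auto
  obtain j where "inverse (real (Suc j)) < min b (y - D)" using reals_Archimedean[of "min b (y - D)"] b(1) y(1) by auto
  then have j: "1 / (real j + 1) < b" "D + 1 / (real j + 1) < y" by (auto simp: inverse_eq_divide add.commute)
  obtain e where e: "0 < e" "e < 1 / (real j + 1)" "e < 1" "cover_rate d e \<le> (D + 1 / (real j + 1)) * \<bar>ln e\<bar>"
    using small[of j] unfolding small_cover_rate_def by blast
  have "0 < \<bar>ln e\<bar>" using e by simp
  then have "cover_rate d e / \<bar>ln e\<bar> \<le> D + 1 / (real j + 1)" using e(4) by (simp add: pos_divide_le_eq)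
  then show False using b(2)[OF e(1)] e(2) j by linarith
qed

lemma Metric_space_if_separating:
  assumes d: "cont_pseudometric X d" and sep: "\<And>x y. x \<in> X \<Longrightarrow> y \<in> X \<Longrightarrow> d x y = 0 \<Longrightarrow> x = y"
    and out: "\<And>x y. x \<notin> X \<or> y \<notin> X \<Longrightarrow> d x y = 0"
  shows "Metric_space X d"
proof
  show "0 \<le> d x y" for x y
    using cont_pseudometric_nonneg[OF d, of x y] out[of x y] by (cases "x \<in> X \<and> y \<in> X") auto
  show "d x y = d y x" for x y
    using cont_pseudometricD(3)[OF d, of x y] out[of x y] out[of y x] by (cases "x \<in> X \<and> y \<in> X") auto
  show "d x y = 0 \<longleftrightarrow> x = y" if "x \<in> X" "y \<in> X" for x y
    using sep[OF that] cont_pseudometricD(2)[OF d that(1)] by auto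
  show "d x z \<le> d x y + d y z" if "x \<in> X" "y \<in> X" "z \<in> X" for x y z
    using cont_pseudometricD(4)[OF d that] .
qed

end

theorem theorem1p4:
  fixes X :: "'a::metric_space set" and T :: "int^'k::finite \<Rightarrow> 'a \<Rightarrow> 'a"
  assumes "X \<noteq> {}" and "Zk_system X T" and "marker_property X T"
  shows "\<exists>d. Metric_space X d \<and> Metric_space.mtopology X d = top_of_set X \<and>
             mdim_M X T d = mdim X T"
proof -
  interpret Zk_action X T using assms by unfold_locales
  obtain d where d: "cont_pseudometric X d" "\<And>x y. x \<in> X \<Longrightarrow> y \<in> X \<Longrightarrow> d x y = 0 \<Longrightarrow> x = y"
    "mdim_M X T d \<le> mdim X T" "\<And>x y. x \<notin> X \<or> y \<notin> X \<Longrightarrow> d x y = 0"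
  proof (cases "mdim X T = \<infinity>")
    \<comment> \<open>Here the upper bound is trivial and the lower bound holds for every compatible
      metric, so the given one serves.\<close>
    case True
    define d where "d x y = (if x \<in> X \<and> y \<in> X then dist x y else 0)" for x y
    have "continuous_on (X \<times> X) (\<lambda>z. d (fst z) (snd z)) \<longleftrightarrow> continuous_on (X \<times> X) (\<lambda>z. dist (fst z) (snd z))"
      by (rule continuous_on_cong) (auto simp: d_def)
    then have pm: "cont_pseudometric X d"
      using cont_pseudometricD(1)[OF cont_pseudometric_dist, of X]
      by (auto simp: cont_pseudometric_def d_def dist_commute dist_triangle)
    show ?thesis
    proof (rule that[OF pm])
      show "x = y" if "x \<in> X" "y \<in> X" "d x y = 0" for x y using that by (simp add: d_def)
      show "d x y = 0" if "x \<notin> X \<or> y \<notin> X" for x y using that by (auto simp: d_def)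
    qed (use True in simp)
  next
    case False
    have 0: "0 \<le> widim_rate e" for e unfolding widim_rate_def by (intro cINF_greatest) auto
    have le: "ereal (widim_rate e) \<le> mdim X T" if "e > 0" for e
      unfolding mdim_eq using that by (intro SUP_upper) auto
    have "0 \<le> mdim X T" using le[of 1] 0[of 1] by (meson ereal_less_eq(5) order_trans zero_less_one)
    with False obtain D where D: "mdim X T = ereal D" "0 \<le> D" by (cases "mdim X T") auto
    have rate: "widim_rate e \<le> D" if "e > 0" for e using le[OF that] D(1) by simp
    show ?thesis
    proof (rule metric_with_small_cover_rates[OF assms(3) rate D(2)])
      fix d assume "cont_pseudometric X d" "\<And>x y. x \<in> X \<Longrightarrow> y \<in> X \<Longrightarrow> d x y = 0 \<Longrightarrow> x = y"
        "\<And>j. small_cover_rate D j d" "\<And>x y. x \<notin> X \<or> y \<notin> X \<Longrightarrow> d x y = 0"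
      then show ?thesis using that[of d] mdim_M_le[of d D] D(1) by simp
    qed
  qed
  have "Metric_space X d" using Metric_space_if_separating d(1,2,4) by simp
  moreover have "Metric_space.mtopology X d = top_of_set X"
    using mtopology_eq_top_of_set[OF compact_X d(1) _ calculation] d(2) by blast
  moreover have "mdim_M X T d = mdim X T"
    using mdim_le_mdim_M[OF d(1)] d(2,3) by (simp add: antisym)
  ultimately show ?thesis by blast
qed

end
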